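(* Let $0<\alpha\leq 1$ and let $s>s_\alpha$. Then there exist $\nu>0$ and $\delta>0$ such that for any $T>0$ and any $u,v\in X^{1/2,s}_\alpha$ with compact support (in time) in $[-T,T]$, $$\|\partial_x(uv)\|_{X^{-1/2+\delta,s}_\alpha}\lesssim T^\nu\,\|u\|_{X^{1/2,s}_\alpha}\|v\|_{X^{1/2,s}_\alpha},$$ where the implicit constant does not depend on $T$, $u$, $v$.
   Context: For $0<\alpha\le 1$ set $s_\alpha=-3/4$ if $0<\alpha\leq 1/2$ and $s_\alpha=-\frac{3}{5-2\alpha}$ if $1/2<\alpha\leq 1$. For a function $u(t,x)$ on $\mathbb{R}^2$, $\widehat{u}(\tau,\xi)$ denotes its space-time Fourier transform ($\tau$ dual to $t$, $\xi$ dual to $x$), $\langle\cdot\rangle=(1+|\cdot|^2)^{1/2}$, and for $b,s\in\mathbb{R}$ the space $X^{b,s}_\alpha$ is defined by the norm $$\|u\|_{X^{b,s}_\alpha}=\big\|\langle i(\tau-\xi^3)+|\xi|^{2\alpha}\rangle^b\langle\xi\rangle^s\widehat{u}(\tau,\xi)\big\|_{L^2(\mathbb{R}^2)}.$$ $A\lesssim B$ means $A\le CB$ for a constant $C>0$. *)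

theory Defs
  imports "HOL-Analysis.Analysis"
begin

text \<open>Everything is formulated on the Fourier side: a (tempered) distribution u(t,x)
  is represented by its space-time Fourier transform F = u-hat :: real*real => complex,
  where a point zeta = (tau, xi), tau dual to t, xi dual to x.\<close>

definition s_alpha :: "real \<Rightarrow> real" where
  "s_alpha \<alpha> = (if \<alpha> \<le> 1/2 then -3/4 else -3 / (5 - 2*\<alpha>))"

definition jbr :: "complex \<Rightarrow> real" where
  "jbr z = sqrt (1 + (cmod z)\<^sup>2)"

definition Xsq :: "real \<Rightarrow> real \<Rightarrow> real \<Rightarrow> (real \<times> real \<Rightarrow> complex) \<Rightarrow> ennreal" where
  "Xsq \<alpha> b s F = (\<integral>\<^sup>+ \<zeta>. ennreal ((jbr (\<i> * complex_of_real (fst \<zeta> - (snd \<zeta>)^3)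
        + complex_of_real (\<bar>snd \<zeta>\<bar> powr (2*\<alpha>))) powr b
        * jbr (complex_of_real (snd \<zeta>)) powr s * cmod (F \<zeta>))\<^sup>2) \<partial>lborel)"

definition in_X :: "real \<Rightarrow> real \<Rightarrow> real \<Rightarrow> (real \<times> real \<Rightarrow> complex) \<Rightarrow> bool" where
  "in_X \<alpha> b s F \<longleftrightarrow> F \<in> borel_measurable lborel \<and> Xsq \<alpha> b s F < \<infinity>"

definition smooth2 :: "(real \<times> real \<Rightarrow> complex) \<Rightarrow> bool" where
  "smooth2 f \<longleftrightarrow> (\<exists>g :: nat \<Rightarrow> nat \<Rightarrow> real \<times> real \<Rightarrow> complex.
      g 0 0 = f \<and>
      (\<forall>j k. continuous_on UNIV (g j k)) \<and>
      (\<forall>j k p. ((\<lambda>t. g j k (t, snd p)) has_vector_derivative g (Suc j) k p) (at (fst p))) \<and>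
      (\<forall>j k p. ((\<lambda>x. g j k (fst p, x)) has_vector_derivative g j (Suc k) p) (at (snd p))))"

definition test_fun :: "(real \<times> real \<Rightarrow> complex) \<Rightarrow> bool" where
  "test_fun \<phi> \<longleftrightarrow> smooth2 \<phi> \<and> compact (closure {p. \<phi> p \<noteq> 0})"

definition fourier2 :: "(real \<times> real \<Rightarrow> complex) \<Rightarrow> real \<times> real \<Rightarrow> complex" where
  "fourier2 \<phi> \<zeta> = (LINT p|lborel. \<phi> p * cis (- (fst p * fst \<zeta> + snd p * snd \<zeta>)))"

text \<open>The distribution u with Fourier transform F has (time) support in [-T,T]:
  u(phi) = (2 pi)^(-2) * integral F(zeta) phi-hat(-zeta) vanishes for every test function phi
  whose support is disjoint from [-T,T] x R.\<close>
definition time_supp_in :: "real \<Rightarrow> (real \<times> real \<Rightarrow> complex) \<Rightarrow> bool" where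
  "time_supp_in T F \<longleftrightarrow> (\<forall>\<phi>. test_fun \<phi> \<and> closure {p. \<phi> p \<noteq> 0} \<inter> ({-T..T} \<times> UNIV) = {}
        \<longrightarrow> (LINT \<zeta>|lborel. F \<zeta> * fourier2 \<phi> (- \<zeta>)) = 0)"

text \<open>Fourier transform of d_x(u v) where u-hat = F, v-hat = G:
  i xi (2 pi)^(-2) (F * G)(tau, xi).\<close>
definition dx_prod :: "(real \<times> real \<Rightarrow> complex) \<Rightarrow> (real \<times> real \<Rightarrow> complex) \<Rightarrow> real \<times> real \<Rightarrow> complex" where
  "dx_prod F G \<zeta> = \<i> * complex_of_real (snd \<zeta>) / complex_of_real ((2*pi)\<^sup>2)
      * (LINT \<eta>|lborel. F \<eta> * G (\<zeta> - \<eta>))"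

end

theory Submission
  imports Defs "HOL-Probability.Characteristic_Functions"
begin

text \<open>Let \<open>\<lambda>(\<tau>, \<xi>) = \<langle>i(\<tau> - \<xi>\<^sup>3) + \<bar>\<xi>\<bar>\<^bsup>2\<alpha>\<^esup>\<rangle>\<close>.

  A time support in \<open>[-T, T]\<close> makes \<open>F(\<sqdot>, \<xi>)\<close> equal to its convolution with the Fourier transform of a cutoff
  at scale \<open>T\<close>, so \<open>\<bar>F(\<tau>, \<xi>)\<bar>\<^sup>2 \<lesssim> T \<integral>\<bar>F(\<tau>', \<xi>)\<bar>\<^sup>2 d\<tau>'\<close>. Hence the region \<open>\<bar>\<tau> - \<xi>\<^sup>3\<bar> < c/T\<close> carries at most
  half of the mass of \<open>F\<close>, and lowering the exponent of \<open>\<lambda>\<close> from \<open>1/2\<close> to \<open>1/2 - \<epsilon>\<close> gains \<open>T\<^bsup>\<epsilon>\<^esup>\<close>.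

  It remains to prove the bilinear estimate with all modulation exponents \<open>1/2 - \<epsilon>\<close>. By the resonance relation the
  largest of the three modulations is at least \<open>\<bar>\<xi> \<xi>\<^sub>1 \<xi>\<^sub>2\<bar>\<close>. Spending most of it on the frequency weights leaves the
  other two with exponents above \<open>1\<close>, so that one Cauchy--Schwarz inequality, with the square of the kernel integrated
  against the output or against one of the inputs, reduces everything to bounds of the form
  \<open>sup\<^sub>\<zeta> \<integral> k(\<zeta>, \<eta>)\<^sup>2 d\<eta> < \<infinity>\<close>. The condition on \<open>s\<close> for \<open>\<alpha> > 1/2\<close> is where two such bounds balance, at an output frequency
  \<open>\<bar>\<xi>\<bar> \<sim> \<bar>\<xi>\<^sub>1\<bar>\<^bsup>\<alpha> - 1/2\<^esup>\<close> produced by two inputs of size \<open>\<bar>\<xi>\<^sub>1\<bar>\<close>.\<close>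

section \<open>Pointwise bounds for the bilinear weight\<close>

text \<open>The uniform kernel bounds come from one change of variables. With the outer point
  (\<tau>, \<xi>) fixed, the two inner modulations add up to a quadratic polynomial in the inner
  frequency, with leading coefficient -3\<xi> and vertex \<xi>/2. Its Jacobian, of size |\<xi>|
  |2\<xi>_1 - \<xi>|, is an admissible weight wherever it is not too small. Where it degenerates,
  all three frequencies are comparable and only |\<xi>|^(1/2) can be integrated; the dissipative
  part of the modulation then supplies the missing factor |\<xi>|^\<alpha>. Frequencies too low for
  both weights are covered by an integrable singular weight, after the dissipation at a high
  frequency has cancelled one modulation. The pointwise task is to bound the squared multiplier by
  these three weights.

  The obstacle in the time localization is that the support condition only admits test functions
  compactly supported in both variables, while F is merely in a weighted L^2 space. The convolution
  identity is therefore reached through cutoffs of scale n in both variables, integrated over boxes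
  of centres so that n may tend to infinity.\<close>

abbreviation jap :: "real \<Rightarrow> real" where "jap x \<equiv> sqrt (1 + x\<^sup>2)"

section \<open>Elementary bounds for the bracket and for real powers\<close>

lemma jap_pos: "0 < jap x" by (simp add: add_pos_nonneg)
lemma abs_le_jap: "\<bar>x\<bar> \<le> jap x" by (rule real_le_rsqrt) auto
lemma jap_le_add: "jap x \<le> 1 + \<bar>x\<bar>" by (rule real_le_lsqrt) (auto simp: power2_eq_square algebra_simps)

lemma jap_powr_upper:
  assumes "0 \<le> t" "t \<le> 2" "1 \<le> B" "\<bar>x\<bar> \<le> B"
  shows "jap x powr t \<le> 4 * B powr t"
proof -
  have "jap x powr t \<le> (2 * B) powr t"
    using assms jap_le_add[of x] by (intro powr_mono2) (auto intro: less_imp_le[OF jap_pos])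
  also have "\<dots> = 2 powr t * B powr t" using assms by (simp add: powr_mult)
  also have "2 powr t \<le> 2 powr (2::real)" using assms by (intro powr_mono) auto
  then have "2 powr t * B powr t \<le> 4 * B powr t"
    by (intro mult_right_mono) (auto simp: powr_numeral)
  finally show ?thesis .
qed

lemma jap_powr_bounded:
  assumes "0 \<le> t" "t \<le> 2" shows "jap x powr t \<le> 1 + x\<^sup>2"
proof -
  have "jap x powr t \<le> jap x powr 2" using assms by (intro powr_mono) auto
  also have "\<dots> = 1 + x\<^sup>2" using jap_pos[of x] by (simp add: powr_numeral)
  finally show ?thesis .
qed

lemma jap_powr_neg_le:
  assumes "0 \<le> t" "0 < A" "A \<le> \<bar>x\<bar>" shows "jap x powr (-t) \<le> A powr (-t)"
  using assms abs_le_jap[of x] by (intro powr_mono2') auto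

text \<open>A negative power of a quantity known up to a factor \<open>K\<close> loses at most
  \<open>K^n\<close>, uniformly in the exponent \<open>t\<close>. This keeps the numerical constants
  below independent of \<rho> and \<kappa>.\<close>

lemma powr_minus_scale:
  fixes B K t n :: real
  assumes "0 \<le> t" "t \<le> n" "1 \<le> K" "0 < B" shows "(B / K) powr (-t) \<le> K powr n * B powr (-t)"
proof -
  have "(B / K) powr (-t) = K powr t * B powr (-t)"
    using assms by (simp add: powr_divide powr_minus divide_simps)
  also have "\<dots> \<le> K powr n * B powr (-t)" using assms by (intro mult_right_mono powr_mono) auto
  finally show ?thesis .
qed

lemma powr_one_bound: "1 \<le> B \<Longrightarrow> t \<le> 0 \<Longrightarrow> B powr t \<le> (1::real)"
  using powr_mono[of t 0 B] by simp

lemma powr_mult3: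
  fixes a b c t :: real
  assumes "0 \<le> a" "0 \<le> b" "0 \<le> c" shows "(a * b * c) powr t = a powr t * b powr t * c powr t"
  using assms by (simp add: powr_mult)

lemma powr_ge_of_scale:
  fixes B K t :: real
  assumes "0 \<le> t" "t \<le> 1" "1 \<le> K" "0 < B" shows "B powr t / K \<le> (B / K) powr t"
proof -
  have "K powr t \<le> K powr 1" using assms(2,3) by (rule powr_mono)
  then show ?thesis using assms by (simp add: powr_divide frac_le)
qed

text \<open>Here \<open>s = -\<rho>\<close>, and \<open>\<kappa>\<close> measures the loss in the modulation exponents. The conditions \<open>e4\<close> and \<open>e5\<close> come from the
  two competing bounds for a low output produced by two high inputs; for small \<open>\<kappa>\<close> both amount to
  \<open>\<rho> < - s_alpha \<alpha>\<close> when \<open>\<alpha> > 1/2\<close>, and \<open>e4\<close> alone does so when \<open>\<alpha> \<le> 1/2\<close>.\<close>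
locale exponents =
  fixes \<alpha> \<rho> \<kappa> \<beta> r :: real
  assumes al: "0 < \<alpha>" "\<alpha> \<le> 1"
    and rho: "1/2 < \<rho>" "\<rho> < 1"
    and beta: "\<beta> = max (\<alpha> - 1/2) 0"
    and kap: "0 < \<kappa>" "\<kappa> < 1"
    and r1: "1 < r"
    and e1: "1 + \<kappa> \<le> 2*\<rho>"
    and e2: "2*\<rho> + \<kappa> \<le> 2"
    and e3: "2*\<rho> + 3*\<kappa> \<le> 3/2 + \<alpha>"
    and e4: "4*\<rho> - 3 + 2*\<kappa> + \<beta>*(\<kappa> - 2*\<rho>) \<le> 0"
    and e5: "\<beta> = 0 \<or> \<beta>*(2 - 2*\<rho>) + 4*\<rho> - 2 + 2*\<kappa> + \<beta>*\<kappa> \<le> 2*\<alpha>"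
    and e6: "2*\<kappa> + \<beta>*\<kappa> \<le> 2*\<alpha>"
begin

text \<open>The square of the multiplier \<xi> <\<xi>>^s <\<xi>_1>^(-s) <\<xi>_2>^(-s) at s =
  -\<rho>, with \<open>x\<close> the output and \<open>y\<close>, \<open>z\<close> the input
  frequencies. Squares are natural because Cauchy-Schwarz integrates the square of the
  kernel.\<close>

definition wgt :: "real \<Rightarrow> real \<Rightarrow> real \<Rightarrow> real" where
  "wgt x y z = x\<^sup>2 * jap x powr (-2*\<rho>) * jap y powr (2*\<rho>) * jap z powr (2*\<rho>)"

text \<open>An integrable singular weight in \<open>v\<close>, normalised so that its mass is bounded uniformly in \<open>u\<close>.\<close>
definition lowf :: "real \<Rightarrow> real \<Rightarrow> real" where
  "lowf u v = (if \<bar>v\<bar> \<le> 10 * jap u powr \<beta> then \<bar>v\<bar> powr (\<kappa> - 1) * (10 * jap u powr \<beta>) powr (-\<kappa>) else 0)"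

lemma beta_bounds: "0 \<le> \<beta>" "\<beta> \<le> 1/2" using beta al by (auto simp: max_def)

lemma lowf_nonneg: "0 \<le> lowf u v" by (simp add: lowf_def)
lemma wgt_nonneg: "0 \<le> wgt x y z" by (simp add: wgt_def)
lemma wgt_commute: "wgt x y z = wgt x z y" by (simp add: wgt_def)

text \<open>\<open>B\<close> is a frequency dominating half of \<open>jap u\<close>. The
  normalisation of \<open>lowf\<close> then costs only B^(-\<beta>\<kappa>), which is where the term
  \<beta>\<kappa> in \<open>e5\<close> and \<open>e6\<close> comes from.\<close>

lemma lowf_ge:
  assumes "v \<noteq> 0" "\<bar>v\<bar> \<le> 10 * jap u powr \<beta>" "jap u \<le> 2 * B" "1 \<le> B"
  shows "\<bar>v\<bar> powr (\<kappa> - 1) * B powr (-\<beta>*\<kappa>) / 20 \<le> lowf u v"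
proof -
  have "jap u powr \<beta> \<le> (2 * B) powr \<beta>"
    using assms beta_bounds jap_pos[of u] by (intro powr_mono2) auto
  also have "\<dots> = 2 powr \<beta> * B powr \<beta>" using assms by (simp add: powr_mult)
  also have "\<dots> \<le> 2 powr 1 * B powr \<beta>" using beta_bounds by (intro mult_right_mono powr_mono) auto
  finally have "10 * jap u powr \<beta> \<le> 20 * B powr \<beta>" by simp
  then have "(20 * B powr \<beta>) powr (-\<kappa>) \<le> (10 * jap u powr \<beta>) powr (-\<kappa>)"
    using kap jap_pos[of u] by (intro powr_mono2') auto
  moreover have "(20 * B powr \<beta>) powr (-\<kappa>) = 20 powr (-\<kappa>) * B powr (-\<beta>*\<kappa>)"
    using assms by (simp add: powr_mult powr_powr)
  moreover have "(20::real) powr (-1) \<le> 20 powr (-\<kappa>)" using kap by (intro powr_mono) auto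
  then have "B powr (-\<beta>*\<kappa>) / 20 \<le> 20 powr (-\<kappa>) * B powr (-\<beta>*\<kappa>)"
    using mult_right_mono[of "20 powr (-1)" "20 powr (-\<kappa>)" "B powr (-\<beta>*\<kappa>)"]
    by (simp add: powr_minus_divide)
  ultimately have "B powr (-\<beta>*\<kappa>) / 20 \<le> (10 * jap u powr \<beta>) powr (-\<kappa>)" by linarith
  then have "\<bar>v\<bar> powr (\<kappa> - 1) * (B powr (-\<beta>*\<kappa>) / 20) \<le> \<bar>v\<bar> powr (\<kappa> - 1) * (10 * jap u powr \<beta>) powr (-\<kappa>)"
    by (intro mult_left_mono) auto
  then show ?thesis using assms by (simp add: lowf_def)
qed

lemma lowf_ge_low:
  assumes "v \<noteq> 0" "\<bar>v\<bar> \<le> 2" "\<bar>u\<bar> \<le> 4"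
  shows "1/200 \<le> lowf u v"
proof -
  have j: "1 \<le> jap u powr \<beta>" using beta_bounds by (intro ge_one_powr_ge_zero) auto
  have "jap u \<le> 2 * 4" using jap_le_add[of u] assms by auto
  then have "\<bar>v\<bar> powr (\<kappa> - 1) * 4 powr (-\<beta>*\<kappa>) / 20 \<le> lowf u v"
    using assms j by (intro lowf_ge) auto
  moreover have "2 powr (\<kappa>-1) \<le> \<bar>v\<bar> powr (\<kappa> - 1)"
    using kap assms by (intro powr_mono2') auto
  moreover have "(2::real) powr (-1) \<le> 2 powr (\<kappa>-1)" using kap by (intro powr_mono) auto
  moreover have "\<beta> * \<kappa> \<le> 1/2 * 1" using beta_bounds kap by (intro mult_mono) auto
  then have "(4::real) powr (-1) \<le> 4 powr (-\<beta>*\<kappa>)" by (intro powr_mono) auto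
  ultimately have v: "1/2 \<le> \<bar>v\<bar> powr (\<kappa> - 1)" "1/4 \<le> 4 powr (-\<beta>*\<kappa>)"
    and l: "\<bar>v\<bar> powr (\<kappa> - 1) * 4 powr (-\<beta>*\<kappa>) / 20 \<le> lowf u v"
    by (auto simp: powr_minus_divide)
  have "1/2 * (1/4) \<le> \<bar>v\<bar> powr (\<kappa> - 1) * 4 powr (-\<beta>*\<kappa>)" using v by (intro mult_mono) auto
  then show ?thesis using l by simp
qed

section \<open>The weight in the separate frequency regions\<close>

lemma exp_bounds: "0 \<le> 1 - \<kappa>" "1 - \<kappa> \<le> 1" "0 \<le> 2*\<rho>" "2*\<rho> \<le> 2" using kap rho by auto

lemma weight_small:
  assumes "\<bar>x\<bar> \<le> 4" "\<bar>y\<bar> \<le> 2" "\<bar>z\<bar> \<le> 4" "1 \<le> l" shows "wgt x y z * l powr (\<kappa> - 1) \<le> 1360"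
proof -
  have "x\<^sup>2 \<le> 4\<^sup>2" "y\<^sup>2 \<le> 2\<^sup>2" "z\<^sup>2 \<le> 4\<^sup>2" using assms power2_le_iff_abs_le[of 4 x] power2_le_iff_abs_le[of 2 y] power2_le_iff_abs_le[of 4 z] by auto
  then have "jap y powr (2*\<rho>) \<le> 5" "jap z powr (2*\<rho>) \<le> 17" "x\<^sup>2 \<le> 16"
    using jap_powr_bounded[of "2*\<rho>" y] jap_powr_bounded[of "2*\<rho>" z] exp_bounds by simp_all
  moreover have "jap x powr (-2*\<rho>) \<le> 1" using rho by (intro powr_one_bound) auto
  moreover have "l powr (\<kappa> - 1) \<le> 1" using kap assms by (intro powr_one_bound) auto
  ultimately have "wgt x y z * l powr (\<kappa> - 1) \<le> 16 * 1 * 5 * 17 * 1"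
    unfolding wgt_def by (intro mult_mono) auto
  then show ?thesis by simp
qed

text \<open>All three frequencies have size \<open>B\<close>, so \<open>l\<close> is at least B^3/64
  and the total power of \<open>B\<close> is 2\<rho> + 3\<kappa> - 1, at most 1/2 + \<alpha> by
  \<open>e3\<close>. The right side is split into what the degenerate quadratic integral absorbs and
  what the dissipation absorbs.\<close>

lemma weight_balanced:
  assumes "1 \<le> B" "B / 4 \<le> \<bar>x\<bar>" "\<bar>x\<bar> \<le> B" "B / 4 \<le> \<bar>y\<bar>" "\<bar>y\<bar> \<le> B" "B / 4 \<le> \<bar>z\<bar>" "\<bar>z\<bar> \<le> B"
    and "\<bar>x * y * z\<bar> \<le> l"
  shows "wgt x y z * l powr (\<kappa> - 1) \<le> 16384 * (sqrt B * B powr \<alpha>)"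
proof -
  have B: "0 < B" using assms by simp
  have "B / 4 * (B / 4) * (B / 4) \<le> \<bar>x\<bar> * \<bar>y\<bar> * \<bar>z\<bar>"
    using assms by (intro mult_mono) auto
  then have "B ^ 3 / 64 \<le> l" using assms by (simp add: abs_mult power3_eq_cube)
  then have "l powr (-(1 - \<kappa>)) \<le> (B ^ 3 / 64) powr (-(1 - \<kappa>))"
    using B exp_bounds by (intro powr_mono2') auto
  also have "\<dots> \<le> 64 powr 1 * (B ^ 3) powr (-(1 - \<kappa>))"
    using B exp_bounds by (intro powr_minus_scale) auto
  also have "(B ^ 3) powr (-(1 - \<kappa>)) = B powr (3 * \<kappa> - 3)"
    using B by (simp add: powr_powr flip: powr_numeral)
  finally have l: "l powr (\<kappa> - 1) \<le> 64 * B powr (3 * \<kappa> - 3)" by simp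
  have "jap x powr (-(2*\<rho>)) \<le> (B / 4) powr (-(2*\<rho>))"
    using B assms rho by (intro jap_powr_neg_le) auto
  also have "\<dots> \<le> 4 powr 2 * B powr (-(2*\<rho>))" using B rho by (intro powr_minus_scale) auto
  finally have jx: "jap x powr (-2*\<rho>) \<le> 16 * B powr (-(2*\<rho>))" by (simp add: powr_numeral)
  have jy: "jap y powr (2*\<rho>) \<le> 4 * B powr (2*\<rho>)" "jap z powr (2*\<rho>) \<le> 4 * B powr (2*\<rho>)"
    using assms exp_bounds by (auto intro!: jap_powr_upper)
  have x2: "x\<^sup>2 \<le> B powr 2" using assms B by (simp add: powr_numeral abs_le_square_iff[symmetric])
  have "wgt x y z * l powr (\<kappa> - 1) \<le>
      (B powr 2 * (16 * B powr (-(2*\<rho>))) * (4 * B powr (2*\<rho>)) * (4 * B powr (2*\<rho>))) * (64 * B powr (3 * \<kappa> - 3))"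
    unfolding wgt_def using jx jy x2 l by (intro mult_mono mult_nonneg_nonneg) auto
  also have "\<dots> = 16384 * B powr (2 + -(2*\<rho>) + 2*\<rho> + 2*\<rho> + (3*\<kappa> - 3))"
    by (simp only: powr_add mult_ac)
  also have "\<dots> \<le> 16384 * B powr (1/2 + \<alpha>)"
    using assms e3 by (intro mult_left_mono powr_mono) auto
  finally show ?thesis using B by (simp add: powr_add powr_half_sqrt)
qed

lemma sq_jap_powr_le:
  assumes "1 \<le> B" "\<bar>x\<bar> \<le> B" shows "x\<^sup>2 * jap x powr (-2*\<rho>) \<le> B powr (2 - 2*\<rho>)"
proof (cases "x = 0")
  case False
  have "jap x powr (-(2*\<rho>)) \<le> \<bar>x\<bar> powr (-(2*\<rho>))" using False rho by (intro jap_powr_neg_le) auto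
  then have "x\<^sup>2 * jap x powr (-2*\<rho>) \<le> \<bar>x\<bar> powr 2 * \<bar>x\<bar> powr (-(2*\<rho>))"
    by (simp add: powr_numeral mult_left_mono)
  also have "\<dots> = \<bar>x\<bar> powr (2 + -(2*\<rho>))" by (rule powr_add[symmetric])
  also have "\<dots> \<le> B powr (2 + -(2*\<rho>))" using assms rho by (intro powr_mono2) auto
  finally show ?thesis by simp
qed auto

lemma abs_mult_powr_le: "t \<le> 2*\<rho> \<Longrightarrow> 0 \<le> t \<Longrightarrow> \<bar>x\<bar> powr t * jap x powr (-2*\<rho>) \<le> 1"
proof -
  assume t: "t \<le> 2*\<rho>" "0 \<le> t"
  have "\<bar>x\<bar> powr t * jap x powr (-2*\<rho>) \<le> jap x powr t * jap x powr (-2*\<rho>)"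
    using t abs_le_jap[of x] by (intro mult_right_mono powr_mono2) auto
  also have "\<dots> = jap x powr (t - 2*\<rho>)" by (simp flip: powr_add)
  also have "\<dots> \<le> jap x powr 0" using t by (intro powr_mono) auto
  finally show ?thesis using jap_pos[of x] by simp
qed

text \<open>Since \<open>l\<close> is at least |y|^2 |z| / 2, the power of |z| is 2\<rho> + \<kappa>
  - 1, nonnegative by \<open>e1\<close>, so |z| may be replaced by |y|. The remaining exponent
  2\<rho> + 3\<kappa> - 3 is negative by \<open>e3\<close> and \<alpha> \<le> 1.\<close>

lemma weight_output_comparable:
  assumes "y \<noteq> 0" "\<bar>z\<bar> \<le> \<bar>y\<bar>" "x = y + z" "2 \<le> \<bar>y\<bar>" "\<bar>y\<bar> / 2 \<le> \<bar>x\<bar>" "1 \<le> \<bar>z\<bar>"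
    and l: "\<bar>x * y * z\<bar> \<le> l"
  shows "wgt x y z * l powr (\<kappa> - 1) \<le> 256 * (\<bar>x\<bar> * \<bar>y\<bar>)"
proof -
  let ?b = "\<bar>y\<bar>" let ?c = "\<bar>z\<bar>"
  have b: "0 < ?b" "0 < ?c" "1 \<le> ?b" using assms by auto
  have "?b / 2 * ?b * ?c \<le> \<bar>x\<bar> * ?b * ?c" using assms by (intro mult_right_mono) auto
  then have "(?b * ?b * ?c) / 2 \<le> l" using l by (simp add: abs_mult)
  then have "l powr (-(1 - \<kappa>)) \<le> ((?b * ?b * ?c) / 2) powr (-(1 - \<kappa>))"
    using b exp_bounds by (intro powr_mono2' divide_pos_pos mult_pos_pos) auto
  also have "\<dots> \<le> 2 powr 1 * (?b * ?b * ?c) powr (-(1 - \<kappa>))"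
    using b exp_bounds by (intro powr_minus_scale mult_pos_pos) auto
  finally have l1: "l powr (\<kappa> - 1) \<le> 2 * (?b powr (\<kappa> - 1) * ?b powr (\<kappa> - 1) * ?c powr (\<kappa> - 1))"
    by (simp only: powr_mult3 abs_ge_zero minus_diff_eq) simp
  have "jap x powr (-(2*\<rho>)) \<le> (?b / 2) powr (-(2*\<rho>))"
    using b assms rho by (intro jap_powr_neg_le) auto
  also have "\<dots> \<le> 2 powr 2 * ?b powr (-(2*\<rho>))" using b rho by (intro powr_minus_scale) auto
  finally have jx: "jap x powr (-2*\<rho>) \<le> 4 * ?b powr (-(2*\<rho>))" by (simp add: powr_numeral)
  have jy: "jap y powr (2*\<rho>) \<le> 4 * ?b powr (2*\<rho>)" "jap z powr (2*\<rho>) \<le> 4 * ?c powr (2*\<rho>)"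
    using assms exp_bounds by (auto intro!: jap_powr_upper)
  have "\<bar>x\<bar> * \<bar>x\<bar> \<le> \<bar>x\<bar> * (2 * ?b)" using assms by (intro mult_left_mono) auto
  then have x2: "x\<^sup>2 \<le> \<bar>x\<bar> * (2 * ?b)" by (simp add: power2_eq_square)
  have "wgt x y z * l powr (\<kappa> - 1) \<le>
      (\<bar>x\<bar> * (2 * ?b) * (4 * ?b powr (-(2*\<rho>))) * (4 * ?b powr (2*\<rho>)) * (4 * ?c powr (2*\<rho>)))
       * (2 * (?b powr (\<kappa> - 1) * ?b powr (\<kappa> - 1) * ?c powr (\<kappa> - 1)))"
    unfolding wgt_def using jx jy x2 l1 by (intro mult_mono mult_nonneg_nonneg) auto
  also have "\<dots> = 256 * (\<bar>x\<bar> * ?b) * ((?c powr (2*\<rho>) * ?c powr (\<kappa> - 1)) *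
      (?b powr (-(2*\<rho>)) * ?b powr (2*\<rho>) * ?b powr (\<kappa> - 1) * ?b powr (\<kappa> - 1)))"
    by (simp only: mult_ac)
  also have "?c powr (2*\<rho>) * ?c powr (\<kappa> - 1) = ?c powr (2*\<rho> + (\<kappa> - 1))"
    by (simp flip: powr_add)
  also have "?b powr (-(2*\<rho>)) * ?b powr (2*\<rho>) * ?b powr (\<kappa> - 1) * ?b powr (\<kappa> - 1) = ?b powr (2*\<kappa> - 2)"
    by (simp flip: powr_add)
  also have "?c powr (2*\<rho> + (\<kappa> - 1)) * ?b powr (2*\<kappa> - 2) \<le> ?b powr (2*\<rho> + (\<kappa> - 1)) * ?b powr (2*\<kappa> - 2)"
    using assms e1 kap by (intro mult_right_mono powr_mono2) auto
  also have "\<dots> = ?b powr (2*\<rho> + 3*\<kappa> - 3)" by (simp flip: powr_add) (simp add: algebra_simps)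
  also have "\<dots> \<le> 1" using b e3 al by (intro powr_one_bound) auto
  finally show ?thesis by (simp add: mult_left_mono)
qed

text \<open>The critical interaction: two inputs of size |y| produce a smaller output
  \<open>x\<close>. The cases part at |x| = |y|^\<beta>. Above this threshold, and always if \<beta>
  = 0, \<open>e4\<close> makes the weight |x| |y| sufficient. Below it that weight is too small, and
  the dissipation |y|^(2\<alpha>) \<le> \<open>l1\<close> is spent instead, through
  \<open>e5\<close>.\<close>

lemma weight_high_high_low:
  assumes "x \<noteq> 0" "y \<noteq> 0" "\<bar>z\<bar> \<le> \<bar>y\<bar>" "x = y + z" "2 \<le> \<bar>y\<bar>" "\<bar>x\<bar> \<le> \<bar>y\<bar> / 2"
    and l: "\<bar>x * y * z\<bar> \<le> l" and l1: "1 \<le> l1" "\<bar>y\<bar> powr (2*\<alpha>) \<le> l1"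
  shows "wgt x y z * l powr (\<kappa> - 1) \<le> 1000 * (\<bar>x\<bar> * \<bar>y\<bar> + lowf y x * l1 powr r)"
proof -
  let ?a = "\<bar>x\<bar>" let ?b = "\<bar>y\<bar>"
  have b: "0 < ?a" "0 < ?b" "1 \<le> ?b" and c: "?b / 2 \<le> \<bar>z\<bar>"
    using assms(1-6) by linarith+
  have "?a * ?b * (?b / 2) \<le> ?a * ?b * \<bar>z\<bar>" using c by (intro mult_left_mono) auto
  then have "(?a * ?b * ?b) / 2 \<le> l" using l by (simp add: abs_mult)
  then have "l powr (-(1 - \<kappa>)) \<le> ((?a * ?b * ?b) / 2) powr (-(1 - \<kappa>))"
    using b exp_bounds by (intro powr_mono2' divide_pos_pos mult_pos_pos) auto
  also have "\<dots> \<le> 2 powr 1 * (?a * ?b * ?b) powr (-(1 - \<kappa>))"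
    using b exp_bounds by (intro powr_minus_scale mult_pos_pos) auto
  finally have l0: "l powr (\<kappa> - 1) \<le> 2 * (?a powr (\<kappa> - 1) * ?b powr (\<kappa> - 1) * ?b powr (\<kappa> - 1))"
    by (simp only: powr_mult3 abs_ge_zero minus_diff_eq) simp
  have jy: "jap y powr (2*\<rho>) \<le> 4 * ?b powr (2*\<rho>)" "jap z powr (2*\<rho>) \<le> 4 * ?b powr (2*\<rho>)"
    using assms exp_bounds by (auto intro!: jap_powr_upper)
  have main: "wgt x y z * l powr (\<kappa> - 1)
      \<le> 32 * (x\<^sup>2 * jap x powr (-2*\<rho>)) * ?a powr (\<kappa> - 1) * ?b powr (4*\<rho> + 2*\<kappa> - 2)"
  proof -
    have "wgt x y z * l powr (\<kappa> - 1) \<le>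
      ((x\<^sup>2 * jap x powr (-2*\<rho>)) * (4 * ?b powr (2*\<rho>)) * (4 * ?b powr (2*\<rho>)))
       * (2 * (?a powr (\<kappa> - 1) * ?b powr (\<kappa> - 1) * ?b powr (\<kappa> - 1)))"
      unfolding wgt_def using jy l0 by (intro mult_mono mult_nonneg_nonneg) auto
    also have "\<dots> = 32 * (x\<^sup>2 * jap x powr (-2*\<rho>)) * ?a powr (\<kappa> - 1)
       * (?b powr (2*\<rho>) * ?b powr (2*\<rho>) * ?b powr (\<kappa> - 1) * ?b powr (\<kappa> - 1))" by simp
    also have "?b powr (2*\<rho>) * ?b powr (2*\<rho>) * ?b powr (\<kappa> - 1) * ?b powr (\<kappa> - 1) = ?b powr (4*\<rho> + 2*\<kappa> - 2)"
      by (simp flip: powr_add) (simp add: algebra_simps)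
    finally show ?thesis .
  qed
  have ak: "x\<^sup>2 * ?a powr (\<kappa> - 1) = ?a * ?a powr \<kappa>"
  proof -
    have "x\<^sup>2 * ?a powr (\<kappa> - 1) = ?a * (?a powr 1 * ?a powr (\<kappa> - 1))" by (simp add: power2_eq_square)
    then show ?thesis by (simp only: powr_add[symmetric]) simp
  qed
  show ?thesis
  proof (cases "\<beta> = 0 \<or> ?b powr \<beta> \<le> ?a")
    case True
    \<comment> \<open>The exponent \<kappa> - 2\<rho> is negative by \<open>e1\<close>, so the lower
      bound |x| \<ge> |y|^\<beta> makes this power small; for \<beta> = 0 boundedness is
      enough.\<close>
    have k: "?a powr \<kappa> * jap x powr (-2*\<rho>) \<le> ?b powr (\<beta> * (\<kappa> - 2*\<rho>))"
    proof (cases "\<beta> = 0")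
      case False
      then have t: "?b powr \<beta> \<le> ?a" using True by simp
      have "?a powr \<kappa> * jap x powr (-(2*\<rho>)) \<le> ?a powr \<kappa> * ?a powr (-(2*\<rho>))"
        using b rho by (intro mult_left_mono jap_powr_neg_le) auto
      also have "\<dots> = ?a powr (\<kappa> - 2*\<rho>)" by (simp flip: powr_add)
      also have "\<dots> \<le> (?b powr \<beta>) powr (\<kappa> - 2*\<rho>)" using t b e1 by (intro powr_mono2') auto
      finally show ?thesis by (simp add: powr_powr)
    qed (use abs_mult_powr_le[of \<kappa> x] b kap rho in auto)
    have "(x\<^sup>2 * jap x powr (-2*\<rho>)) * ?a powr (\<kappa> - 1) * ?b powr (4*\<rho> + 2*\<kappa> - 2)
       \<le> ?a * ?b powr (\<beta> * (\<kappa> - 2*\<rho>)) * ?b powr (4*\<rho> + 2*\<kappa> - 2)"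
    proof (intro mult_right_mono)
      have "(x\<^sup>2 * jap x powr (-2*\<rho>)) * ?a powr (\<kappa> - 1) = (x\<^sup>2 * ?a powr (\<kappa> - 1)) * jap x powr (-2*\<rho>)"
        by (simp only: mult_ac)
      also have "\<dots> = ?a * (?a powr \<kappa> * jap x powr (-2*\<rho>))" by (simp only: ak mult_ac)
      also have "\<dots> \<le> ?a * ?b powr (\<beta> * (\<kappa> - 2*\<rho>))" using k by (intro mult_left_mono) auto
      finally show "(x\<^sup>2 * jap x powr (-2*\<rho>)) * ?a powr (\<kappa> - 1) \<le> ?a * ?b powr (\<beta> * (\<kappa> - 2*\<rho>))" .
    qed auto
    also have "\<dots> = ?a * ?b powr (1 + (4*\<rho> - 3 + 2*\<kappa> + \<beta> * (\<kappa> - 2*\<rho>)))"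
      by (simp add: mult.assoc flip: powr_add) (simp add: algebra_simps)
    also have "\<dots> = ?a * (?b * ?b powr (4*\<rho> - 3 + 2*\<kappa> + \<beta> * (\<kappa> - 2*\<rho>)))"
      using b by (simp only: powr_add) simp
    also have "\<dots> \<le> ?a * (?b * 1)" using b e4 by (intro mult_left_mono powr_one_bound) auto
    finally have "wgt x y z * l powr (\<kappa> - 1) \<le> 32 * (?a * ?b)" using main by (simp add: mult_ac)
    moreover have "0 \<le> ?a * ?b" "0 \<le> lowf y x * l1 powr r" using lowf_nonneg by auto
    ultimately show ?thesis by argo
  next
    case False
    then have bet: "\<beta>*(2 - 2*\<rho>) + 4*\<rho> - 2 + 2*\<kappa> + \<beta>*\<kappa> \<le> 2*\<alpha>" "?a \<le> ?b powr \<beta>" using e5 by auto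
    have b1: "1 \<le> ?b powr \<beta>" using b beta_bounds by (intro ge_one_powr_ge_zero) auto
    have "?b powr \<beta> \<le> jap y powr \<beta>" using abs_le_jap beta_bounds by (intro powr_mono2) auto
    then have "?a powr (\<kappa> - 1) * ?b powr (-\<beta>*\<kappa>) / 20 \<le> lowf y x"
      using assms(1,5) bet(2) jap_le_add[of y] powr_ge_zero[of "jap y" \<beta>]
      by (intro lowf_ge; linarith)
    \<comment> \<open>The power \<open>l1 powr r\<close> is the one that later cancels against
      \<open>(l1 * l2) powr (-r)\<close>.\<close>
    moreover have "?b powr (2*\<alpha>) \<le> l1 powr r"
    proof -
      have "l1 powr 1 \<le> l1 powr r" using r1 l1 by (intro powr_mono) auto
      then show ?thesis using l1 by simp
    qed
    ultimately have low: "?a powr (\<kappa> - 1) * ?b powr (-\<beta>*\<kappa>) / 20 * ?b powr (2*\<alpha>) \<le> lowf y x * l1 powr r"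
      using lowf_nonneg by (intro mult_mono) auto
    have "x\<^sup>2 * jap x powr (-2*\<rho>) \<le> (?b powr \<beta>) powr (2 - 2*\<rho>)"
      using b1 bet by (intro sq_jap_powr_le) auto
    then have "(x\<^sup>2 * jap x powr (-2*\<rho>)) * ?a powr (\<kappa> - 1) * ?b powr (4*\<rho> + 2*\<kappa> - 2)
        \<le> (?b powr \<beta>) powr (2 - 2*\<rho>) * ?a powr (\<kappa> - 1) * ?b powr (4*\<rho> + 2*\<kappa> - 2)"
      by (intro mult_right_mono) auto
    also have "\<dots> = ?a powr (\<kappa> - 1) * ?b powr (\<beta>*(2 - 2*\<rho>) + (4*\<rho> + 2*\<kappa> - 2))"
      by (simp add: powr_powr powr_add)
    also have "\<dots> \<le> ?a powr (\<kappa> - 1) * ?b powr (-\<beta>*\<kappa> + 2*\<alpha>)"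
      using b bet by (intro mult_left_mono powr_mono) auto
    also have "\<dots> = 20 * (?a powr (\<kappa> - 1) * ?b powr (-\<beta>*\<kappa>) / 20 * ?b powr (2*\<alpha>))"
      by (simp only: powr_add) simp
    finally have "wgt x y z * l powr (\<kappa> - 1) \<le> 640 * (lowf y x * l1 powr r)" using main low by linarith
    moreover have "0 \<le> ?a * ?b" "0 \<le> lowf y x * l1 powr r" using lowf_nonneg by auto
    ultimately show ?thesis by argo
  qed
qed

text \<open>With |z| < 1 the weights of \<open>x\<close> and \<open>y\<close> combine to a multiple
  of y^2, since the exponents 2 - 2\<rho> and 2\<rho> add up to 2. In the regions where this is
  applied y^2 is dominated by the Jacobian weight, so no decay has to be taken from
  \<open>l\<close>.\<close>

lemma weight_one_low_input:
  assumes "\<bar>x\<bar> \<le> 2 * \<bar>y\<bar>" "1 \<le> \<bar>y\<bar>" "\<bar>z\<bar> < 1" "1 \<le> l"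
  shows "wgt x y z * l powr (\<kappa> - 1) \<le> 32 * y\<^sup>2"
proof -
  have "l powr (\<kappa> - 1) \<le> 1" using assms kap by (intro powr_one_bound) auto
  moreover have "x\<^sup>2 * jap x powr (-2*\<rho>) \<le> (2 * \<bar>y\<bar>) powr (2 - 2*\<rho>)" using assms by (intro sq_jap_powr_le) auto
  moreover have "jap y powr (2*\<rho>) \<le> 4 * (2 * \<bar>y\<bar>) powr (2*\<rho>)"
    using assms exp_bounds by (intro jap_powr_upper) auto
  moreover have "jap z powr (2*\<rho>) \<le> 2"
  proof -
    have "z\<^sup>2 \<le> 1" using assms by (simp add: abs_square_le_1)
    then show ?thesis using jap_powr_bounded[of "2*\<rho>" z] exp_bounds by simp
  qed
  ultimately have "wgt x y z * l powr (\<kappa> - 1) \<le>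
      (2 * \<bar>y\<bar>) powr (2 - 2*\<rho>) * (4 * (2 * \<bar>y\<bar>) powr (2*\<rho>)) * 2 * 1"
    unfolding wgt_def by (intro mult_mono mult_nonneg_nonneg) auto
  also have "\<dots> = 8 * ((2 * \<bar>y\<bar>) powr (2 - 2*\<rho>) * (2 * \<bar>y\<bar>) powr (2*\<rho>))" by simp
  also have "\<dots> = 8 * (2 * \<bar>y\<bar>) powr 2" by (simp only: powr_add[symmetric]) simp
  also have "\<dots> = 32 * y\<^sup>2" by (simp add: powr_numeral power_mult_distrib)
  finally show ?thesis .
qed

section \<open>Assembly of the regions according to the largest modulation\<close>

lemma input_frequency_cases:
  fixes a b c d :: real
  assumes "2 * a \<le> d + b"
  shows "(a \<le> 2 \<and> b \<le> 2) \<or> (2 < b \<and> d \<le> b / 2) \<or> (2 < a \<and> b < 1) \<or>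
    (b / 2 < d \<and> 1 \<le> b \<and> c < 1) \<or> (b / 2 < d \<and> 1 \<le> b \<and> 1 \<le> c)"
  using assms by linarith

lemma le_double_of_average: "2 * c \<le> d + b \<Longrightarrow> b / 2 < d \<Longrightarrow> 0 \<le> d \<Longrightarrow> c \<le> 2 * (d::real)"
  by linarith

text \<open>Since x + z = 2x - y, this sum is the factor of the Jacobian that can degenerate. If it
  is small compared with the outer frequency \<open>y\<close>, both \<open>x\<close> and
  \<open>-z\<close> are close to y/2, so all three frequencies are comparable.\<close>

lemma comparable_near_diagonal:
  fixes x y z :: real
  assumes "\<bar>x + z\<bar> \<le> \<bar>y\<bar> / 2" and "y = x - z"
  shows "\<bar>y\<bar> / 4 \<le> \<bar>x\<bar>" "\<bar>x\<bar> \<le> \<bar>y\<bar>" "\<bar>y\<bar> / 4 \<le> \<bar>z\<bar>" "\<bar>z\<bar> \<le> \<bar>y\<bar>"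
  using assms by linarith+

text \<open>The largest modulation \<open>l\<close> belongs to the output, and \<open>y\<close> is
  the larger input. The first term on the right is the Jacobian of the quadratic phase, the second
  replaces it where |y - z| \<le> |x|/2, and the two \<open>lowf\<close> terms cover bounded
  frequencies and a low output. The term \<open>lowf y x\<close> has output and input exchanged and
  will be read as part of the transposed kernel.\<close>

lemma weight_bound_output:
  assumes "y \<noteq> 0" "\<bar>z\<bar> \<le> \<bar>y\<bar>" "x = y + z" "1 \<le> l" and l: "\<bar>x * y * z\<bar> \<le> l"
    and l1: "1 \<le> l1" "\<bar>y\<bar> powr (2*\<alpha>) \<le> l1"
  shows "wgt x y z * l powr (\<kappa> - 1) \<le> 1000000 * (\<bar>x\<bar> * \<bar>y - z\<bar> + sqrt \<bar>x\<bar> * sqrt (max l1 l2)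
      + (lowf x y + lowf y x) * l1 powr r)"
proof (cases "x = 0")
  case True
  then show ?thesis
    using l1 lowf_nonneg[of x y] lowf_nonneg[of y x] by (auto simp: wgt_def intro!: mult_nonneg_nonneg add_nonneg_nonneg)
next
  case x0: False
  define M S L L' P W where defs: "M = \<bar>x\<bar> * \<bar>y - z\<bar>" "S = sqrt \<bar>x\<bar> * sqrt (max l1 l2)"
    "L = lowf x y * l1 powr r" "L' = lowf y x * l1 powr r" "P = \<bar>x\<bar> * \<bar>y\<bar>" "W = wgt x y z * l powr (\<kappa> - 1)"
  have tri: "\<bar>x\<bar> \<le> 2 * \<bar>y\<bar>" using assms(2,3) by linarith
  have nn: "0 \<le> M" "0 \<le> S" "0 \<le> L" "0 \<le> L'" unfolding defs
    using l1 lowf_nonneg by (auto intro!: mult_nonneg_nonneg)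
  have lr: "1 \<le> l1 powr r" using l1 r1 by (intro ge_one_powr_ge_zero) auto
  have "W \<le> 1000000 * M \<or> W \<le> 1000000 * S \<or>
     W \<le> 1000000 * L \<or> W \<le> 1000000 * (M + L')"
  proof -
    consider "\<bar>y\<bar> \<le> 2" | "2 < \<bar>y\<bar>" "\<bar>y - z\<bar> \<le> \<bar>x\<bar> / 2" | "2 < \<bar>y\<bar>" "\<bar>x\<bar> / 2 < \<bar>y - z\<bar>" "\<bar>z\<bar> < 1"
      | "2 < \<bar>y\<bar>" "\<bar>x\<bar> / 2 < \<bar>y - z\<bar>" "1 \<le> \<bar>z\<bar>" "\<bar>y\<bar> / 2 \<le> \<bar>x\<bar>"
      | "2 < \<bar>y\<bar>" "\<bar>x\<bar> / 2 < \<bar>y - z\<bar>" "1 \<le> \<bar>z\<bar>" "\<bar>x\<bar> < \<bar>y\<bar> / 2" by linarith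
    then show ?thesis
    proof cases
      case 1
      have "1/200 \<le> lowf x y" using 1 assms(1) tri by (intro lowf_ge_low) linarith+
      then have "1/200 * 1 \<le> L" unfolding defs using lr by (intro mult_mono) auto
      moreover have "W \<le> 1360"
        unfolding defs using 1 assms(2,4) tri by (intro weight_small) linarith+
      ultimately have "W \<le> 1000000 * L" using nn by linarith
      then show ?thesis by blast
    next
      case 2
      have b: "\<bar>x\<bar> / 4 \<le> \<bar>y\<bar>" "\<bar>y\<bar> \<le> \<bar>x\<bar>" "\<bar>x\<bar> / 4 \<le> \<bar>z\<bar>" "\<bar>z\<bar> \<le> \<bar>x\<bar>"
        using comparable_near_diagonal[of y "-z" x] 2(2) assms(3) by auto
      then have "2 \<le> \<bar>x\<bar>" using 2 by simp
      with b have "W \<le> 16384 * (sqrt \<bar>x\<bar> * \<bar>x\<bar> powr \<alpha>)" unfolding defs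
        using l by (intro weight_balanced) auto
      \<comment> \<open>The dissipation of the input \<open>y\<close>, whose frequency is comparable
        with \<open>x\<close>, pays for the power |x|^\<alpha> left by the balanced bound.\<close>
      moreover have "\<bar>x\<bar> powr \<alpha> \<le> 4 * sqrt (max l1 l2)"
      proof -
        have "\<bar>x\<bar> powr \<alpha> / 4 \<le> (\<bar>x\<bar> / 4) powr \<alpha>" using x0 al by (intro powr_ge_of_scale) auto
        also have "\<dots> \<le> \<bar>y\<bar> powr \<alpha>" using b al by (intro powr_mono2) auto
        also have "\<dots> = sqrt (\<bar>y\<bar> powr (2*\<alpha>))" by (simp add: powr_half_sqrt[symmetric] powr_powr)
        also have "\<dots> \<le> sqrt (max l1 l2)" using l1 by (intro real_sqrt_le_mono) auto
        finally show ?thesis by simp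
      qed
      then have "sqrt \<bar>x\<bar> * \<bar>x\<bar> powr \<alpha> \<le> sqrt \<bar>x\<bar> * (4 * sqrt (max l1 l2))" by (intro mult_left_mono) auto
      then have "16384 * (sqrt \<bar>x\<bar> * \<bar>x\<bar> powr \<alpha>) \<le> 65536 * S" unfolding defs by simp
      ultimately have "W \<le> 65536 * S" by (rule order_trans)
      then have "W \<le> 1000000 * S" using nn by linarith
      then show ?thesis by blast
    next
      case 3
      have x: "\<bar>x\<bar> \<le> 2 * \<bar>y\<bar>" and d: "\<bar>y\<bar> / 2 \<le> \<bar>y - z\<bar>" "\<bar>y\<bar> / 2 \<le> \<bar>x\<bar>" using 3 assms(3) by linarith+
      have "W \<le> 32 * y\<^sup>2" unfolding defs using x 3 assms(4) by (intro weight_one_low_input) linarith+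
      also have "\<dots> = 128 * (\<bar>y\<bar> / 2 * (\<bar>y\<bar> / 2))" by (simp add: power2_eq_square)
      also have "\<dots> \<le> 128 * M" unfolding defs using d by (intro mult_left_mono mult_mono) auto
      finally have "W \<le> 1000000 * M" using nn by linarith
      then show ?thesis by blast
    next
      case 4
      have "W \<le> 256 * P" unfolding defs
        using 4 by (intro weight_output_comparable assms) simp_all
      moreover have "\<bar>y\<bar> / 2 \<le> \<bar>y - z\<bar>" using assms(2,3) 4(2) by linarith
      then have "\<bar>x\<bar> * (\<bar>y\<bar> / 2) \<le> M" unfolding defs by (intro mult_left_mono) auto
      then have "P \<le> 2 * M" by (simp add: defs)
      ultimately have "W \<le> 1000000 * M" using nn by linarith
      then show ?thesis by blast
    next
      case 5
      have "W \<le> 1000 * (P + L')" unfolding defs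
        using 5 by (intro weight_high_high_low x0 assms) simp_all
      moreover have "\<bar>y\<bar> / 2 \<le> \<bar>y - z\<bar>" using assms(2,3) 5(2) by linarith
      then have "\<bar>x\<bar> * (\<bar>y\<bar> / 2) \<le> M" unfolding defs by (intro mult_left_mono) auto
      then have "P \<le> 2 * M" by (simp add: defs)
      ultimately have "W \<le> 1000000 * (M + L')" using nn by simp
      then show ?thesis by blast
    qed
  qed
  then have "W \<le> 1000000 * (M + S + (L + L'))" unfolding distrib_left using nn by (elim disjE) linarith+
  then show ?thesis by (simp only: defs distrib_right)
qed

text \<open>Now the input \<open>y\<close> carries the largest modulation \<open>l1\<close>, so it
  becomes the outer point; the inner points are the output \<open>x\<close> and the other input
  \<open>z\<close>, and the dissipation to be spent is that of \<open>x\<close>. Either input may be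
  the larger one, which adds the case of a low \<open>y\<close> with a high output.\<close>

lemma weight_bound_input:
  assumes "y \<noteq> 0" "x = y + z" "1 \<le> l1" and l1: "\<bar>x * y * z\<bar> \<le> l1"
    and l: "1 \<le> l" "\<bar>x\<bar> powr (2*\<alpha>) \<le> l"
  shows "wgt x y z * l1 powr (\<kappa> - 1) \<le> 1000000 * (\<bar>y\<bar> * \<bar>x + z\<bar> + sqrt \<bar>y\<bar> * sqrt (max l l2)
      + lowf x y * l powr r)"
proof (cases "x = 0")
  case True
  then show ?thesis
    using l lowf_nonneg[of x y] by (auto simp: wgt_def intro!: mult_nonneg_nonneg add_nonneg_nonneg)
next
  case x0: False
  define M S L W where defs: "M = \<bar>y\<bar> * \<bar>x + z\<bar>" "S = sqrt \<bar>y\<bar> * sqrt (max l l2)"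
    "L = lowf x y * l powr r" "W = wgt x y z * l1 powr (\<kappa> - 1)"
  let ?a = "\<bar>x\<bar>" let ?b = "\<bar>y\<bar>" let ?c = "\<bar>z\<bar>"
  have tri: "\<bar>z\<bar> \<le> \<bar>x\<bar> + \<bar>y\<bar>" "\<bar>x\<bar> \<le> \<bar>y\<bar> + \<bar>z\<bar>" using assms(2) by linarith+
  have tri2: "2 * \<bar>x\<bar> \<le> \<bar>x + z\<bar> + \<bar>y\<bar>" "2 * \<bar>z\<bar> \<le> \<bar>x + z\<bar> + \<bar>y\<bar>" using assms(2) by linarith+
  have nn: "0 \<le> M" "0 \<le> S" "0 \<le> L" unfolding defs
    using l lowf_nonneg by (auto intro!: mult_nonneg_nonneg)
  have "l powr 1 \<le> l powr r" using l r1 by (intro powr_mono) auto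
  then have lr: "l \<le> l powr r" "1 \<le> l powr r" using l by auto
  have "W \<le> 1000000 * M \<or> W \<le> 1000000 * S \<or>
     W \<le> 1000000 * L"
  proof -
    consider "\<bar>x\<bar> \<le> 2" "\<bar>y\<bar> \<le> 2" | "2 < \<bar>y\<bar>" "\<bar>x + z\<bar> \<le> \<bar>y\<bar> / 2"
      | "2 < \<bar>x\<bar>" "\<bar>y\<bar> < 1"
      | "\<bar>y\<bar> / 2 < \<bar>x + z\<bar>" "1 \<le> \<bar>y\<bar>" "\<bar>z\<bar> < 1"
      | "\<bar>y\<bar> / 2 < \<bar>x + z\<bar>" "1 \<le> \<bar>y\<bar>" "1 \<le> \<bar>z\<bar>"
      using input_frequency_cases[OF tri2(1), of "\<bar>z\<bar>"] by blast
    then show ?thesis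
    proof cases
      case 1
      have "1/200 \<le> lowf x y" using 1 assms(1) by (intro lowf_ge_low) auto
      then have "1/200 * 1 \<le> L" unfolding defs using lr by (intro mult_mono) auto
      moreover have "W \<le> 1360"
        unfolding defs using 1 assms(3) tri(1) by (intro weight_small) linarith+
      ultimately have "W \<le> 1000000 * L" using nn by linarith
      then show ?thesis by blast
    next
      case 2
      have b: "?b / 4 \<le> ?a" "?a \<le> ?b" "?b / 4 \<le> ?c" "?c \<le> ?b"
        using comparable_near_diagonal[OF 2(2)] assms(2) by auto
      then have "W \<le> 16384 * (sqrt ?b * ?b powr \<alpha>)" unfolding defs
        using 2 by (intro weight_balanced l1 b) simp_all
      moreover have "?b powr \<alpha> \<le> 4 * sqrt (max l l2)"
      proof -
        have "?b powr \<alpha> / 4 \<le> (?b / 4) powr \<alpha>" using assms al by (intro powr_ge_of_scale) auto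
        also have "\<dots> \<le> ?a powr \<alpha>" using b al by (intro powr_mono2) auto
        also have "\<dots> = sqrt (?a powr (2*\<alpha>))" by (simp add: powr_half_sqrt[symmetric] powr_powr)
        also have "\<dots> \<le> sqrt (max l l2)" using l by (intro real_sqrt_le_mono) auto
        finally show ?thesis by simp
      qed
      then have "sqrt ?b * ?b powr \<alpha> \<le> sqrt ?b * (4 * sqrt (max l l2))" by (intro mult_left_mono) auto
      then have "16384 * (sqrt ?b * ?b powr \<alpha>) \<le> 65536 * S" unfolding defs by simp
      ultimately have "W \<le> 65536 * S" by (rule order_trans)
      then have "W \<le> 1000000 * S" using nn by linarith
      then show ?thesis by blast
    next
      \<comment> \<open>For a low input of highest modulation the factor |y|^(\<kappa>-1) coming
        from \<open>l1\<close> is exactly the singularity of \<open>lowf\<close>. The leftover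
        |x|^(2\<kappa>) is absorbed by the dissipation |x|^(2\<alpha>) through
        \<open>e6\<close>.\<close>
      case 3
      have a: "0 < ?a" "1 \<le> ?a" "1 \<le> 2 * ?a" and c: "?a / 2 \<le> ?c" "?c \<le> 2 * ?a" using 3 tri by linarith+
      have b: "0 < ?b" using assms by simp
      have "?a * ?b * (?a / 2) \<le> ?a * ?b * ?c" using c by (intro mult_left_mono) auto
      also have "?a * ?b * (?a / 2) = (?a * ?a * ?b) / 2" by (simp only: times_divide_eq_right mult_ac)
      also have "?a * ?b * ?c \<le> l1" using l1 by (simp only: abs_mult)
      finally have "(?a * ?a * ?b) / 2 \<le> l1" .
      then have "l1 powr (-(1 - \<kappa>)) \<le> ((?a * ?a * ?b) / 2) powr (-(1 - \<kappa>))"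
        using a b exp_bounds by (intro powr_mono2' divide_pos_pos mult_pos_pos) auto
      also have "\<dots> \<le> 2 powr 1 * (?a * ?a * ?b) powr (-(1 - \<kappa>))"
        using a b exp_bounds by (intro powr_minus_scale mult_pos_pos) auto
      finally have l1': "l1 powr (\<kappa> - 1) \<le> 2 * (?a powr (\<kappa> - 1) * ?a powr (\<kappa> - 1) * ?b powr (\<kappa> - 1))"
        by (simp only: powr_mult3 abs_ge_zero minus_diff_eq) simp
      have x2: "x\<^sup>2 * jap x powr (-2*\<rho>) \<le> (2 * ?a) powr (2 - 2*\<rho>)" using a by (intro sq_jap_powr_le) auto
      have "y\<^sup>2 \<le> 1" using 3 by (simp add: abs_square_le_1)
      then have jy: "jap y powr (2*\<rho>) \<le> 2" using jap_powr_bounded[of "2*\<rho>" y] exp_bounds by simp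
      have jz: "jap z powr (2*\<rho>) \<le> 4 * (2 * ?a) powr (2*\<rho>)"
        using a c exp_bounds by (intro jap_powr_upper) auto
      have "W \<le>
          ((2 * ?a) powr (2 - 2*\<rho>) * 2 * (4 * (2 * ?a) powr (2*\<rho>)))
           * (2 * (?a powr (\<kappa> - 1) * ?a powr (\<kappa> - 1) * ?b powr (\<kappa> - 1)))"
        unfolding defs wgt_def using x2 jy jz l1' by (intro mult_mono mult_nonneg_nonneg) auto
      also have "\<dots> = 16 * ((2 * ?a) powr (2 - 2*\<rho>) * (2 * ?a) powr (2*\<rho>))
           * (?a powr (\<kappa> - 1) * ?a powr (\<kappa> - 1)) * ?b powr (\<kappa> - 1)" by simp
      also have "(2 * ?a) powr (2 - 2*\<rho>) * (2 * ?a) powr (2*\<rho>) = (2 * ?a) powr 2"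
        by (simp only: powr_add[symmetric]) simp
      also have "\<dots> = 4 * ?a powr 2" by (simp add: powr_mult powr_numeral power_mult_distrib)
      also have "16 * (4 * ?a powr 2) * (?a powr (\<kappa> - 1) * ?a powr (\<kappa> - 1)) * ?b powr (\<kappa> - 1)
          = 64 * (?a powr 2 * ?a powr (\<kappa> - 1) * ?a powr (\<kappa> - 1)) * ?b powr (\<kappa> - 1)" by simp
      also have "?a powr 2 * ?a powr (\<kappa> - 1) * ?a powr (\<kappa> - 1) = ?a powr (2 * \<kappa>)"
        by (simp only: powr_add[symmetric]) simp
      also have "64 * ?a powr (2*\<kappa>) * ?b powr (\<kappa> - 1) \<le> 64 * ?a powr (-\<beta>*\<kappa> + 2*\<alpha>) * ?b powr (\<kappa> - 1)"
        using a e6 by (intro mult_right_mono mult_left_mono powr_mono) auto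
      also have "\<dots> = 64 * (20 * (?b powr (\<kappa> - 1) * ?a powr (-\<beta>*\<kappa>) / 20 * ?a powr (2*\<alpha>)))"
        by (simp only: powr_add) simp
      also have "\<dots> \<le> 64 * (20 * L)"
      proof -
        have "1 \<le> jap x powr \<beta>" using beta_bounds by (intro ge_one_powr_ge_zero) auto
        then have "?b powr (\<kappa> - 1) * ?a powr (-\<beta>*\<kappa>) / 20 \<le> lowf x y"
          using 3 a jap_le_add[of x] assms(1) by (intro lowf_ge; linarith)
        then show ?thesis unfolding defs using l lr lowf_nonneg by (intro mult_left_mono mult_mono) auto
      qed
      finally have "W \<le> 1000000 * L" using nn by linarith
      then show ?thesis by blast
    next
      case 4
      have x: "\<bar>x\<bar> \<le> 2 * \<bar>y\<bar>" using 4 tri(2) by linarith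
      have "W \<le> 32 * y\<^sup>2" unfolding defs using x 4 assms(3) by (intro weight_one_low_input) linarith+
      also have "\<dots> = 64 * (\<bar>y\<bar> * (\<bar>y\<bar> / 2))" by (simp add: power2_eq_square)
      also have "\<dots> \<le> 64 * M" unfolding defs using 4 by (intro mult_left_mono mult_mono) auto
      finally have "W \<le> 1000000 * M" using nn by linarith
      then show ?thesis by blast
    next
      \<comment> \<open>The power |x|^(1+\<kappa>) is compensated by <x>^(-2\<rho>) through
        \<open>e1\<close>, and the power of |y| |z| is at most 1 by \<open>e2\<close>. Then |z|
        \<le> 2|x + z| turns |y| |z| into the Jacobian weight.\<close>
      case 5
      have pos: "0 < ?a * ?b * ?c" using x0 5 by (intro mult_pos_pos) auto
      have bc: "1 \<le> ?b * ?c" using 5 mult_mono[of 1 ?b 1 ?c] by auto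
      have "l1 powr (\<kappa> - 1) \<le> (?a * ?b * ?c) powr (\<kappa> - 1)"
        using pos l1 kap by (intro powr_mono2') (auto simp: abs_mult)
      also have "\<dots> = ?a powr (\<kappa> - 1) * ?b powr (\<kappa> - 1) * ?c powr (\<kappa> - 1)"
        by (simp only: powr_mult3 abs_ge_zero)
      finally have l1': "l1 powr (\<kappa> - 1) \<le> ?a powr (\<kappa> - 1) * ?b powr (\<kappa> - 1) * ?c powr (\<kappa> - 1)" .
      have jy: "jap y powr (2*\<rho>) \<le> 4 * ?b powr (2*\<rho>)" "jap z powr (2*\<rho>) \<le> 4 * ?c powr (2*\<rho>)"
        using 5 exp_bounds by (auto intro!: jap_powr_upper)
      have "W \<le>
         (x\<^sup>2 * jap x powr (-2*\<rho>) * (4 * ?b powr (2*\<rho>)) * (4 * ?c powr (2*\<rho>)))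
          * (?a powr (\<kappa> - 1) * ?b powr (\<kappa> - 1) * ?c powr (\<kappa> - 1))"
        unfolding defs wgt_def using jy l1' by (intro mult_mono mult_nonneg_nonneg) auto
      also have "\<dots> = 16 * (x\<^sup>2 * ?a powr (\<kappa> - 1) * jap x powr (-2*\<rho>)) *
          ((?b powr (2*\<rho>) * ?b powr (\<kappa> - 1)) * (?c powr (2*\<rho>) * ?c powr (\<kappa> - 1)))" by simp
      also have "x\<^sup>2 * ?a powr (\<kappa> - 1) = ?a powr 2 * ?a powr (\<kappa> - 1)" by (simp add: powr_numeral)
      also have "\<dots> = ?a powr (1 + \<kappa>)" by (simp only: powr_add[symmetric]) simp
      also have "(?b powr (2*\<rho>) * ?b powr (\<kappa> - 1)) * (?c powr (2*\<rho>) * ?c powr (\<kappa> - 1)) = (?b * ?c) powr (2*\<rho> + (\<kappa> - 1))"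
        by (simp only: powr_add powr_mult abs_ge_zero mult_ac)
      also have "16 * (?a powr (1 + \<kappa>) * jap x powr (-2*\<rho>)) * (?b * ?c) powr (2*\<rho> + (\<kappa> - 1))
         \<le> 16 * 1 * (?b * ?c) powr 1"
        using abs_mult_powr_le[of "1 + \<kappa>" x] e1 e2 kap bc by (intro mult_mono powr_mono) auto
      also have "\<dots> = 16 * (?b * ?c)" using bc by simp
      also have "\<dots> \<le> 16 * (?b * (2 * \<bar>x + z\<bar>))"
      proof (intro mult_left_mono)
        show "?c \<le> 2 * \<bar>x + z\<bar>" by (rule le_double_of_average[OF tri2(2) 5(1)]) simp
      qed auto
      also have "\<dots> = 32 * M" by (simp add: defs)
      finally have "W \<le> 1000000 * M" using nn by linarith
      then show ?thesis by blast
    qed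
  qed
  then have "W \<le> 1000000 * (M + S + L)" unfolding distrib_left using nn by (elim disjE) linarith+
  then show ?thesis by (simp only: defs)
qed

end

section \<open>Integrals of modulation kernels\<close>

abbreviation brk :: "real \<Rightarrow> real \<Rightarrow> ennreal" where "brk r u \<equiv> ennreal ((1 + \<bar>u\<bar>) powr (-r))"

section \<open>One-dimensional integrals of inverse powers of affine and quadratic functions\<close>

lemma nn_integral_even_le:
  fixes f :: "real \<Rightarrow> ennreal"
  assumes [measurable]: "f \<in> borel_measurable borel" and ev: "\<And>x. f (-x) = f x"
  shows "(\<integral>\<^sup>+x. f x \<partial>lborel) \<le> 2 * (\<integral>\<^sup>+x. f x * indicator {0..} x \<partial>lborel)"
proof -
  have "(\<integral>\<^sup>+x. f x \<partial>lborel) \<le> (\<integral>\<^sup>+x. f x * indicator {0..} x + f x * indicator {..0} x \<partial>lborel)"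
    by (intro nn_integral_mono) (auto simp: indicator_def)
  also have "\<dots> = (\<integral>\<^sup>+x. f x * indicator {0..} x \<partial>lborel) + (\<integral>\<^sup>+x. f x * indicator {..0} x \<partial>lborel)"
    by (intro nn_integral_add) auto
  also have "(\<integral>\<^sup>+x. f x * indicator {..0} x \<partial>lborel) = (\<integral>\<^sup>+x. f x * indicator {0..} x \<partial>lborel)"
    by (subst nn_integral_real_affine[where c="-1" and t=0])
       (auto simp: ev indicator_def intro!: nn_integral_cong)
  finally show ?thesis by (simp add: mult_2)
qed

lemma nn_integral_brk:
  assumes r: "1 < r"
  shows "(\<integral>\<^sup>+x. brk r x \<partial>lborel) \<le> ennreal (2 / (r - 1))"
proof -
  let ?F = "\<lambda>x::real. (- 1 / (r - 1)) * (1 + x) powr (1 - r)"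
  have "(\<integral>\<^sup>+x. brk r x \<partial>lborel) \<le> 2 * (\<integral>\<^sup>+x. brk r x * indicator {0..} x \<partial>lborel)"
    by (intro nn_integral_even_le) auto
  also have "(\<integral>\<^sup>+x. brk r x * indicator {0..} x \<partial>lborel)
      = (\<integral>\<^sup>+x. ennreal ((1 + x) powr (-r)) * indicator {0..} x \<partial>lborel)"
    by (intro nn_integral_cong) (auto simp: indicator_def)
  also have "\<dots> = ennreal (0 - ?F 0)"
  proof (rule nn_integral_FTC_atLeast)
    have "((\<lambda>x::real. (1 + x) powr (1 - r)) \<longlongrightarrow> 0) at_top"
      using r by (intro tendsto_neg_powr filterlim_tendsto_add_at_top[OF tendsto_const] filterlim_ident) auto
    then show "(?F \<longlongrightarrow> 0) at_top" by (rule tendsto_mult_right_zero)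
    show "DERIV ?F x :> (1 + x) powr (-r)" if "0 \<le> x" for x
    proof -
      have "DERIV (\<lambda>x. (1 + x) powr (1 - r)) x :> (1 - r) * (1 + x) powr (-r)"
        using that by (auto intro!: derivative_eq_intros)
      from DERIV_cmult[OF this, of "- 1 / (r - 1)"]
      have "DERIV ?F x :> (- 1 / (r - 1) * (1 - r)) * (1 + x) powr (-r)" by (simp only: mult.assoc)
      moreover have "- 1 / (r - 1) * (1 - r) = 1" using r by (simp add: divide_simps)
      ultimately show ?thesis by (simp only: mult_1)
    qed
  qed auto
  also have "2 * ennreal (0 - ?F 0) = ennreal (2 / (r - 1))"
    using r by (subst ennreal_numeral[symmetric], subst ennreal_mult[symmetric]) auto
  finally show ?thesis .
qed

lemma nn_integral_brk_affine:
  assumes r: "1 < r" and b: "b \<noteq> 0"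
  shows "ennreal \<bar>b\<bar> * (\<integral>\<^sup>+x. brk r (c + b * x) \<partial>lborel) \<le> ennreal (2 / (r - 1))"
  using nn_integral_brk[OF r] nn_integral_real_affine[of "brk r" b c] b by simp

text \<open>Substituting \<open>u = m + b y\<^sup>2\<close> on each half line.\<close>
lemma nn_integral_quadratic_weighted:
  assumes r: "1 < r"
  shows "(\<integral>\<^sup>+y. ennreal (\<bar>b\<bar> * \<bar>y\<bar>) * brk r (m + b * y\<^sup>2) \<partial>lborel) \<le> ennreal (2 / (r - 1))"
proof -
  have pos: "(\<integral>\<^sup>+y. ennreal (b * \<bar>y\<bar>) * brk r (m + b * y\<^sup>2) \<partial>lborel) \<le> ennreal (2 / (r - 1))"
    if b: "0 < b" for b m :: real
  proof -
    let ?f = "\<lambda>y. ennreal (b * \<bar>y\<bar>) * brk r (m + b * y\<^sup>2)"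
    \<comment> \<open>The substitution is made on the compact intervals [0, n], which exhaust the
      half line; the factor 2 anticipates the evenness of the integrand.\<close>
    have fin: "2 * (\<integral>\<^sup>+y. ?f y * indicator {0..real n} y \<partial>lborel) \<le> ennreal (2 / (r - 1))" for n :: nat
    proof -
      have "2 * (\<integral>\<^sup>+y. ?f y * indicator {0..real n} y \<partial>lborel)
          = (\<integral>\<^sup>+y. 2 * (?f y * indicator {0..real n} y) \<partial>lborel)"
        by (rule nn_integral_cmult[symmetric]) measurable
      also have "\<dots> = (\<integral>\<^sup>+y. brk r (m + b * y\<^sup>2) * ennreal (2 * b * y) * indicator {0..real n} y \<partial>lborel)"
        using b by (intro nn_integral_cong)
          (auto simp: indicator_def ennreal_mult' mult_ac simp flip: ennreal_numeral)
      also have "\<dots> = (\<integral>\<^sup>+y. ennreal ((1 + \<bar>m + b * y\<^sup>2\<bar>) powr (-r) * (2 * b * y) * indicator {0..real n} y) \<partial>lborel)"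
        using b by (intro nn_integral_cong) (auto simp: indicator_def ennreal_mult')
      also have "\<dots> = (\<integral>\<^sup>+u. ennreal ((1 + \<bar>u\<bar>) powr (-r) * indicator {m + b * 0\<^sup>2..m + b * (real n)\<^sup>2} u) \<partial>lborel)"
        using b by (intro nn_integral_substitution[symmetric])
          (auto intro!: derivative_eq_intros continuous_intros simp: set_borel_measurable_def)
      also have "\<dots> \<le> (\<integral>\<^sup>+u. brk r u \<partial>lborel)"
        by (intro nn_integral_mono) (auto simp: indicator_def)
      also have "\<dots> \<le> ennreal (2 / (r - 1))" by (rule nn_integral_brk[OF r])
      finally show ?thesis .
    qed
    have "(\<integral>\<^sup>+y. ?f y \<partial>lborel) \<le> 2 * (\<integral>\<^sup>+y. ?f y * indicator {0..} y \<partial>lborel)"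
      by (intro nn_integral_even_le) auto
    also have "(\<integral>\<^sup>+y. ?f y * indicator {0..} y \<partial>lborel) = (\<integral>\<^sup>+y. (SUP n::nat. ?f y * indicator {0..real n} y) \<partial>lborel)"
    proof (intro nn_integral_cong)
      fix y :: real
      obtain N :: nat where "y \<le> real N" using real_arch_simple by blast
      then have "?f y * indicator {0..} y \<le> ?f y * indicator {0..real N} y" by (auto simp: indicator_def)
      also have "\<dots> \<le> (SUP n::nat. ?f y * indicator {0..real n} y)" by (rule SUP_upper) simp
      finally show "?f y * indicator {0..} y = (SUP n::nat. ?f y * indicator {0..real n} y)"
        by (intro antisym SUP_least) (auto simp: indicator_def)
    qed
    also have "\<dots> = (SUP n::nat. (\<integral>\<^sup>+y. ?f y * indicator {0..real n} y \<partial>lborel))"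
      by (intro nn_integral_monotone_convergence_SUP) (auto simp: incseq_def le_fun_def indicator_def)
    also have "2 * \<dots> = (SUP n::nat. 2 * (\<integral>\<^sup>+y. ?f y * indicator {0..real n} y \<partial>lborel))"
      by (rule SUP_mult_left_ennreal)
    also have "\<dots> \<le> ennreal (2 / (r - 1))" using fin by (intro SUP_least)
    finally show ?thesis .
  qed
  consider "b = 0" | "0 < b" | "0 < -b" by linarith
  then show ?thesis
  proof cases
    case 3
    have "\<bar>- m + (- b) * y\<^sup>2\<bar> = \<bar>m + b * y\<^sup>2\<bar>" for y by (simp add: abs_minus_commute)
    then show ?thesis using pos[OF 3, of "-m"] 3 by simp
  qed (use pos in auto)
qed

text \<open>Without the full Jacobian, decay of order q > 1/2 still suffices. For b > 0, if m + b
  y^2 has the real roots c and -c, then |m + b y^2| \<ge> b (|y| - c)^2. The integrand thus decays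
  with exponent 2q > 1 around each root in the variable b^(1/2) y, uniformly in \<open>m\<close> and
  \<open>b\<close>.\<close>

lemma nn_integral_quadratic:
  assumes q: "1/2 < q"
  shows "(\<integral>\<^sup>+y. ennreal (sqrt \<bar>b\<bar>) * brk q (m + b * y\<^sup>2) \<partial>lborel) \<le> ennreal (2 powr q * (4 / (2*q - 1)))"
proof -
  have pos: "(\<integral>\<^sup>+y. ennreal (sqrt b) * brk q (m + b * y\<^sup>2) \<partial>lborel) \<le> ennreal (2 powr q * (4 / (2*q - 1)))"
    if b: "0 < b" for b m :: real
  proof -
    \<comment> \<open>The nonnegative root when m \<le> 0. The default 0 serves the rootless case,
      where |m + b y^2| \<ge> b y^2.\<close>
    define c where "c = (if m \<le> 0 then sqrt (- m / b) else 0)"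
    have c: "0 \<le> c" and cm: "m \<le> 0 \<Longrightarrow> m = - b * c\<^sup>2"
      using b by (auto simp: c_def divide_nonpos_pos)
    have low: "b * (\<bar>y\<bar> - c)\<^sup>2 \<le> \<bar>m + b * y\<^sup>2\<bar>" for y
    proof (cases "m \<le> 0")
      case True
      have "m + b * y\<^sup>2 = b * ((\<bar>y\<bar> - c) * (\<bar>y\<bar> + c))"
        using cm[OF True] by (simp add: algebra_simps power2_eq_square)
      then have "\<bar>m + b * y\<^sup>2\<bar> = b * (\<bar>\<bar>y\<bar> - c\<bar> * (\<bar>y\<bar> + c))" using b c by (simp add: abs_mult)
      moreover have "\<bar>\<bar>y\<bar> - c\<bar> * \<bar>\<bar>y\<bar> - c\<bar> \<le> \<bar>\<bar>y\<bar> - c\<bar> * (\<bar>y\<bar> + c)"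
        using c by (intro mult_left_mono) auto
      ultimately show ?thesis using b by (simp add: power2_eq_square)
    qed (use b in \<open>auto simp: c_def\<close>)
    have pw: "(1 + \<bar>m + b * y\<^sup>2\<bar>) powr (-q) \<le> 2 powr q * ((1 + \<bar>sqrt b * (\<bar>y\<bar> - c)\<bar>) powr (-(2*q)))" for y
    proof -
      define w where "w = \<bar>sqrt b * (\<bar>y\<bar> - c)\<bar>"
      have w0: "0 \<le> w" by (simp add: w_def)
      have "0 \<le> (1 - w)\<^sup>2" by simp
      then have "(1 + w)\<^sup>2 / 2 \<le> 1 + w\<^sup>2" by (simp add: power2_eq_square algebra_simps)
      also have "w\<^sup>2 = b * (\<bar>y\<bar> - c)\<^sup>2" using b by (simp add: w_def power_mult_distrib)
      also have "1 + \<dots> \<le> 1 + \<bar>m + b * y\<^sup>2\<bar>" using low by simp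
      finally have "(1 + \<bar>m + b * y\<^sup>2\<bar>) powr (-q) \<le> ((1 + w)\<^sup>2 / 2) powr (-q)"
        using q w0 by (intro powr_mono2' divide_pos_pos zero_less_power) auto
      also have "\<dots> = 2 powr q * ((1 + w) powr 2) powr (-q)"
        using w0 by (simp add: powr_divide powr_minus powr_numeral divide_simps)
      also have "((1 + w) powr 2) powr (-q) = (1 + w) powr (-(2*q))" by (simp only: powr_powr) simp
      finally show ?thesis by (simp only: w_def)
    qed
    have ptw: "ennreal (sqrt b) * brk q (m + b * y\<^sup>2) \<le>
        ennreal (2 powr q) * (ennreal (sqrt b) * brk (2*q) (- sqrt b * c + sqrt b * y))
        + ennreal (2 powr q) * (ennreal (sqrt b) * brk (2*q) (sqrt b * c + sqrt b * y))" for y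
    proof -
      have "(1 + \<bar>sqrt b * (\<bar>y\<bar> - c)\<bar>) powr (-(2*q)) \<le>
         (1 + \<bar>- sqrt b * c + sqrt b * y\<bar>) powr (-(2*q)) + (1 + \<bar>sqrt b * c + sqrt b * y\<bar>) powr (-(2*q))"
      proof (cases "0 \<le> y")
        case True
        then have "sqrt b * (\<bar>y\<bar> - c) = - sqrt b * c + sqrt b * y" by (simp add: algebra_simps)
        then show ?thesis by simp
      next
        case False
        then have "sqrt b * (\<bar>y\<bar> - c) = - (sqrt b * c + sqrt b * y)" by (simp add: algebra_simps)
        then have "\<bar>sqrt b * (\<bar>y\<bar> - c)\<bar> = \<bar>sqrt b * c + sqrt b * y\<bar>" by simp
        then show ?thesis by simp
      qed
      then have "sqrt b * (1 + \<bar>m + b * y\<^sup>2\<bar>) powr (-q) \<le> sqrt b * (2 powr q *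
         ((1 + \<bar>- sqrt b * c + sqrt b * y\<bar>) powr (-(2*q)) + (1 + \<bar>sqrt b * c + sqrt b * y\<bar>) powr (-(2*q))))"
        using pw[of y] b by (intro mult_left_mono order_trans[OF pw]) auto
      then have "sqrt b * (1 + \<bar>m + b * y\<^sup>2\<bar>) powr (-q) \<le>
         2 powr q * (sqrt b * (1 + \<bar>- sqrt b * c + sqrt b * y\<bar>) powr (-(2*q))) +
         2 powr q * (sqrt b * (1 + \<bar>sqrt b * c + sqrt b * y\<bar>) powr (-(2*q)))"
        by (simp only: distrib_left mult_ac)
      then show ?thesis using b by (simp flip: ennreal_mult ennreal_plus)
    qed
    have "(\<integral>\<^sup>+y. ennreal (sqrt b) * brk q (m + b * y\<^sup>2) \<partial>lborel) \<le>
       (\<integral>\<^sup>+y. ennreal (2 powr q) * (ennreal (sqrt b) * brk (2*q) (- sqrt b * c + sqrt b * y))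
        + ennreal (2 powr q) * (ennreal (sqrt b) * brk (2*q) (sqrt b * c + sqrt b * y)) \<partial>lborel)"
      by (intro nn_integral_mono ptw)
    also have "\<dots> = ennreal (2 powr q) * (ennreal (sqrt b) * (\<integral>\<^sup>+y. brk (2*q) (- sqrt b * c + sqrt b * y) \<partial>lborel))
        + ennreal (2 powr q) * (ennreal (sqrt b) * (\<integral>\<^sup>+y. brk (2*q) (sqrt b * c + sqrt b * y) \<partial>lborel))"
      by (simp add: nn_integral_add nn_integral_cmult)
    also have "\<dots> \<le> ennreal (2 powr q) * ennreal (2 / (2*q - 1)) + ennreal (2 powr q) * ennreal (2 / (2*q - 1))"
      using nn_integral_brk_affine[of "2*q" "sqrt b" "- sqrt b * c"] nn_integral_brk_affine[of "2*q" "sqrt b" "sqrt b * c"] b q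
      by (intro add_mono mult_left_mono) auto
    also have "\<dots> = ennreal (2 powr q * (4 / (2*q - 1)))"
      using q by (simp flip: ennreal_mult ennreal_plus)
    finally show ?thesis .
  qed
  consider "b = 0" | "0 < b" | "0 < -b" by linarith
  then show ?thesis
  proof cases
    case 3
    have "\<bar>- m + (- b) * y\<^sup>2\<bar> = \<bar>m + b * y\<^sup>2\<bar>" for y by (simp add: abs_minus_commute)
    then show ?thesis using pos[OF 3, of "-m"] 3 by simp
  qed (use pos in auto)
qed

section \<open>The modulation function and the resonance relation\<close>

lemma borel_fst_snd [measurable]:
  "fst \<in> borel_measurable (borel :: ('a::second_countable_topology \<times> 'b::second_countable_topology) measure)"
  "snd \<in> borel_measurable (borel :: ('a::second_countable_topology \<times> 'b::second_countable_topology) measure)"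
  by (simp_all add: borel_prod[symmetric])

definition lam :: "real \<Rightarrow> real \<times> real \<Rightarrow> real" where
  "lam \<alpha> \<zeta> = jbr (\<i> * complex_of_real (fst \<zeta> - (snd \<zeta>)^3) + complex_of_real (\<bar>snd \<zeta>\<bar> powr (2*\<alpha>)))"

lemma lam_eq: "lam \<alpha> \<zeta> = sqrt (1 + ((fst \<zeta> - snd \<zeta> ^ 3)\<^sup>2 + (\<bar>snd \<zeta>\<bar> powr (2*\<alpha>))\<^sup>2))"
  unfolding lam_def jbr_def by (simp add: cmod_power2)

lemma lam_ge1: "1 \<le> lam \<alpha> \<zeta>" by (simp add: lam_eq)
lemma lam_pos: "0 < lam \<alpha> \<zeta>" using lam_ge1[of \<alpha> \<zeta>] by linarith
lemma abs_le_lam: "\<bar>fst \<zeta> - snd \<zeta> ^ 3\<bar> \<le> lam \<alpha> \<zeta>" unfolding lam_eq by (rule real_le_rsqrt) auto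
lemma powr_le_lam: "\<bar>snd \<zeta>\<bar> powr (2*\<alpha>) \<le> lam \<alpha> \<zeta>" unfolding lam_eq by (rule real_le_rsqrt) auto
lemma half_brk_le_lam: "(1 + \<bar>fst \<zeta> - snd \<zeta> ^ 3\<bar>) / 2 \<le> lam \<alpha> \<zeta>"
  using lam_ge1[of \<alpha> \<zeta>] abs_le_lam[of \<zeta> \<alpha>] by simp
lemma lam_uminus: "lam \<alpha> (- \<zeta>) = lam \<alpha> \<zeta>"
proof -
  have "(- fst \<zeta> + snd \<zeta> ^ 3)\<^sup>2 = (fst \<zeta> - snd \<zeta> ^ 3)\<^sup>2" by (simp add: power2_commute)
  then show ?thesis by (simp add: lam_eq)
qed
lemma lam_diff_commute: "lam \<alpha> (a - b) = lam \<alpha> (b - a)" using lam_uminus[of \<alpha> "a - b"] by simp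

lemma lam_measurable [measurable]: "lam \<alpha> \<in> borel_measurable borel"
  unfolding lam_eq[abs_def] by measurable

text \<open>The time frequencies cancel, and \<xi>^3 - \<xi>_1^3 - \<xi>_2^3 = 3 \<xi> \<xi>_1
  \<xi>_2 when \<xi> = \<xi>_1 + \<xi>_2. The factor 3 matches the number of modulations, so their
  maximum dominates the product with constant 1.\<close>

lemma resonance:
  fixes \<zeta> \<eta> :: "real \<times> real"
  shows
  "fst \<zeta> - snd \<zeta>^3 - (fst \<eta> - snd \<eta>^3) - (fst (\<zeta> - \<eta>) - snd (\<zeta> - \<eta>)^3) = - (3 * (snd \<zeta> * snd \<eta> * snd (\<zeta> - \<eta>)))"
  by (simp add: power3_eq_cube) algebra

lemma resonance_le_max:
  "\<bar>snd \<zeta> * snd \<eta> * snd (\<zeta> - \<eta>)\<bar> \<le> max (lam \<alpha> \<zeta>) (max (lam \<alpha> \<eta>) (lam \<alpha> (\<zeta> - \<eta>)))"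
  using resonance[of \<zeta> \<eta>] abs_le_lam[of \<zeta> \<alpha>] abs_le_lam[of \<eta> \<alpha>] abs_le_lam[of "\<zeta> - \<eta>" \<alpha>]
  by linarith

section \<open>Integrals involving one or two modulations\<close>

lemma nn_integral_lam_slice:
  assumes r: "1 < r"
  shows "(\<integral>\<^sup>+t. ennreal (lam \<alpha> (t, x) powr (-r)) \<partial>lborel) \<le> ennreal (2 powr r * (2 / (r - 1)))"
proof -
  have "(\<integral>\<^sup>+t. ennreal (lam \<alpha> (t, x) powr (-r)) \<partial>lborel) \<le> (\<integral>\<^sup>+t. ennreal (2 powr r) * brk r (t - x ^ 3) \<partial>lborel)"
  proof (intro nn_integral_mono)
    fix t :: real
    have "lam \<alpha> (t, x) powr (-r) \<le> ((1 + \<bar>t - x^3\<bar>) / 2) powr (-r)"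
      using r half_brk_le_lam[of "(t, x)" \<alpha>] by (intro powr_mono2') auto
    also have "\<dots> = 2 powr r * (1 + \<bar>t - x ^ 3\<bar>) powr (-r)"
      by (simp add: powr_divide powr_minus divide_simps)
    finally show "ennreal (lam \<alpha> (t, x) powr (-r)) \<le> ennreal (2 powr r) * brk r (t - x ^ 3)"
      by (simp flip: ennreal_mult)
  qed
  also have "\<dots> = ennreal (2 powr r) * (\<integral>\<^sup>+t. brk r (t - x ^ 3) \<partial>lborel)"
    by (rule nn_integral_cmult) auto
  also have "\<dots> \<le> ennreal (2 powr r) * ennreal (2 / (r - 1))"
    using nn_integral_brk_affine[OF r, of 1 "- (x ^ 3)"] by (intro mult_left_mono) auto
  finally show ?thesis using r by (simp flip: ennreal_mult)
qed

lemma nn_integral_lam_slice':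
  assumes r: "1 < r"
  shows "(\<integral>\<^sup>+t. ennreal (lam \<alpha> (s - t, x) powr (-r)) \<partial>lborel) \<le> ennreal (2 powr r * (2 / (r - 1)))"
proof -
  have [measurable]: "(\<lambda>t. lam \<alpha> (t, x)) \<in> borel_measurable borel"
    using lam_measurable by (rule measurable_compose[rotated]) (simp add: borel_prod[symmetric])
  have "(\<integral>\<^sup>+t. ennreal (lam \<alpha> (t, x) powr (-r)) \<partial>lborel)
     = (\<integral>\<^sup>+t. ennreal (lam \<alpha> (s - t, x) powr (-r)) \<partial>lborel)"
    using nn_integral_real_affine[of "\<lambda>t. ennreal (lam \<alpha> (t, x) powr (-r))" "-1" s] by simp
  then show ?thesis using nn_integral_lam_slice[OF r, of \<alpha> x] by simp
qed

text \<open>The larger of the two factors is at least a quarter of \<open>1 + \<bar>E\<bar>\<close>, where \<open>E\<close> is the sum of the two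
  modulations and depends only on the frequencies.\<close>
lemma lam_pair_le:
  assumes r: "1 < r" and e: "0 \<le> e" "e \<le> 1/2"
  defines "E \<equiv> \<lambda>\<zeta> x. (fst \<zeta> - snd \<zeta>^3 / 4) + (- 3 * snd \<zeta>) * (x - snd \<zeta> / 2)\<^sup>2"
  shows "(lam \<alpha> \<eta> * lam \<alpha> (\<zeta> - \<eta>)) powr (-r) * max (lam \<alpha> \<eta>) (lam \<alpha> (\<zeta> - \<eta>)) powr e
    \<le> 4 powr r * (1 + \<bar>E \<zeta> (snd \<eta>)\<bar>) powr (-(r - e)) * (lam \<alpha> \<eta> powr (-r) + lam \<alpha> (\<zeta> - \<eta>) powr (-r))"
proof -
  define D where "D = 1 + \<bar>E \<zeta> (snd \<eta>)\<bar>"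
  \<comment> \<open>Completing the square at \<xi>/2 gives the coefficient -3\<xi> and the constant
    \<tau> - \<xi>^3/4; the inner time frequency drops out of the sum.\<close>
  have "E \<zeta> (snd \<eta>) = (fst \<eta> - snd \<eta>^3) + (fst (\<zeta> - \<eta>) - snd (\<zeta> - \<eta>)^3)"
    unfolding E_def by (simp add: power3_eq_cube power2_eq_square field_simps)
  then have "D \<le> (1 + \<bar>fst \<eta> - snd \<eta>^3\<bar>) + (1 + \<bar>fst (\<zeta> - \<eta>) - snd (\<zeta> - \<eta>)^3\<bar>)"
    unfolding D_def by linarith
  then have D: "D / 4 \<le> max (lam \<alpha> \<eta>) (lam \<alpha> (\<zeta> - \<eta>))" "0 < D"
    using half_brk_le_lam[of \<eta> \<alpha>] half_brk_le_lam[of "\<zeta> - \<eta>" \<alpha>] by (simp_all add: D_def max_def)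
  have *: "(a * b) powr (-r) * b powr e \<le> 4 powr r * D powr (-(r - e)) * a powr (-r)"
    if "1 \<le> a" "D / 4 \<le> b" for a b
  proof -
    have b: "0 < b" using that D by linarith
    have "b powr (-r + e) \<le> (D / 4) powr (-(r - e))" 
    proof -
      have "b powr (-(r - e)) \<le> (D / 4) powr (-(r - e))" using that D e r by (intro powr_mono2') auto
      then show ?thesis by simp
    qed
    also have "\<dots> \<le> 4 powr r * D powr (-(r - e))" using D e r by (intro powr_minus_scale) auto
    finally have "a powr (-r) * b powr (-r + e) \<le> a powr (-r) * (4 powr r * D powr (-(r - e)))"
      by (intro mult_left_mono) auto
    then show ?thesis using that b by (simp add: powr_mult powr_add[symmetric] mult_ac)
  qed
  show ?thesis
  proof (cases "lam \<alpha> \<eta> \<le> lam \<alpha> (\<zeta> - \<eta>)")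
    case True
    have "(lam \<alpha> \<eta> * lam \<alpha> (\<zeta> - \<eta>)) powr (-r) * lam \<alpha> (\<zeta> - \<eta>) powr e \<le> 4 powr r * D powr (-(r - e)) * lam \<alpha> \<eta> powr (-r)"
      using D True lam_ge1 by (intro *) auto
    also have "\<dots> \<le> 4 powr r * D powr (-(r - e)) * (lam \<alpha> \<eta> powr (-r) + lam \<alpha> (\<zeta> - \<eta>) powr (-r))"
      by (intro mult_left_mono) auto
    finally show ?thesis using True by (simp add: D_def max_def)
  next
    case False
    have "(lam \<alpha> (\<zeta> - \<eta>) * lam \<alpha> \<eta>) powr (-r) * lam \<alpha> \<eta> powr e \<le> 4 powr r * D powr (-(r - e)) * lam \<alpha> (\<zeta> - \<eta>) powr (-r)"
      using D False lam_ge1 by (intro *) auto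
    also have "\<dots> \<le> 4 powr r * D powr (-(r - e)) * (lam \<alpha> \<eta> powr (-r) + lam \<alpha> (\<zeta> - \<eta>) powr (-r))"
      by (intro mult_left_mono) auto
    finally show ?thesis using False by (simp add: D_def max_def mult.commute[of "lam \<alpha> \<eta>"])
  qed
qed

lemma nn_integral_prod_swap:
  fixes f :: "real \<times> real \<Rightarrow> ennreal"
  assumes [measurable]: "f \<in> borel_measurable borel"
  shows "(\<integral>\<^sup>+\<eta>. f \<eta> \<partial>lborel) = (\<integral>\<^sup>+x. (\<integral>\<^sup>+t. f (t, x) \<partial>lborel) \<partial>lborel)"
  unfolding lborel_prod[symmetric]
  by (subst lborel_pair.nn_integral_snd) (auto simp: lborel_prod)

text \<open>At a fixed inner frequency the time variable is integrated first: the modulation that is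
  not traded for \<open>E\<close> has exponent r > 1 and contributes a constant. What remains is a
  one-dimensional integral against a power of the quadratic \<open>E\<close>, with \<open>e\<close>
  the decay given away to the factor \<open>max ... powr e\<close>.\<close>

lemma nn_integral_lam_pair:
  assumes r: "1 < r" and e: "0 \<le> e" "e \<le> 1/2" and [measurable]: "g \<in> borel_measurable borel" and g0: "\<And>x. 0 \<le> g x"
  defines "E \<equiv> \<lambda>\<zeta> x. (fst \<zeta> - snd \<zeta>^3 / 4) + (- 3 * snd \<zeta>) * (x - snd \<zeta> / 2)\<^sup>2"
  shows "(\<integral>\<^sup>+\<eta>. ennreal (g (snd \<eta>) * ((lam \<alpha> \<eta> * lam \<alpha> (\<zeta> - \<eta>)) powr (-r) * max (lam \<alpha> \<eta>) (lam \<alpha> (\<zeta> - \<eta>)) powr e)) \<partial>lborel)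
    \<le> ennreal (4 powr r * (2 * (2 powr r * (2 / (r - 1))))) * (\<integral>\<^sup>+x. ennreal (g x) * brk (r - e) (E \<zeta> x) \<partial>lborel)"
proof -
  let ?K = "4 powr r * (2 * (2 powr r * (2 / (r - 1))))"
  have [measurable]: "(\<lambda>x. brk (r - e) (E \<zeta> x)) \<in> borel_measurable borel" unfolding E_def by measurable
  have slice[measurable]: "(\<lambda>t. lam \<alpha> (t, x)) \<in> borel_measurable borel" "(\<lambda>t. lam \<alpha> (s - t, x)) \<in> borel_measurable borel" for x s
    using lam_measurable by (rule measurable_compose[rotated], simp add: borel_prod[symmetric])+
  have "(\<integral>\<^sup>+\<eta>. ennreal (g (snd \<eta>) * ((lam \<alpha> \<eta> * lam \<alpha> (\<zeta> - \<eta>)) powr (-r) * max (lam \<alpha> \<eta>) (lam \<alpha> (\<zeta> - \<eta>)) powr e)) \<partial>lborel)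
    = (\<integral>\<^sup>+x. (\<integral>\<^sup>+t. ennreal (g x * ((lam \<alpha> (t, x) * lam \<alpha> (\<zeta> - (t, x))) powr (-r) * max (lam \<alpha> (t, x)) (lam \<alpha> (\<zeta> - (t, x))) powr e)) \<partial>lborel) \<partial>lborel)"
    by (subst nn_integral_prod_swap) auto
  also have "\<dots> \<le> (\<integral>\<^sup>+x. ennreal ?K * (ennreal (g x) * brk (r - e) (E \<zeta> x)) \<partial>lborel)"
  proof (intro nn_integral_mono)
    fix x :: real
    let ?c = "g x * (4 powr r * (1 + \<bar>E \<zeta> x\<bar>) powr (-(r - e)))"
    have c0: "0 \<le> ?c" using g0 by auto
    have "(\<integral>\<^sup>+t. ennreal (g x * ((lam \<alpha> (t, x) * lam \<alpha> (\<zeta> - (t, x))) powr (-r) * max (lam \<alpha> (t, x)) (lam \<alpha> (\<zeta> - (t, x))) powr e)) \<partial>lborel)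
      \<le> (\<integral>\<^sup>+t. ennreal ?c * (ennreal (lam \<alpha> (t, x) powr (-r)) + ennreal (lam \<alpha> (fst \<zeta> - t, snd \<zeta> - x) powr (-r))) \<partial>lborel)"
    proof (intro nn_integral_mono)
      fix t :: real
      have "g x * ((lam \<alpha> (t, x) * lam \<alpha> (\<zeta> - (t, x))) powr (-r) * max (lam \<alpha> (t, x)) (lam \<alpha> (\<zeta> - (t, x))) powr e)
        \<le> g x * (4 powr r * (1 + \<bar>E \<zeta> x\<bar>) powr (-(r - e)) * (lam \<alpha> (t, x) powr (-r) + lam \<alpha> (\<zeta> - (t, x)) powr (-r)))"
        using lam_pair_le[OF r e, of \<alpha> "(t, x)" \<zeta>] g0 unfolding E_def by (intro mult_left_mono) auto
      also have "\<dots> = ?c * (lam \<alpha> (t, x) powr (-r) + lam \<alpha> (fst \<zeta> - t, snd \<zeta> - x) powr (-r))"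
        by (simp add: minus_prod_def mult_ac)
      finally show "ennreal (g x * ((lam \<alpha> (t, x) * lam \<alpha> (\<zeta> - (t, x))) powr (-r) * max (lam \<alpha> (t, x)) (lam \<alpha> (\<zeta> - (t, x))) powr e))
        \<le> ennreal ?c * (ennreal (lam \<alpha> (t, x) powr (-r)) + ennreal (lam \<alpha> (fst \<zeta> - t, snd \<zeta> - x) powr (-r)))"
        using c0 by (simp only: ennreal_plus[symmetric] powr_ge_zero ennreal_mult[symmetric] add_nonneg_nonneg ennreal_leI)
    qed
    also have "\<dots> = ennreal ?c * ((\<integral>\<^sup>+t. ennreal (lam \<alpha> (t, x) powr (-r)) \<partial>lborel) + (\<integral>\<^sup>+t. ennreal (lam \<alpha> (fst \<zeta> - t, snd \<zeta> - x) powr (-r)) \<partial>lborel))"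
      by (subst nn_integral_cmult, measurable, subst nn_integral_add) auto
    also have "\<dots> \<le> ennreal ?c * (ennreal (2 powr r * (2 / (r - 1))) + ennreal (2 powr r * (2 / (r - 1))))"
      by (intro mult_left_mono add_mono nn_integral_lam_slice nn_integral_lam_slice' r) auto
    also have "\<dots> = ennreal (?c * (2 * (2 powr r * (2 / (r - 1)))))"
      using r c0 by (simp flip: ennreal_plus ennreal_mult)
    also have "?c * (2 * (2 powr r * (2 / (r - 1)))) = ?K * (g x * (1 + \<bar>E \<zeta> x\<bar>) powr (-(r - e)))" by simp
    also have "ennreal \<dots> = ennreal ?K * (ennreal (g x) * brk (r - e) (E \<zeta> x))"
      using r g0 by (simp only: ennreal_mult[symmetric] powr_ge_zero mult_nonneg_nonneg divide_nonneg_nonneg)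
    finally show "(\<integral>\<^sup>+t. ennreal (g x * ((lam \<alpha> (t, x) * lam \<alpha> (\<zeta> - (t, x))) powr (-r) * max (lam \<alpha> (t, x)) (lam \<alpha> (\<zeta> - (t, x))) powr e)) \<partial>lborel)
      \<le> ennreal ?K * (ennreal (g x) * brk (r - e) (E \<zeta> x))" .
  qed
  also have "\<dots> = ennreal ?K * (\<integral>\<^sup>+x. ennreal (g x) * brk (r - e) (E \<zeta> x) \<partial>lborel)"
    by (rule nn_integral_cmult) measurable
  finally show ?thesis .
qed

text \<open>The weight is one third of the absolute derivative of the quadratic phase, so after
  centring at \<xi>/2 it is dominated by the Jacobian of the substitution, and decay of order r > 1
  is enough.\<close>

lemma nn_integral_kernel_weighted:
  assumes r: "1 < r"
  shows "(\<integral>\<^sup>+\<eta>. ennreal (\<bar>snd \<zeta>\<bar> * \<bar>2 * snd \<eta> - snd \<zeta>\<bar> * (lam \<alpha> \<eta> * lam \<alpha> (\<zeta> - \<eta>)) powr (-r)) \<partial>lborel)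
    \<le> ennreal (4 powr r * (2 * (2 powr r * (2 / (r - 1)))) * (2 / (r - 1)))"
proof -
  let ?K = "4 powr r * (2 * (2 powr r * (2 / (r - 1))))"
  let ?m = "fst \<zeta> - snd \<zeta>^3 / 4" let ?b = "- 3 * snd \<zeta>"
  have pos: "max (lam \<alpha> \<eta>) (lam \<alpha> (\<zeta> - \<eta>)) \<noteq> 0" for \<eta> using lam_pos[of \<alpha> \<eta>] by linarith
  have "(\<integral>\<^sup>+\<eta>. ennreal (\<bar>snd \<zeta>\<bar> * \<bar>2 * snd \<eta> - snd \<zeta>\<bar> * (lam \<alpha> \<eta> * lam \<alpha> (\<zeta> - \<eta>)) powr (-r)) \<partial>lborel)
     \<le> ennreal ?K * (\<integral>\<^sup>+x. ennreal (\<bar>snd \<zeta>\<bar> * \<bar>2 * x - snd \<zeta>\<bar>) * brk (r - 0) (?m + ?b * (x - snd \<zeta> / 2)\<^sup>2) \<partial>lborel)"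
    using nn_integral_lam_pair[OF r, of 0 "\<lambda>x. \<bar>snd \<zeta>\<bar> * \<bar>2 * x - snd \<zeta>\<bar>" \<alpha> \<zeta>] pos by simp
  also have "(\<integral>\<^sup>+x. ennreal (\<bar>snd \<zeta>\<bar> * \<bar>2 * x - snd \<zeta>\<bar>) * brk (r - 0) (?m + ?b * (x - snd \<zeta> / 2)\<^sup>2) \<partial>lborel)
     = (\<integral>\<^sup>+y. ennreal (\<bar>snd \<zeta>\<bar> * (2 * \<bar>y\<bar>)) * brk r (?m + ?b * y\<^sup>2) \<partial>lborel)"
    by (subst nn_integral_real_affine[where c=1 and t="snd \<zeta> / 2"]) (auto simp: abs_mult)
  also have "\<dots> \<le> (\<integral>\<^sup>+y. ennreal (\<bar>?b\<bar> * \<bar>y\<bar>) * brk r (?m + ?b * y\<^sup>2) \<partial>lborel)"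
  proof (intro nn_integral_mono mult_right_mono ennreal_leI)
    fix y show "\<bar>snd \<zeta>\<bar> * (2 * \<bar>y\<bar>) \<le> \<bar>?b\<bar> * \<bar>y\<bar>" by (simp add: abs_mult)
  qed auto
  also have "\<dots> \<le> ennreal (2 / (r - 1))" by (rule nn_integral_quadratic_weighted[OF r])
  finally show ?thesis using r by (subst ennreal_mult) (auto simp: mult_left_mono)
qed

text \<open>The square root of the larger modulation costs half a power of decay. What is left, r -
  1/2 > 1/2, is the range in which the quadratic integral with weight |\<xi>|^(1/2) is still
  uniformly bounded.\<close>

lemma nn_integral_kernel_sqrt:
  assumes r: "1 < r"
  shows "(\<integral>\<^sup>+\<eta>. ennreal (sqrt \<bar>snd \<zeta>\<bar> * ((lam \<alpha> \<eta> * lam \<alpha> (\<zeta> - \<eta>)) powr (-r) * sqrt (max (lam \<alpha> \<eta>) (lam \<alpha> (\<zeta> - \<eta>))))) \<partial>lborel)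
    \<le> ennreal (4 powr r * (2 * (2 powr r * (2 / (r - 1)))) * (2 powr (r - 1/2) * (4 / (2 * (r - 1/2) - 1))))"
proof -
  let ?K = "4 powr r * (2 * (2 powr r * (2 / (r - 1))))"
  let ?m = "fst \<zeta> - snd \<zeta>^3 / 4" let ?b = "- 3 * snd \<zeta>"
  have sq: "max (lam \<alpha> \<eta>) (lam \<alpha> (\<zeta> - \<eta>)) powr (1/2) = sqrt (max (lam \<alpha> \<eta>) (lam \<alpha> (\<zeta> - \<eta>)))" for \<eta>
    using lam_pos[of \<alpha> \<eta>] by (intro powr_half_sqrt) linarith
  have "(\<integral>\<^sup>+\<eta>. ennreal (sqrt \<bar>snd \<zeta>\<bar> * ((lam \<alpha> \<eta> * lam \<alpha> (\<zeta> - \<eta>)) powr (-r) * sqrt (max (lam \<alpha> \<eta>) (lam \<alpha> (\<zeta> - \<eta>))))) \<partial>lborel)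
     \<le> ennreal ?K * (\<integral>\<^sup>+x. ennreal (sqrt \<bar>snd \<zeta>\<bar>) * brk (r - 1/2) (?m + ?b * (x - snd \<zeta> / 2)\<^sup>2) \<partial>lborel)"
    using nn_integral_lam_pair[OF r, of "1/2" "\<lambda>x. sqrt \<bar>snd \<zeta>\<bar>" \<alpha> \<zeta>] unfolding sq by simp
  also have "(\<integral>\<^sup>+x. ennreal (sqrt \<bar>snd \<zeta>\<bar>) * brk (r - 1/2) (?m + ?b * (x - snd \<zeta> / 2)\<^sup>2) \<partial>lborel)
     = (\<integral>\<^sup>+y. ennreal (sqrt \<bar>snd \<zeta>\<bar>) * brk (r - 1/2) (?m + ?b * y\<^sup>2) \<partial>lborel)"
    by (subst nn_integral_real_affine[where c=1 and t="snd \<zeta> / 2"]) auto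
  also have "\<dots> \<le> (\<integral>\<^sup>+y. ennreal (sqrt \<bar>?b\<bar>) * brk (r - 1/2) (?m + ?b * y\<^sup>2) \<partial>lborel)"
    by (intro nn_integral_mono mult_right_mono ennreal_leI) auto
  also have "\<dots> \<le> ennreal (2 powr (r - 1/2) * (4 / (2 * (r - 1/2) - 1)))"
    using r by (intro nn_integral_quadratic) auto
  finally show ?thesis using r by (subst ennreal_mult) (auto simp: mult_left_mono)
qed

lemma nn_integral_powr_sing:
  assumes "0 < k" "0 \<le> L"
  shows "(\<integral>\<^sup>+x. ennreal (if \<bar>x\<bar> \<le> L then \<bar>x\<bar> powr (k - 1) else 0) \<partial>lborel) \<le> ennreal (2 * (L powr k / k))"
proof -
  have "(\<integral>\<^sup>+x. ennreal (if \<bar>x\<bar> \<le> L then \<bar>x\<bar> powr (k - 1) else 0) \<partial>lborel)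
     \<le> 2 * (\<integral>\<^sup>+x. ennreal (if \<bar>x\<bar> \<le> L then \<bar>x\<bar> powr (k - 1) else 0) * indicator {0..} x \<partial>lborel)"
    by (intro nn_integral_even_le) auto
  also have "(\<integral>\<^sup>+x. ennreal (if \<bar>x\<bar> \<le> L then \<bar>x\<bar> powr (k - 1) else 0) * indicator {0..} x \<partial>lborel)
     = (\<integral>\<^sup>+x. ennreal (x powr (k - 1)) * indicator {0..L} x \<partial>lborel)"
    by (intro nn_integral_cong) (auto simp: indicator_def)
  also have "\<dots> = ennreal (L powr k / k)"
  proof -
    have "((\<lambda>x. x powr (k - 1)) has_integral (L powr k / k)) {0..L}"
      using has_integral_powr_from_0[of "k - 1" L] assms by simp
    from nn_integral_has_integral_lebesgue[OF _ this] show ?thesis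
      by (simp add: ennreal_mult' ennreal_indicator mult.commute)
  qed
  also have "2 * ennreal (L powr k / k) = ennreal (2 * (L powr k / k))"
    by (simp only: ennreal_mult'[of 2] zero_le_numeral ennreal_numeral)
  finally show ?thesis .
qed

context exponents begin

lemma lowf_measurable [measurable]: "lowf u \<in> borel_measurable borel"
  unfolding lowf_def[abs_def] by measurable

text \<open>Time and frequency decouple: the remaining modulation integrates to a constant in time,
  and the normalising factor of \<open>lowf\<close> compensates the mass of |v|^(\<kappa>-1) on its
  interval, leaving 2/\<kappa>.\<close>

lemma nn_integral_kernel_low:
  "(\<integral>\<^sup>+\<eta>. ennreal (lowf (snd \<zeta>) (snd \<eta>) * lam \<alpha> (\<zeta> - \<eta>) powr (-r)) \<partial>lborel)
    \<le> ennreal (2 powr r * (2 / (r - 1)) * (2 / \<kappa>))"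
proof -
  let ?L = "10 * jap (snd \<zeta>) powr \<beta>"
  have L: "0 < ?L" using jap_pos[of "snd \<zeta>"] by simp
  have slice[measurable]: "(\<lambda>t. lam \<alpha> (s - t, x)) \<in> borel_measurable borel" for x s
    using lam_measurable by (rule measurable_compose[rotated]) (simp add: borel_prod[symmetric])
  have "(\<integral>\<^sup>+\<eta>. ennreal (lowf (snd \<zeta>) (snd \<eta>) * lam \<alpha> (\<zeta> - \<eta>) powr (-r)) \<partial>lborel)
     = (\<integral>\<^sup>+x. (\<integral>\<^sup>+t. ennreal (lowf (snd \<zeta>) x) * ennreal (lam \<alpha> (\<zeta> - (t, x)) powr (-r)) \<partial>lborel) \<partial>lborel)"
    by (subst nn_integral_prod_swap) (auto simp: lowf_nonneg ennreal_mult)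
  also have "\<dots> = (\<integral>\<^sup>+x. (\<integral>\<^sup>+t. ennreal (lowf (snd \<zeta>) x) * ennreal (lam \<alpha> (fst \<zeta> - t, snd \<zeta> - x) powr (-r)) \<partial>lborel) \<partial>lborel)"
    by (simp add: minus_prod_def)
  also have "\<dots> \<le> (\<integral>\<^sup>+x. ennreal (2 powr r * (2 / (r - 1)) * ?L powr (-\<kappa>)) * ennreal (if \<bar>x\<bar> \<le> ?L then \<bar>x\<bar> powr (\<kappa> - 1) else 0) \<partial>lborel)"
  proof (intro nn_integral_mono)
    fix x :: real
    have "(\<integral>\<^sup>+t. ennreal (lowf (snd \<zeta>) x) * ennreal (lam \<alpha> (fst \<zeta> - t, snd \<zeta> - x) powr (-r)) \<partial>lborel)
       = ennreal (lowf (snd \<zeta>) x) * (\<integral>\<^sup>+t. ennreal (lam \<alpha> (fst \<zeta> - t, snd \<zeta> - x) powr (-r)) \<partial>lborel)"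
      by (rule nn_integral_cmult) measurable
    also have "\<dots> \<le> ennreal (lowf (snd \<zeta>) x) * ennreal (2 powr r * (2 / (r - 1)))"
      by (intro mult_left_mono nn_integral_lam_slice' r1) auto
    also have "\<dots> = ennreal (2 powr r * (2 / (r - 1)) * ?L powr (-\<kappa>)) * ennreal (if \<bar>x\<bar> \<le> ?L then \<bar>x\<bar> powr (\<kappa> - 1) else 0)"
      using r1 by (simp add: lowf_def mult_ac flip: ennreal_mult)
    finally show "(\<integral>\<^sup>+t. ennreal (lowf (snd \<zeta>) x) * ennreal (lam \<alpha> (fst \<zeta> - t, snd \<zeta> - x) powr (-r)) \<partial>lborel) \<le> \<dots>" .
  qed
  also have "\<dots> = ennreal (2 powr r * (2 / (r - 1)) * ?L powr (-\<kappa>)) * (\<integral>\<^sup>+x. ennreal (if \<bar>x\<bar> \<le> ?L then \<bar>x\<bar> powr (\<kappa> - 1) else 0) \<partial>lborel)"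
    by (rule nn_integral_cmult) measurable
  also have "\<dots> \<le> ennreal (2 powr r * (2 / (r - 1)) * ?L powr (-\<kappa>)) * ennreal (2 * (?L powr \<kappa> / \<kappa>))"
    using L kap by (intro mult_left_mono nn_integral_powr_sing) auto
  also have "\<dots> = ennreal (2 powr r * (2 / (r - 1)) * ?L powr (-\<kappa>) * (2 * (?L powr \<kappa> / \<kappa>)))"
    using r1 kap by (intro ennreal_mult[symmetric]) auto
  also have "2 powr r * (2 / (r - 1)) * ?L powr (-\<kappa>) * (2 * (?L powr \<kappa> / \<kappa>)) = 2 powr r * (2 / (r - 1)) * (2 / \<kappa>) * (?L powr (-\<kappa>) * ?L powr \<kappa>)"
    by simp
  also have "?L powr (-\<kappa>) * ?L powr \<kappa> = 1" using L by (simp flip: powr_add)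
  finally show ?thesis by simp
qed

end

section \<open>A smooth cutoff and its Fourier transform\<close>

text \<open>A smooth function on the line together with all its derivatives, index 0 being the
  function itself. Smoothness of test functions asks for an explicit family of partial derivatives,
  so every construction is carried out on whole families.\<close>

definition jet :: "(nat \<Rightarrow> real \<Rightarrow> complex) \<Rightarrow> bool" where
  "jet g \<longleftrightarrow> (\<forall>n t. (g n has_vector_derivative g (Suc n) t) (at t))"

lemma jetD: "jet g \<Longrightarrow> (g n has_vector_derivative g (Suc n) t) (at t)"
  by (simp add: jet_def)

lemma jet_continuous: "jet g \<Longrightarrow> continuous_on A (g n)"
  by (intro continuous_at_imp_continuous_on ballI) (blast intro: jetD has_vector_derivative_continuous)

lemma jet_cis: "jet (\<lambda>n t. (\<i> * of_real u)^n * cis (t * u))"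
  unfolding jet_def
proof (intro allI)
  fix n t
  have "((\<lambda>t. cis (t * u)) has_vector_derivative (\<i> * of_real u) * cis (t * u)) (at t)"
  proof -
    have "((\<lambda>z. exp (\<i> * (z * of_real u))) has_field_derivative (\<i> * of_real u) * exp (\<i> * (of_real t * of_real u))) (at (of_real t))"
      by (auto intro!: derivative_eq_intros)
    from has_vector_derivative_real_field[OF this] show ?thesis by (simp add: cis_conv_exp)
  qed
  then have "((\<lambda>t. (\<i> * of_real u)^n * cis (t * u)) has_vector_derivative (\<i> * of_real u)^n * ((\<i> * of_real u) * cis (t * u))) (at t)"
    by (rule has_vector_derivative_mult_right)
  then show "((\<lambda>t. (\<i> * of_real u)^n * cis (t * u)) has_vector_derivative (\<i> * of_real u)^Suc n * cis (t * u)) (at t)"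
    by (simp add: mult_ac)
qed

lemma jet_diff: "jet f \<Longrightarrow> jet g \<Longrightarrow> jet (\<lambda>n t. f n t - g n t)"
  unfolding jet_def by (auto intro!: derivative_intros)

lemma jet_cmult: "jet f \<Longrightarrow> jet (\<lambda>n t. c * f n t)"
  unfolding jet_def by (auto intro!: has_vector_derivative_mult_right)

lemma jet_affine:
  assumes "jet f" shows "jet (\<lambda>n t. of_real (c^n) * f n (d + c * t))"
  unfolding jet_def
proof (intro allI)
  fix n t
  have "((f n \<circ> (\<lambda>t. d + c * t)) has_vector_derivative c *\<^sub>R f (Suc n) (d + c * t)) (at t)"
    by (intro vector_diff_chain_at jetD assms) (auto intro!: derivative_eq_intros)
  then have "((\<lambda>t. of_real (c^n) * f n (d + c * t)) has_vector_derivative of_real (c^n) * (c *\<^sub>R f (Suc n) (d + c * t))) (at t)"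
    unfolding o_def by (rule has_vector_derivative_mult_right)
  then show "((\<lambda>t. of_real (c^n) * f n (d + c * t)) has_vector_derivative of_real (c^Suc n) * f (Suc n) (d + c * t)) (at t)"
    by (simp add: scaleR_conv_of_real mult_ac)
qed

text \<open>The Leibniz formula for the derivatives of a product.\<close>

definition jprod :: "(nat \<Rightarrow> real \<Rightarrow> complex) \<Rightarrow> (nat \<Rightarrow> real \<Rightarrow> complex) \<Rightarrow> nat \<Rightarrow> real \<Rightarrow> complex" where
  "jprod f g n t = (\<Sum>k\<le>n. of_nat (n choose k) * (f k t * g (n - k) t))"

lemma jprod_0: "jprod f g 0 t = f 0 t * g 0 t" by (simp add: jprod_def)

lemma jprod_zero: "(\<And>k. k \<le> n \<Longrightarrow> f k t = 0 \<or> g (n - k) t = 0) \<Longrightarrow> jprod f g n t = 0"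
  unfolding jprod_def by (intro sum.neutral) auto

lemma jet_jprod:
  assumes f: "jet f" and g: "jet g" shows "jet (jprod f g)"
  unfolding jet_def
proof (intro allI)
  fix n t
  have "((\<lambda>t. \<Sum>k\<le>n. of_nat (n choose k) * (f k t * g (n - k) t)) has_vector_derivative
     (\<Sum>k\<le>n. of_nat (n choose k) * (f k t * g (Suc (n - k)) t + f (Suc k) t * g (n - k) t))) (at t)"
    by (intro has_vector_derivative_sum has_vector_derivative_mult_right has_vector_derivative_mult jetD f g)
  moreover have "(\<Sum>k\<le>n. of_nat (n choose k) * (f k t * g (Suc (n - k)) t + f (Suc k) t * g (n - k) t)) = jprod f g (Suc n) t"
  proof -
    let ?a = "\<lambda>k. f k t * g (Suc n - k) t"
    have "jprod f g (Suc n) t = ?a 0 + (\<Sum>k\<le>n. of_nat (Suc n choose Suc k) * ?a (Suc k))"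
      unfolding jprod_def by (subst sum.atMost_Suc_shift) simp
    also have "(\<Sum>k\<le>n. of_nat (Suc n choose Suc k) * ?a (Suc k))
        = (\<Sum>k\<le>n. of_nat (n choose k) * ?a (Suc k)) + (\<Sum>k\<le>n. of_nat (n choose Suc k) * ?a (Suc k))"
      by (simp add: sum.distrib[symmetric] algebra_simps)
    finally have 1: "jprod f g (Suc n) t = ?a 0 +
      ((\<Sum>k\<le>n. of_nat (n choose k) * ?a (Suc k)) + (\<Sum>k\<le>n. of_nat (n choose Suc k) * ?a (Suc k)))" .
    have "?a 0 + (\<Sum>k\<le>n. of_nat (n choose Suc k) * ?a (Suc k)) = (\<Sum>k\<le>Suc n. of_nat (n choose k) * ?a k)"
      by (subst sum.atMost_Suc_shift) simp
    also have "(\<Sum>k\<le>Suc n. of_nat (n choose k) * ?a k) = (\<Sum>k\<le>n. of_nat (n choose k) * ?a k)" by simp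
    finally have 2: "?a 0 + (\<Sum>k\<le>n. of_nat (n choose Suc k) * ?a (Suc k)) = (\<Sum>k\<le>n. of_nat (n choose k) * ?a k)" .
    have "jprod f g (Suc n) t = (\<Sum>k\<le>n. of_nat (n choose k) * ?a k) + (\<Sum>k\<le>n. of_nat (n choose k) * ?a (Suc k))"
      unfolding 1 2[symmetric] by (simp only: add_ac)
    also have "(\<Sum>k\<le>n. of_nat (n choose k) * ?a k) = (\<Sum>k\<le>n. of_nat (n choose k) * (f k t * g (Suc (n - k)) t))"
      by (intro sum.cong) (auto simp: Suc_diff_le)
    finally show ?thesis by (simp add: sum.distrib[symmetric] distrib_left)
  qed
  ultimately show "(jprod f g n has_vector_derivative jprod f g (Suc n) t) (at t)"
    unfolding jprod_def[abs_def] by simp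
qed

text \<open>The n-th derivative of exp(-1/x) for x > 0 is P(1/x) exp(-1/x) with P =
  \<open>flat_poly n\<close>. One more derivative brings out the factor 1/x^2, which is X^2 in the
  variable X = 1/x, and changes P to P - P'.\<close>

primrec flat_poly :: "nat \<Rightarrow> real poly" where
  "flat_poly 0 = 1"
| "flat_poly (Suc n) = [:0, 0, 1:] * (flat_poly n - pderiv (flat_poly n))"

definition flat :: "nat \<Rightarrow> real \<Rightarrow> real" where
  "flat n x = (if 0 < x then poly (flat_poly n) (1 / x) * exp (- (1 / x)) else 0)"

lemma poly_div_exp_tendsto_0: "((\<lambda>x::real. poly p x / exp x) \<longlongrightarrow> 0) at_top"
proof -
  have "((\<lambda>x::real. \<Sum>i\<le>degree p. coeff p i * (x ^ i / exp x)) \<longlongrightarrow> (\<Sum>i\<le>degree p. coeff p i * 0)) at_top"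
    by (intro tendsto_sum tendsto_mult tendsto_const tendsto_power_div_exp_0)
  then show ?thesis by (simp add: poly_altdef sum_divide_distrib)
qed

lemma flat_DERIV: "DERIV (flat n) x :> flat (Suc n) x"
proof -
  consider "0 < x" | "x < 0" | "x = 0" by linarith
  then show ?thesis
  proof cases
    case 1
    have "DERIV (\<lambda>x. poly (flat_poly n) (1 / x) * exp (- (1 / x))) x :> flat (Suc n) x"
      using 1 by (auto intro!: derivative_eq_intros simp: flat_def power2_eq_square field_simps)
    then show ?thesis
    proof (rule has_field_derivative_transform_within_open[where S="{0<..}"])
      show "poly (flat_poly n) (1 / y) * exp (- (1 / y)) = flat n y" if "y \<in> {0<..}" for y using that by (simp add: flat_def)
    qed (use 1 in auto)
  next
    case 2
    have "DERIV (\<lambda>x::real. 0::real) x :> flat (Suc n) x" using 2 by (simp add: flat_def)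
    then show ?thesis
    proof (rule has_field_derivative_transform_within_open[where S="{..<0}"])
      show "0 = flat n y" if "y \<in> {..<0}" for y using that by (simp add: flat_def)
    qed (use 2 in auto)
  next
    case 3
    \<comment> \<open>In the variable 1/y the difference quotient at 0 from the right is a
      polynomial divided by exp.\<close>
    have r: "((\<lambda>y. flat n y / y) \<longlongrightarrow> 0) (at_right 0)"
    proof -
      have "((\<lambda>y::real. poly ([:0, 1:] * flat_poly n) (inverse y) / exp (inverse y)) \<longlongrightarrow> 0) (at_right 0)"
        by (rule filterlim_compose[OF poly_div_exp_tendsto_0 filterlim_inverse_at_top_right])
      then show ?thesis
        by (rule Lim_transform_eventually)
           (auto simp: flat_def exp_minus field_simps intro!: eventually_at_right_less eventually_mono[OF eventually_at_right_less])
    qed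
    have l: "((\<lambda>y. flat n y / y) \<longlongrightarrow> 0) (at_left 0)"
      by (rule Lim_transform_eventually[OF tendsto_const])
         (auto simp: flat_def eventually_at_left_field intro!: exI[of _ "-1"])
    have "((\<lambda>y. flat n y / y) \<longlongrightarrow> 0) (at 0)"
      using r l by (simp add: filterlim_at_split)
    then show ?thesis using 3 by (simp add: flat_def has_field_derivative_iff)
  qed
qed

lemma jet_flat: "jet (\<lambda>n t. of_real (flat n t))"
  unfolding jet_def using flat_DERIV
  by (auto simp: has_real_derivative_iff_has_vector_derivative intro!: has_vector_derivative_of_real)

text \<open>All derivatives of exp(-1/t) exp(-1/(1-t)), a bump living on (0, 1); the signs come from
  the reflection t -> 1 - t in the second factor.\<close>

definition hump :: "nat \<Rightarrow> real \<Rightarrow> complex" where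
  "hump = jprod (\<lambda>n t. of_real (flat n t)) (\<lambda>n t. of_real ((-1)^n) * of_real (flat n (1 + (-1) * t)))"

lemma jet_hump: "jet hump"
  unfolding hump_def by (intro jet_jprod jet_flat jet_affine)

lemma hump_outside: "t \<le> 0 \<or> 1 \<le> t \<Longrightarrow> hump n t = 0"
  unfolding hump_def by (intro jprod_zero) (auto simp: flat_def)

lemma hump_0: "hump 0 t = of_real (flat 0 t * flat 0 (1 - t))"
  by (simp add: hump_def jprod_0)

text \<open>An antiderivative F of the bump is a smooth step, constant on either side of [0, 1].
  With I the height of the step, (F(t + 3) - F(t - 2)) / I rises on [-3, -2] and falls on [2, 3].
  The plateau extends to 2 so that a difference of dilates keeps a positive distance from
  [-T, T].\<close>

lemma cutoff_exists:
  "\<exists>g. jet g \<and> (\<forall>n t. 3 \<le> \<bar>t\<bar> \<longrightarrow> g n t = 0) \<and> (\<forall>t. \<bar>t\<bar> \<le> 2 \<longrightarrow> g 0 t = 1)"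
proof -
  let ?h = "\<lambda>t. flat 0 t * flat 0 (1 - t)"
  have "continuous_on UNIV (flat 0)"
    using flat_DERIV by (intro continuous_at_imp_continuous_on ballI) (blast intro: DERIV_isCont)
  then have "continuous_on UNIV ?h" by (auto intro!: continuous_intros continuous_on_compose2[of UNIV "flat 0"])
  then have "isCont ?h t" for t by (simp add: continuous_on_eq_continuous_at)
  then obtain F where "\<forall>t::real. (F has_vector_derivative ?h t) (at t)"
    using einterval_antiderivative[of "-\<infinity>" "\<infinity>" ?h] by auto
  then have F: "DERIV F t :> ?h t" for t by (simp add: has_real_derivative_iff_has_vector_derivative)
  have h_out: "?h t = 0" if "t \<le> 0 \<or> 1 \<le> t" for t using that by (auto simp: flat_def)
  have left: "F t = F 0" if "t \<le> 0" for t
  proof -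
    have "\<exists>c. \<forall>t\<in>{..0}. F t = c"
    proof (rule has_field_derivative_zero_constant)
      fix x :: real assume "x \<in> {..0}"
      then have "x \<le> 0 \<or> 1 \<le> x" by auto
      from F[of x, unfolded h_out[OF this]] show "(F has_field_derivative 0) (at x within {..0})"
        by (rule has_field_derivative_at_within)
    qed auto
    then show ?thesis using that by auto
  qed
  have right: "F t = F 1" if "1 \<le> t" for t
  proof -
    have "\<exists>c. \<forall>t\<in>{1..}. F t = c"
    proof (rule has_field_derivative_zero_constant)
      fix x :: real assume "x \<in> {1..}"
      then have "x \<le> 0 \<or> 1 \<le> x" by auto
      from F[of x, unfolded h_out[OF this]] show "(F has_field_derivative 0) (at x within {1..})"
        by (rule has_field_derivative_at_within)
    qed auto
    then show ?thesis using that by auto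
  qed
  have "F 0 < F 1"
  proof -
    obtain z where "0 < z" "z < 1" "F 1 - F 0 = (1 - 0) * ?h z"
      using MVT2[of 0 1 F ?h] F by auto
    moreover have "0 < ?h z" using \<open>0 < z\<close> \<open>z < 1\<close> by (simp add: flat_def)
    ultimately show ?thesis by simp
  qed
  define I where "I = F 1 - F 0"
  have I: "0 < I" using \<open>F 0 < F 1\<close> by (simp add: I_def)
  \<comment> \<open>The step is put in front of the family of the bump, which shifts the index of
    differentiation by one.\<close>
  define H where "H n t = (case n of 0 \<Rightarrow> of_real (F t) | Suc m \<Rightarrow> hump m t)" for n t
  have jH: "jet H" unfolding jet_def
  proof (intro allI)
    fix n t
    show "(H n has_vector_derivative H (Suc n) t) (at t)"
    proof (cases n)
      case 0
      have "((\<lambda>t. of_real (F t)) has_vector_derivative of_real (?h t)) (at t)"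
        using F by (intro has_vector_derivative_of_real) (simp add: has_real_derivative_iff_has_vector_derivative)
      then show ?thesis using 0 by (simp add: H_def[abs_def] hump_0)
    qed (use jetD[OF jet_hump] in \<open>simp add: H_def[abs_def]\<close>)
  qed
  define g where "g n t = of_real (1 / I) * (of_real (1^n) * H n (3 + 1 * t) - of_real (1^n) * H n (-2 + 1 * t))" for n t
  have "jet g" unfolding g_def[abs_def] by (intro jet_cmult jet_diff jet_affine jH)
  moreover have "g n t = 0" if "3 \<le> \<bar>t\<bar>" for n t
  proof -
    consider "t \<le> -3" | "3 \<le> t" using \<open>3 \<le> \<bar>t\<bar>\<close> by linarith
    then show ?thesis
    proof cases
      case 1 then show ?thesis
        using left[of "3 + t"] left[of "t - 2"] hump_outside[of "3 + t"] hump_outside[of "t - 2"]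
        by (cases n) (auto simp: g_def H_def)
    next
      case 2 then show ?thesis
        using right[of "3 + t"] right[of "t - 2"] hump_outside[of "3 + t"] hump_outside[of "t - 2"]
        by (cases n) (auto simp: g_def H_def)
    qed
  qed
  moreover have "g 0 t = 1" if "\<bar>t\<bar> \<le> 2" for t
  proof -
    have "F (3 + t) = F 1" "F (t - 2) = F 0" using that by (auto intro: left right)
    then have "g 0 t = of_real (1 / I * (F 1 - F 0))" by (simp add: g_def H_def)
    then show ?thesis using I by (simp add: I_def)
  qed
  ultimately show ?thesis by blast
qed

definition cutoff :: "nat \<Rightarrow> real \<Rightarrow> complex" where
  "cutoff = (SOME g. jet g \<and> (\<forall>n t. 3 \<le> \<bar>t\<bar> \<longrightarrow> g n t = 0) \<and> (\<forall>t. \<bar>t\<bar> \<le> 2 \<longrightarrow> g 0 t = 1))"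

lemma jet_cutoff: "jet cutoff"
  and cutoff_outside: "3 \<le> \<bar>t\<bar> \<Longrightarrow> cutoff n t = 0"
  and cutoff_inside: "\<bar>t\<bar> \<le> 2 \<Longrightarrow> cutoff 0 t = 1"
  using someI_ex[OF cutoff_exists] unfolding cutoff_def by blast+

section \<open>Fourier transform of the cutoff\<close>

definition ft :: "(real \<Rightarrow> complex) \<Rightarrow> real \<Rightarrow> complex" where
  "ft f u = (LINT t|lborel. f t * cis (t * u))"

lemma integrable_compact_support:
  fixes f :: "real \<Rightarrow> complex"
  assumes "continuous_on UNIV f" "\<And>t. a \<le> \<bar>t\<bar> \<Longrightarrow> f t = 0"
  shows "integrable lborel f"
proof -
  have "integrable lborel (\<lambda>t. indicator {-a..a} t *\<^sub>R f t)"
    using assms(1) by (intro borel_integrable_compact) (auto intro: continuous_on_subset)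
  also have "(\<lambda>t. indicator {-a..a} t *\<^sub>R f t) = f"
    using assms(2) by (auto simp: indicator_def fun_eq_iff)
  finally show ?thesis .
qed

lemma continuous_cis_mult: "continuous_on A (\<lambda>t. cis (t * u))"
  using jet_continuous[OF jet_cis[of u], where A=A and n=0] by simp

lemma ft_deriv:
  assumes g: "jet g" and s: "\<And>n t. a \<le> \<bar>t\<bar> \<Longrightarrow> g n t = 0" and a: "0 < a"
  shows "ft (g (Suc n)) u = - (\<i> * of_real u) * ft (g n) u"
proof -
  let ?F = "\<lambda>t. g n t * cis (t * u)"
  let ?f = "\<lambda>t. g (Suc n) t * cis (t * u) + g n t * ((\<i> * of_real u) * cis (t * u))"
  have int: "integrable lborel (\<lambda>t. g m t * cis (t * u))" for m
    by (intro integrable_compact_support[of _ a] continuous_intros jet_continuous g continuous_cis_mult) (simp add: s)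
  have "(LINT t|lborel. indicator {-a..a} t *\<^sub>R ?f t) = ?F a - ?F (-a)"
  proof (rule integral_FTC_Icc)
    show "(?F has_vector_derivative ?f t) (at t within {-a..a})" for t
      using jetD[OF g, of n t] jetD[OF jet_cis[of u], of 0 t]
      by (intro has_vector_derivative_at_within[OF has_vector_derivative_mult, THEN has_vector_derivative_eq_rhs]) auto
    show "continuous_on {-a..a} ?f"
      by (intro continuous_intros jet_continuous g continuous_cis_mult)
  qed (use a in auto)
  moreover have "(\<lambda>t. indicator {-a..a} t *\<^sub>R ?f t) = ?f"
    by (auto simp: indicator_def fun_eq_iff s)
  ultimately have "(LINT t|lborel. ?f t) = 0" using a by (simp add: s)
  moreover have "(LINT t|lborel. ?f t) = ft (g (Suc n)) u + (LINT t|lborel. (\<i> * of_real u) * (g n t * cis (t * u)))"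
  proof -
    have "?f = (\<lambda>t. g (Suc n) t * cis (t * u) + (\<i> * of_real u) * (g n t * cis (t * u)))"
      by (simp add: fun_eq_iff mult_ac)
    then show ?thesis unfolding ft_def by (simp only:) (intro Bochner_Integration.integral_add integrable_mult_right int)
  qed
  ultimately have "ft (g (Suc n)) u + (\<i> * of_real u) * ft (g n) u = 0" unfolding ft_def by simp
  then show ?thesis by (simp add: eq_neg_iff_add_eq_0)
qed

lemma norm_ft_le: "norm (ft f u) \<le> (LINT t|lborel. norm (f t))"
  unfolding ft_def by (rule order_trans[OF integral_norm_bound]) (simp add: norm_mult)

text \<open>Two integrations by parts bound u^2 times the transform by the L^1 norm of the second
  derivative; quadratic decay makes the transform integrable.\<close>

lemma ft_decay:
  assumes g: "jet g" and s: "\<And>n t. a \<le> \<bar>t\<bar> \<Longrightarrow> g n t = 0" and a: "0 < a"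
  shows "\<exists>C\<ge>0. \<forall>u. norm (ft (g 0) u) \<le> C / (1 + u\<^sup>2)"
proof (intro exI conjI allI)
  let ?C = "(LINT t|lborel. norm (g 0 t)) + (LINT t|lborel. norm (g 2 t))"
  show "0 \<le> ?C" by simp
  fix u
  have "ft (g 2) u = - of_real (u\<^sup>2) * ft (g 0) u"
    using ft_deriv[OF g s a, of 1 u] ft_deriv[OF g s a, of 0 u] by (simp add: numeral_2_eq_2 power2_eq_square mult_ac)
  then have "u\<^sup>2 * norm (ft (g 0) u) = norm (ft (g 2) u)" by (simp add: norm_mult norm_power)
  then have "(1 + u\<^sup>2) * norm (ft (g 0) u) \<le> ?C"
    using norm_ft_le[of "g 0" u] norm_ft_le[of "g 2" u] by (simp add: distrib_right)
  then show "norm (ft (g 0) u) \<le> ?C / (1 + u\<^sup>2)"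
    by (simp add: field_simps add_pos_nonneg)
qed

lemma integrable_inverse_1_plus_sq: "integrable lborel (\<lambda>u::real. 1 / (1 + u\<^sup>2))"
proof (rule integrableI_bounded)
  have "(\<integral>\<^sup>+u. ennreal (norm (1 / (1 + u\<^sup>2 :: real))) \<partial>lborel) \<le> (\<integral>\<^sup>+u. 2 * brk 2 u \<partial>lborel)"
  proof (intro nn_integral_mono)
    fix u :: real
    have "0 \<le> (1 - \<bar>u\<bar>)\<^sup>2" by simp
    then have "(1 + \<bar>u\<bar>)\<^sup>2 \<le> 2 * (1 + u\<^sup>2)" by (simp add: power2_eq_square algebra_simps)
    then have "1 / (1 + u\<^sup>2) \<le> 2 / (1 + \<bar>u\<bar>)\<^sup>2"
      by (simp add: field_simps add_pos_nonneg)
    also have "\<dots> = 2 * (1 + \<bar>u\<bar>) powr (-2)" by (simp add: powr_minus powr_numeral divide_inverse)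
    finally have "ennreal (1 / (1 + u\<^sup>2)) \<le> ennreal (2 * (1 + \<bar>u\<bar>) powr (-2))" by (rule ennreal_leI)
    then show "ennreal (norm (1 / (1 + u\<^sup>2))) \<le> 2 * brk 2 u"
      by (simp add: ennreal_mult')
  qed
  also have "\<dots> = 2 * (\<integral>\<^sup>+u. brk 2 u \<partial>lborel)" by (rule nn_integral_cmult) simp
  also have "\<dots> \<le> 2 * ennreal (2 / (2 - 1))" by (intro mult_left_mono nn_integral_brk) auto
  also have "\<dots> < \<infinity>" by (simp add: ennreal_mult_less_top)
  finally show "(\<integral>\<^sup>+u. ennreal (norm (1 / (1 + u\<^sup>2 :: real))) \<partial>lborel) < \<infinity>" .
qed simp

definition cutoff_hat :: "real \<Rightarrow> complex" where "cutoff_hat = ft (cutoff 0)"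

lemma cutoff_measurable [measurable]: "cutoff n \<in> borel_measurable borel"
  by (intro borel_measurable_continuous_onI jet_continuous jet_cutoff)

lemma cutoff_integrable: "integrable lborel (cutoff n)"
  by (rule integrable_compact_support[of _ 3]) (auto intro: jet_continuous jet_cutoff cutoff_outside)

lemma cis_measurable [measurable]: "cis \<in> borel_measurable borel"
  by (intro borel_measurable_continuous_onI) (use continuous_cis_mult[of UNIV 1] in simp)

lemma cutoff_hat_measurable [measurable]: "cutoff_hat \<in> borel_measurable borel"
  unfolding cutoff_hat_def ft_def[abs_def] by measurable

lemma cutoff_hat_decay: "\<exists>C\<ge>0. \<forall>u. norm (cutoff_hat u) \<le> C / (1 + u\<^sup>2)"
  unfolding cutoff_hat_def by (rule ft_decay[of _ 3]) (auto intro: jet_cutoff cutoff_outside)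

lemma cutoff_hat_integrable: "integrable lborel cutoff_hat"
proof -
  obtain C where "0 \<le> C" "\<And>u. norm (cutoff_hat u) \<le> C / (1 + u\<^sup>2)" using cutoff_hat_decay by blast
  then show ?thesis
    by (intro Bochner_Integration.integrable_bound[OF integrable_mult_right[OF integrable_inverse_1_plus_sq, of C]])
       (auto simp: add_nonneg_nonneg)
qed

lemma cutoff_bounded: "\<exists>B. \<forall>t. norm (cutoff n t) \<le> B"
proof -
  have "bounded (cutoff n ` {-3..3})"
    by (intro compact_imp_bounded compact_continuous_image jet_continuous jet_cutoff) simp
  then obtain B where B: "\<And>t. t \<in> {-3..3} \<Longrightarrow> norm (cutoff n t) \<le> B" unfolding bounded_iff by blast
  have "0 \<le> B" using order_trans[OF norm_ge_zero B[of 0]] by simp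
  then have "norm (cutoff n t) \<le> B" for t
    using B[of t] cutoff_outside[of t n] by (cases "3 \<le> \<bar>t\<bar>") (auto simp: abs_le_iff not_le abs_less_iff)
  then show ?thesis by blast
qed

lemma integrable_pair_bound:
  fixes f :: "'a::euclidean_space \<Rightarrow> 'b::euclidean_space \<Rightarrow> complex"
  assumes m: "case_prod f \<in> borel_measurable (lborel \<Otimes>\<^sub>M lborel)"
    and g: "integrable lborel g" and h: "integrable lborel h" and b: "\<And>x y. norm (f x y) \<le> g x * (h y :: real)"
  shows "integrable (lborel \<Otimes>\<^sub>M lborel) (case_prod f)"
proof -
  have [measurable]: "g \<in> borel_measurable lborel" "h \<in> borel_measurable lborel" using g h by auto
  have "integrable (lborel \<Otimes>\<^sub>M lborel) (\<lambda>z. g (fst z) * h (snd z))"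
  proof (rule lborel_pair.Fubini_integrable)
    show "integrable lborel (\<lambda>x. LINT y|lborel. norm (g (fst (x, y)) * h (snd (x, y))))"
      using g h by (simp add: abs_mult)
  qed (use h in auto)
  then show ?thesis
    by (rule Bochner_Integration.integrable_bound) (use m b in \<open>auto intro!: AE_I2 order_trans[OF b abs_ge_self]\<close>)
qed

text \<open>Fourier inversion at the origin, by Gaussian regularisation.\<close>
lemma integral_cutoff_hat_nonzero: "(LINT u|lborel. cutoff_hat u) \<noteq> 0"
proof -
  \<comment> \<open>These Gaussian averages have two limits. Taken directly, the Gaussian flattens
    to its value at 0. After Fubini and the self-duality of the Gaussian, the cutoff is evaluated
    ever closer to 0.\<close>
  let ?A = "\<lambda>n::nat. LINT u|lborel. of_real (std_normal_density (u / real (Suc n))) * cutoff_hat u"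
  have N_le: "std_normal_density x \<le> 1" for x
  proof -
    have "1 \<le> sqrt (2 * pi)" using pi_gt3 by simp
    moreover have "exp (- x\<^sup>2 / 2) \<le> 1" by simp
    ultimately have "1 / sqrt (2 * pi) * exp (- x\<^sup>2 / 2) \<le> 1 * 1" by (intro mult_mono) auto
    then show ?thesis by (simp add: std_normal_density_def)
  qed
  have int_N0: "integrable lborel std_normal_density" and int_N1: "(LINT x|lborel. std_normal_density x) = 1" by simp_all
  have exp_N: "exp (- x\<^sup>2 / 2) = sqrt (2 * pi) * std_normal_density x" for x by (simp add: std_normal_density_def)
  have lim1: "?A \<longlonglongrightarrow> (LINT u|lborel. of_real (std_normal_density 0) * cutoff_hat u)"
  proof (rule integral_dominated_convergence[where w="\<lambda>u. norm (cutoff_hat u)"])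
    show "AE u in lborel. (\<lambda>n. of_real (std_normal_density (u / real (Suc n))) * cutoff_hat u) \<longlonglongrightarrow> of_real (std_normal_density 0) * cutoff_hat u"
    proof (intro AE_I2 tendsto_intros)
      fix u :: real
      have "(\<lambda>n. u / real (Suc n)) \<longlonglongrightarrow> 0" by (rule lim_const_over_n[THEN LIMSEQ_Suc])
      moreover have "isCont std_normal_density 0" unfolding std_normal_density_def by (intro continuous_intros) auto
      ultimately show "(\<lambda>n. std_normal_density (u / real (Suc n))) \<longlonglongrightarrow> std_normal_density 0" by (rule isCont_tendsto_compose[rotated])
    qed
    show "AE u in lborel. norm (of_real (std_normal_density (u / real (Suc n))) * cutoff_hat u) \<le> norm (cutoff_hat u)" for n
      using N_le by (auto simp: norm_mult intro!: mult_left_le_one_le)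
  qed (auto intro: cutoff_hat_integrable)
  have A: "?A n = (LINT s|lborel. of_real (sqrt (2 * pi) * std_normal_density s) * cutoff 0 (s / real (Suc n)))" for n
  proof -
    define m where "m = real (Suc n)"
    have m: "0 < m" by (simp add: m_def)
    have ch: "(LINT u|lborel. of_real (std_normal_density (u / m)) * cis (t * u)) = of_real (m * (sqrt (2 * pi) * std_normal_density (t * m)))" for t
    proof -
      have "(LINT u|lborel. of_real (std_normal_density (u / m)) * cis (t * u)) = m *\<^sub>R (LINT x|lborel. of_real (std_normal_density x) * cis (t * (m * x)))"
        using m by (subst lborel_integral_real_affine[where c=m and t=0]) auto
      also have "(LINT x|lborel. of_real (std_normal_density x) * cis (t * (m * x))) = char std_normal_distribution (t * m)"
        unfolding char_def by (subst integral_density) (auto simp: scaleR_conv_of_real mult_ac cis_conv_exp)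
      finally show ?thesis unfolding exp_N[symmetric] by (simp add: char_std_normal_distribution scaleR_conv_of_real)
    qed
    have int_N: "integrable lborel (\<lambda>u. std_normal_density (u / m))"
      using lborel_integrable_real_affine[OF int_N0, of "1 / m" 0] m by simp
    have "?A n = (LINT u|lborel. (LINT t|lborel. of_real (std_normal_density (u / m)) * (cutoff 0 t * cis (t * u))))"
      unfolding cutoff_hat_def ft_def m_def by simp
    also have "\<dots> = (LINT t|lborel. (LINT u|lborel. of_real (std_normal_density (u / m)) * (cutoff 0 t * cis (t * u))))"
    proof (rule lborel_pair.Fubini_integral)
      show "integrable (lborel \<Otimes>\<^sub>M lborel) (\<lambda>(t, u). of_real (std_normal_density (u / m)) * (cutoff 0 t * cis (t * u)))"
        by (rule integrable_pair_bound[OF _ integrable_norm[OF cutoff_integrable[of 0]] int_N])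
           (auto simp: norm_mult)
    qed
    also have "\<dots> = (LINT t|lborel. cutoff 0 t * of_real (m * (sqrt (2 * pi) * std_normal_density (t * m))))"
    proof (rule Bochner_Integration.integral_cong[OF refl])
      fix t
      have "(LINT u|lborel. of_real (std_normal_density (u / m)) * (cutoff 0 t * cis (t * u)))
          = (LINT u|lborel. cutoff 0 t * (of_real (std_normal_density (u / m)) * cis (t * u)))"
        by (simp only: mult.left_commute)
      also have "\<dots> = cutoff 0 t * of_real (m * (sqrt (2 * pi) * std_normal_density (t * m)))"
        unfolding integral_mult_right_zero ch ..
      finally show "(LINT u|lborel. of_real (std_normal_density (u / m)) * (cutoff 0 t * cis (t * u)))
          = cutoff 0 t * of_real (m * (sqrt (2 * pi) * std_normal_density (t * m)))" .
    qed
    also have "\<dots> = (LINT s|lborel. of_real (sqrt (2 * pi) * std_normal_density s) * cutoff 0 (s / m))"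
      using m by (subst lborel_integral_real_affine[where c="1 / m" and t=0]) (auto simp: mult_ac scaleR_conv_of_real)
    finally show ?thesis by (simp add: m_def)
  qed
  obtain B where B: "\<And>t. norm (cutoff 0 t) \<le> B" using cutoff_bounded by blast
  have "(\<lambda>n. LINT s|lborel. of_real (sqrt (2 * pi) * std_normal_density s) * cutoff 0 (s / real (Suc n))) \<longlonglongrightarrow> (LINT s|lborel. of_real (sqrt (2 * pi) * std_normal_density s) * 1)"
  proof (rule integral_dominated_convergence[where w="\<lambda>s. B * (sqrt (2 * pi) * std_normal_density s)"])
    show "AE s in lborel. (\<lambda>n. of_real (sqrt (2 * pi) * std_normal_density s) * cutoff 0 (s / real (Suc n))) \<longlonglongrightarrow> of_real (sqrt (2 * pi) * std_normal_density s) * 1"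
    proof (intro AE_I2 tendsto_intros)
      fix s :: real
      have "(\<lambda>n. s / real (Suc n)) \<longlonglongrightarrow> 0" by (rule lim_const_over_n[THEN LIMSEQ_Suc])
      moreover have "isCont (cutoff 0) 0"
        using jet_continuous[OF jet_cutoff, of UNIV 0] by (simp add: continuous_on_eq_continuous_at)
      ultimately have "(\<lambda>n. cutoff 0 (s / real (Suc n))) \<longlonglongrightarrow> cutoff 0 0" by (rule isCont_tendsto_compose[rotated])
      then show "(\<lambda>n. cutoff 0 (s / real (Suc n))) \<longlonglongrightarrow> 1" by (simp add: cutoff_inside)
    qed
    show "integrable lborel (\<lambda>s. B * (sqrt (2 * pi) * std_normal_density s))"
      using int_N0 by simp
    show "AE s in lborel. norm (of_real (sqrt (2 * pi) * std_normal_density s) * cutoff 0 (s / real (Suc n))) \<le> B * (sqrt (2 * pi) * std_normal_density s)" for n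
      using B by (auto simp: norm_mult mult.commute intro!: mult_right_mono)
  qed auto
  then have "?A \<longlonglongrightarrow> (LINT s|lborel. of_real (sqrt (2 * pi) * std_normal_density s) * 1)" by (simp only: A)
  \<comment> \<open>Since the density at 0 is 1 / sqrt (2 pi), the integral equals 2 pi, as
    inversion predicts for a cutoff with value 1 at 0; only its being nonzero is kept.\<close>
  from LIMSEQ_unique[OF this lim1]
  have "(LINT s|lborel. of_real (sqrt (2 * pi) * std_normal_density s) :: complex) = of_real (std_normal_density 0) * (LINT u|lborel. cutoff_hat u)" by simp
  moreover have "(LINT s|lborel. of_real (sqrt (2 * pi) * std_normal_density s) :: complex) = of_real (sqrt (2 * pi))"
    using int_N1 by (subst integral_complex_of_real) simp
  ultimately show ?thesis by auto
qed

section \<open>Compact time support\<close>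

lemma smooth2_tensor:
  assumes "jet A" "jet B" shows "smooth2 (\<lambda>p. A 0 (fst p) * B 0 (snd p))"
  unfolding smooth2_def
proof (intro exI[of _ "\<lambda>j k p. A j (fst p) * B k (snd p)"] conjI allI)
  fix j k :: nat and p :: "real \<times> real"
  show "continuous_on UNIV (\<lambda>p. A j (fst p) * B k (snd p))"
    by (intro continuous_intros continuous_on_compose2[OF jet_continuous[OF assms(1)]]
        continuous_on_compose2[OF jet_continuous[OF assms(2)]]) auto
  show "((\<lambda>t. A j (fst (t, snd p)) * B k (snd (t, snd p))) has_vector_derivative A (Suc j) (fst p) * B k (snd p)) (at (fst p))"
    using has_vector_derivative_mult_left[OF jetD[OF assms(1)]] by simp
  show "((\<lambda>x. A j (fst (fst p, x)) * B k (snd (fst p, x))) has_vector_derivative A j (fst p) * B (Suc k) (snd p)) (at (snd p))"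
    using has_vector_derivative_mult_right[OF jetD[OF assms(2)]] by simp
qed simp

lemma integral_tensor:
  fixes a b :: "real \<Rightarrow> complex"
  assumes a: "integrable lborel a" and b: "integrable lborel b"
  shows "(LINT p|lborel. a (fst p) * b (snd p)) = (LINT t|lborel. a t) * (LINT x|lborel. b x)"
proof -
  have [measurable]: "a \<in> borel_measurable borel" "b \<in> borel_measurable borel" using a b by auto
  have "integrable (lborel \<Otimes>\<^sub>M lborel) (case_prod (\<lambda>t x. a t * b x))"
    by (rule integrable_pair_bound[OF _ integrable_norm[OF a] integrable_norm[OF b]]) (auto simp: norm_mult)
  from lborel_pair.integral_fst'[OF this] show ?thesis
    by (simp add: lborel_prod case_prod_beta')
qed

text \<open>The transform of the dilated cutoff t -> \<open>cutoff 0 (t / c)\<close>. The sign in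
  the exponential is positive because the support condition evaluates the transform of a test
  function at the reflected point.\<close>

definition kern :: "real \<Rightarrow> real \<Rightarrow> complex" where "kern c u = of_real c * cutoff_hat (c * u)"

lemma kern_measurable [measurable]: "kern c \<in> borel_measurable borel"
  unfolding kern_def[abs_def] by measurable

lemma ft_dilated_cutoff:
  assumes c: "0 < c"
  shows "integrable lborel (\<lambda>t. cutoff 0 (t / c) * cis (t * u))"
    and "(LINT t|lborel. cutoff 0 (t / c) * cis (t * u)) = kern c u"
proof -
  have i: "integrable lborel (\<lambda>t. cutoff 0 (t / c))"
    using lborel_integrable_real_affine[OF cutoff_integrable, of "1 / c" 0 0] c by simp
  show "integrable lborel (\<lambda>t. cutoff 0 (t / c) * cis (t * u))"
    by (rule Bochner_Integration.integrable_bound[OF i]) (auto simp: norm_mult)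
  show "(LINT t|lborel. cutoff 0 (t / c) * cis (t * u)) = kern c u"
    using c by (subst lborel_integral_real_affine[where c=c and t=0])
      (auto simp: kern_def cutoff_hat_def ft_def scaleR_conv_of_real mult_ac)
qed

text \<open>The test function is (cutoff(t/n) - cutoff(t/T)) cutoff(x/n), multiplied by characters
  that translate its transform to the centre (t0, x0). As T \<le> n, both dilates in time equal 1
  for |t| \<le> 2T, so the support avoids the strip |t| \<le> T. The cutoffs of scale
  \<open>n\<close> provide compact support and are removed by letting \<open>n\<close> grow.\<close>

lemma time_supp_kernel:
  assumes supp: "time_supp_in T F" and T: "0 < T" "T \<le> n"
  shows "(LINT \<zeta>|lborel. F \<zeta> * ((kern n (fst \<zeta> - t0) - kern T (fst \<zeta> - t0)) * kern n (snd \<zeta> - x0))) = 0"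
proof -
  have n: "0 < n" using T by simp
  define A where "A = jprod (\<lambda>k t. of_real ((1/n)^k) * cutoff k (0 + 1/n * t) - of_real ((1/T)^k) * cutoff k (0 + 1/T * t))
     (\<lambda>k t. (\<i> * of_real (-t0))^k * cis (t * (-t0)))"
  define B where "B = jprod (\<lambda>k t. of_real ((1/n)^k) * cutoff k (0 + 1/n * t)) (\<lambda>k t. (\<i> * of_real (-x0))^k * cis (t * (-x0)))"
  have jA: "jet A" unfolding A_def by (intro jet_jprod jet_diff jet_affine jet_cutoff jet_cis)
  have jB: "jet B" unfolding B_def by (intro jet_jprod jet_affine jet_cutoff jet_cis)
  have A0: "A 0 t = (cutoff 0 (t / n) - cutoff 0 (t / T)) * cis (t * (-t0))" for t by (simp add: A_def jprod_0)
  have B0: "B 0 x = cutoff 0 (x / n) * cis (x * (-x0))" for x by (simp add: B_def jprod_0)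
  define \<phi> where "\<phi> = (\<lambda>p. A 0 (fst p) * B 0 (snd p))"
  have out: "A 0 t = 0" if "3 * n \<le> \<bar>t\<bar>" for t
  proof -
    have "3 * T \<le> \<bar>t\<bar>" using that T by simp
    then have "3 \<le> \<bar>t / n\<bar>" "3 \<le> \<bar>t / T\<bar>" using that n T by (simp_all add: field_simps)
    then show ?thesis by (simp add: A0 cutoff_outside)
  qed
  have inn: "A 0 t = 0" if "\<bar>t\<bar> \<le> 2 * T" for t
  proof -
    have "\<bar>t\<bar> \<le> 2 * n" using that T by simp
    then have "\<bar>t / n\<bar> \<le> 2" "\<bar>t / T\<bar> \<le> 2" using that n T by (simp_all add: field_simps)
    then show ?thesis by (simp add: A0 cutoff_inside)
  qed
  have outB: "B 0 t = 0" if "3 * n \<le> \<bar>t\<bar>" for t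
  proof -
    have "3 \<le> \<bar>t / n\<bar>" using that n by (simp add: field_simps)
    then show ?thesis by (simp add: B0 cutoff_outside)
  qed
  have "{p. \<phi> p \<noteq> 0} \<subseteq> {-(3*n)..3*n} \<times> {-(3*n)..3*n}"
  proof
    fix p assume "p \<in> {p. \<phi> p \<noteq> 0}"
    then have "A 0 (fst p) \<noteq> 0" "B 0 (snd p) \<noteq> 0" by (auto simp: \<phi>_def)
    then have "\<bar>fst p\<bar> < 3 * n" "\<bar>snd p\<bar> < 3 * n" using out[of "fst p"] outB[of "snd p"] by force+
    then show "p \<in> {-(3*n)..3*n} \<times> {-(3*n)..3*n}" by (auto simp: mem_Times_iff abs_less_iff)
  qed
  then have "bounded {p. \<phi> p \<noteq> 0}"
    by (rule bounded_subset[rotated]) (intro bounded_Times bounded_closed_interval)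
  then have "compact (closure {p. \<phi> p \<noteq> 0})" by (simp add: compact_closure)
  moreover have "smooth2 \<phi>" unfolding \<phi>_def by (rule smooth2_tensor[OF jA jB])
  ultimately have tf: "test_fun \<phi>" by (simp add: test_fun_def)
  have "closure {p. \<phi> p \<noteq> 0} \<subseteq> {p. 2 * T \<le> \<bar>fst p\<bar>}"
  proof (rule closure_minimal)
    show "{p. \<phi> p \<noteq> 0} \<subseteq> {p. 2 * T \<le> \<bar>fst p\<bar>}" using inn by (force simp: \<phi>_def)
    show "closed {p::real\<times>real. 2 * T \<le> \<bar>fst p\<bar>}" by (intro closed_Collect_le continuous_intros)
  qed
  then have dis: "closure {p. \<phi> p \<noteq> 0} \<inter> ({-T..T} \<times> UNIV) = {}" using T by fastforce
  have four: "fourier2 \<phi> (- \<zeta>) = (kern n (fst \<zeta> - t0) - kern T (fst \<zeta> - t0)) * kern n (snd \<zeta> - x0)" for \<zeta>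
  proof -
    let ?a = "\<lambda>t. cutoff 0 (t / n) * cis (t * (fst \<zeta> - t0)) - cutoff 0 (t / T) * cis (t * (fst \<zeta> - t0))"
    let ?b = "\<lambda>x. cutoff 0 (x / n) * cis (x * (snd \<zeta> - x0))"
    have "fourier2 \<phi> (- \<zeta>) = (LINT p|lborel. ?a (fst p) * ?b (snd p))"
      unfolding fourier2_def
    proof (rule Bochner_Integration.integral_cong[OF refl])
      fix p
      have c1: "cis (- (fst p * fst (-\<zeta>) + snd p * snd (-\<zeta>))) = cis (fst p * fst \<zeta>) * cis (snd p * snd \<zeta>)"
        by (simp add: cis_mult add.commute)
      have c2: "cis (t * (u - v)) = cis (t * (-v)) * cis (t * u)" for t u v by (simp add: cis_mult algebra_simps)
      show "\<phi> p * cis (- (fst p * fst (-\<zeta>) + snd p * snd (-\<zeta>))) = ?a (fst p) * ?b (snd p)"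
        unfolding \<phi>_def A0 B0 c1 c2[of _ "fst \<zeta>" t0] c2[of _ "snd \<zeta>" x0] by (simp only: left_diff_distrib right_diff_distrib mult_ac)
    qed
    also have "\<dots> = (LINT t|lborel. ?a t) * (LINT x|lborel. ?b x)"
      using n T by (intro integral_tensor Bochner_Integration.integrable_diff ft_dilated_cutoff) auto
    also have "(LINT t|lborel. ?a t) = kern n (fst \<zeta> - t0) - kern T (fst \<zeta> - t0)"
      using n T by (simp add: ft_dilated_cutoff)
    also have "(LINT x|lborel. ?b x) = kern n (snd \<zeta> - x0)" using n by (simp add: ft_dilated_cutoff)
    finally show ?thesis .
  qed
  have "(LINT \<zeta>|lborel. F \<zeta> * fourier2 \<phi> (- \<zeta>)) = 0"
    using supp tf dis unfolding time_supp_in_def by blast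
  then show ?thesis unfolding four .
qed

text \<open>The positive and negative parts of \<open>d\<close> define measures that are finite and
  agree on boxes, an intersection-stable generator. The measures therefore coincide, and their
  densities agree almost everywhere.\<close>

lemma AE_zero_of_boxes_real:
  fixes d :: "'a::euclidean_space \<Rightarrow> real"
  assumes m[measurable]: "d \<in> borel_measurable borel"
    and i: "\<And>a b. integrable lborel (\<lambda>x. indicator (box a b) x * d x)"
    and z: "\<And>a b. (LINT x|lborel. indicator (box a b) x * d x) = 0"
  shows "AE x in lborel. d x = 0"
proof -
  let ?p = "\<lambda>x. ennreal (d x)" let ?q = "\<lambda>x. ennreal (- d x)"
  have fin: "(\<integral>\<^sup>+x. ?p x * indicator (box a b) x \<partial>lborel) \<noteq> \<infinity>" and
    eq: "(\<integral>\<^sup>+x. ?p x * indicator (box a b) x \<partial>lborel) = (\<integral>\<^sup>+x. ?q x * indicator (box a b) x \<partial>lborel)" for a b :: 'a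
  proof -
    let ?f = "\<lambda>x. indicator (box a b) x * d x"
    have p: "(\<integral>\<^sup>+x. ?p x * indicator (box a b) x \<partial>lborel) = (\<integral>\<^sup>+x. ennreal (?f x) \<partial>lborel)"
      by (intro nn_integral_cong) (auto simp: indicator_def)
    have q: "(\<integral>\<^sup>+x. ?q x * indicator (box a b) x \<partial>lborel) = (\<integral>\<^sup>+x. ennreal (- ?f x) \<partial>lborel)"
      by (intro nn_integral_cong) (auto simp: indicator_def)
    have fp: "(\<integral>\<^sup>+x. ennreal (?f x) \<partial>lborel) \<noteq> \<infinity>" and fq: "(\<integral>\<^sup>+x. ennreal (- ?f x) \<partial>lborel) \<noteq> \<infinity>"
      using i[of a b] by (auto simp: real_integrable_def)
    have "enn2real (\<integral>\<^sup>+x. ennreal (?f x) \<partial>lborel) = enn2real (\<integral>\<^sup>+x. ennreal (- ?f x) \<partial>lborel)"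
      using real_lebesgue_integral_def[OF i[of a b]] z[of a b] by simp
    then have "ennreal (enn2real (\<integral>\<^sup>+x. ennreal (?f x) \<partial>lborel)) = ennreal (enn2real (\<integral>\<^sup>+x. ennreal (- ?f x) \<partial>lborel))"
      by (simp only:)
    moreover have "ennreal (enn2real X) = X" if "X \<noteq> \<infinity>" for X
      using that by (intro ennreal_enn2real) (simp add: less_top)
    ultimately have "(\<integral>\<^sup>+x. ennreal (?f x) \<partial>lborel) = (\<integral>\<^sup>+x. ennreal (- ?f x) \<partial>lborel)"
      using fp fq by (simp only: not_False_eq_True)
    then show "(\<integral>\<^sup>+x. ?p x * indicator (box a b) x \<partial>lborel) \<noteq> \<infinity>"
      "(\<integral>\<^sup>+x. ?p x * indicator (box a b) x \<partial>lborel) = (\<integral>\<^sup>+x. ?q x * indicator (box a b) x \<partial>lborel)"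
      using p q fp by simp_all
  qed
  have "density lborel ?p = density lborel ?q"
  proof (rule measure_eqI_generator_eq)
    let ?E = "range (\<lambda>(a, b). box a b::'a set)"
    show "Int_stable ?E" by (auto simp: Int_stable_def box_Int_box)
    show "?E \<subseteq> Pow UNIV" "sets (density lborel ?p) = sigma_sets UNIV ?E" "sets (density lborel ?q) = sigma_sets UNIV ?E"
      by (simp_all add: borel_eq_box)
    let ?A = "\<lambda>n::nat. box (- (real n *\<^sub>R One)) (real n *\<^sub>R One) :: 'a set"
    show "range ?A \<subseteq> ?E" "(\<Union>i. ?A i) = UNIV" unfolding UN_box_eq_UNIV by auto
    show "emeasure (density lborel ?p) (?A i) \<noteq> \<infinity>" for i using fin by (simp add: emeasure_density)
    show "emeasure (density lborel ?p) X = emeasure (density lborel ?q) X" if "X \<in> ?E" for X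
      using that eq by (auto simp: emeasure_density)
  qed
  then have "AE x in lborel. ?p x = ?q x"
    by (intro sigma_finite_measure.density_unique[OF sigma_finite_lborel]) auto
  then show ?thesis
  proof eventually_elim
    case (elim x)
    then show ?case by (cases "0 \<le> d x") (auto simp: ennreal_neg ennreal_eq_0_iff)
  qed
qed

lemma AE_zero_of_boxes:
  fixes d :: "'a::euclidean_space \<Rightarrow> complex"
  assumes m[measurable]: "d \<in> borel_measurable borel"
    and i: "\<And>a b. integrable lborel (\<lambda>x. indicator (box a b) x * d x)"
    and z: "\<And>a b. (LINT x|lborel. indicator (box a b) x * d x) = 0"
  shows "AE x in lborel. d x = 0"
proof -
  have "AE x in lborel. Re (d x) = 0"
  proof (rule AE_zero_of_boxes_real)
    fix a b :: 'a
    have e: "(\<lambda>x. indicator (box a b) x * Re (d x)) = (\<lambda>x. Re (indicator (box a b) x * d x))"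
      by (auto simp: indicator_def fun_eq_iff)
    show "integrable lborel (\<lambda>x. indicator (box a b) x * Re (d x))" unfolding e by (intro integrable_Re i)
    show "(LINT x|lborel. indicator (box a b) x * Re (d x)) = 0" unfolding e using z i by (subst integral_Re) auto
  qed simp
  moreover have "AE x in lborel. Im (d x) = 0"
  proof (rule AE_zero_of_boxes_real)
    fix a b :: 'a
    have e: "(\<lambda>x. indicator (box a b) x * Im (d x)) = (\<lambda>x. Im (indicator (box a b) x * d x))"
      by (auto simp: indicator_def fun_eq_iff)
    show "integrable lborel (\<lambda>x. indicator (box a b) x * Im (d x))" unfolding e by (intro integrable_Im i)
    show "(LINT x|lborel. indicator (box a b) x * Im (d x)) = 0" unfolding e using z i by (subst integral_Im) auto
  qed simp
  ultimately show ?thesis by eventually_elim (simp add: complex_eq_iff)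
qed

text \<open>The kernel integrated over centres in (p, q). For a fixed centre the kernels concentrate
  as the scale grows and have no limiting function, whereas these integrals tend to a multiple of
  the indicator of (p, q) with decay independent of the scale, as a limit in a pairing with F
  requires.\<close>

definition avg :: "real \<Rightarrow> real \<Rightarrow> real \<Rightarrow> real \<Rightarrow> complex" where
  "avg c p q u = (LINT v|lborel. indicator {p<..<q} v * kern c (u - v))"

lemma avg_measurable [measurable]: "avg c p q \<in> borel_measurable borel"
  unfolding avg_def[abs_def] by measurable

text \<open>Uniformity in \<open>c \<ge> c\<^sub>0\<close> is what allows dominated convergence as \<open>c \<longrightarrow> \<infinity>\<close>.\<close>
lemma kern_far:
  assumes c0: "0 < c0"
  shows "\<exists>K\<ge>0. \<forall>c\<ge>c0. \<forall>u v. p < v \<and> v < q \<and> 2 + 2 * \<bar>p\<bar> + 2 * \<bar>q\<bar> \<le> \<bar>u\<bar> \<longrightarrow> norm (kern c (u - v)) \<le> K / (1 + u\<^sup>2)"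
proof -
  obtain C where C: "0 \<le> C" "\<And>u. norm (cutoff_hat u) \<le> C / (1 + u\<^sup>2)" using cutoff_hat_decay by blast
  have "norm (kern c (u - v)) \<le> (8 * C / c0) / (1 + u\<^sup>2)"
    if c: "c0 \<le> c" and uv: "p < v" "v < q" "2 + 2 * \<bar>p\<bar> + 2 * \<bar>q\<bar> \<le> \<bar>u\<bar>" for c u v
  proof -
    have cp: "0 < c" using c c0 by simp
    \<comment> \<open>The threshold on |u| is twice a bound for |v| plus 2, so that |v| \<le> |u|/2
      and 1 \<le> |u|.\<close>
    have far: "\<bar>u\<bar> / 2 \<le> \<bar>u - v\<bar>" "1 \<le> \<bar>u\<bar>" using uv by linarith+
    have "(\<bar>u\<bar> / 2)\<^sup>2 \<le> \<bar>u - v\<bar>\<^sup>2" using far by (intro power_mono) auto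
    then have u2: "u\<^sup>2 / 4 \<le> (u - v)\<^sup>2" by (simp add: power_divide)
    have "1 \<le> u\<^sup>2" using far by (metis abs_square_le_1 abs_le_square_iff abs_one power_one)
    then have "1 + u\<^sup>2 \<le> 8 * (u - v)\<^sup>2" using u2 by simp
    then have "c * c0 * (1 + u\<^sup>2) \<le> c * c * (8 * (u - v)\<^sup>2)" using c cp c0 by (intro mult_mono) auto
    also have "\<dots> \<le> 8 * (1 + (c * (u - v))\<^sup>2)" by (simp add: power_mult_distrib power2_eq_square)
    finally have k: "c * c0 * (1 + u\<^sup>2) \<le> 8 * (1 + (c * (u - v))\<^sup>2)" .
    have p1: "0 < 1 + (c * (u - v))\<^sup>2" "0 < 1 + u\<^sup>2" by (simp_all add: add_pos_nonneg)
    have "norm (kern c (u - v)) \<le> c * (C / (1 + (c * (u - v))\<^sup>2))"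
      using mult_left_mono[OF C(2)[of "c * (u - v)"], of c] cp by (simp add: kern_def norm_mult)
    also have "\<dots> = C * (c / (1 + (c * (u - v))\<^sup>2))" by simp
    also have "\<dots> \<le> C * ((8 / c0) / (1 + u\<^sup>2))"
      using k p1 c0 C by (intro mult_left_mono) (simp_all add: divide_simps mult_ac)
    finally show ?thesis by (simp add: mult.commute)
  qed
  then show ?thesis using C c0 by (intro exI[of _ "8 * C / c0"]) auto
qed

lemma near_bound:
  fixes u M :: real
  assumes "\<bar>u\<bar> < M" "0 \<le> K" shows "K \<le> K * (1 + M\<^sup>2) / (1 + u\<^sup>2)"
proof -
  have "u\<^sup>2 \<le> M\<^sup>2" using assms by (intro abs_le_square_iff[THEN iffD1]) auto
  then have "K * (1 + u\<^sup>2) \<le> K * (1 + M\<^sup>2)" using assms by (intro mult_left_mono) auto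
  then show ?thesis by (simp add: field_simps add_pos_nonneg)
qed

text \<open>At a fixed scale the height of the kernel near the interval may enter the constant. This
  is enough for a Fubini majorant, where \<open>c\<close> does not vary.\<close>

lemma kern_pointwise:
  assumes c: "0 < c"
  shows "\<exists>K\<ge>0. \<forall>u v. p < v \<and> v < q \<longrightarrow> norm (kern c (u - v)) \<le> K / (1 + u\<^sup>2)"
proof -
  let ?M = "2 + 2 * \<bar>p\<bar> + 2 * \<bar>q\<bar>"
  obtain K where K: "0 \<le> K" "\<And>u v. p < v \<Longrightarrow> v < q \<Longrightarrow> ?M \<le> \<bar>u\<bar> \<Longrightarrow> norm (kern c (u - v)) \<le> K / (1 + u\<^sup>2)"
    using kern_far[OF c, of p q] by blast
  obtain C where C: "0 \<le> C" "\<And>u. norm (cutoff_hat u) \<le> C / (1 + u\<^sup>2)" using cutoff_hat_decay by blast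
  have b: "norm (kern c w) \<le> c * C" for w
  proof -
    have "C / (1 + (c * w)\<^sup>2) \<le> C / 1" using C by (intro divide_left_mono) (auto simp: add_pos_nonneg)
    with C(2)[of "c * w"] have "norm (cutoff_hat (c * w)) \<le> C" by simp
    then show ?thesis using c by (simp add: kern_def norm_mult)
  qed
  let ?K = "K + c * C * (1 + ?M\<^sup>2)"
  have nn: "0 \<le> c * C * (1 + ?M\<^sup>2)" using C c by (intro mult_nonneg_nonneg) auto
  have main: "norm (kern c (u - v)) \<le> ?K / (1 + u\<^sup>2)" if "p < v" "v < q" for u v
  proof (cases "?M \<le> \<bar>u\<bar>")
    case True
    have "K / (1 + u\<^sup>2) \<le> ?K / (1 + u\<^sup>2)" using nn by (intro divide_right_mono) auto
    then show ?thesis using K(2)[OF that True] by linarith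
  next
    case False
    have "c * C \<le> c * C * (1 + ?M\<^sup>2) / (1 + u\<^sup>2)" using False C c by (intro near_bound) auto
    also have "\<dots> \<le> ?K / (1 + u\<^sup>2)" using K by (intro divide_right_mono) auto
    finally show ?thesis using b[of "u - v"] by linarith
  qed
  have "0 \<le> ?K" using K nn by (intro add_nonneg_nonneg)
  with main show ?thesis by blast
qed

lemma kern_integrable: "0 < c \<Longrightarrow> integrable lborel (\<lambda>v. kern c (u - v))"
  using lborel_integrable_real_affine[OF cutoff_hat_integrable, of "- c" "c * u"]
  unfolding kern_def by (simp add: algebra_simps)

lemma integral_norm_kern: "0 < c \<Longrightarrow> (LINT v|lborel. norm (kern c (u - v))) = (LINT v|lborel. norm (cutoff_hat v))"
  by (subst (2) lborel_integral_real_affine[where c="- c" and t="c * u"])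
     (auto simp: kern_def norm_mult algebra_simps)

lemma indicator_kern_integrable:
  "0 < c \<Longrightarrow> integrable lborel (\<lambda>v. indicator {p<..<q} v * kern c (u - v))"
  by (rule Bochner_Integration.integrable_bound[OF kern_integrable[of c u]]) (auto simp: norm_mult indicator_def)

lemma integrable_indicator_Ioo: "integrable lborel (indicator {p<..<q::real} :: real \<Rightarrow> real)"
  by (cases "p \<le> q") auto

text \<open>Far from the interval the pointwise decay is already uniform in \<open>c\<close>. Near
  it the kernel may have height of order \<open>c\<close>, but its L^1 norm is independent of
  \<open>c\<close>, and this bounds the average.\<close>

lemma avg_bound:
  assumes c0: "0 < c0"
  shows "\<exists>K\<ge>0. \<forall>c\<ge>c0. \<forall>u. norm (avg c p q u) \<le> K / (1 + u\<^sup>2)"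
proof -
  let ?M = "2 + 2 * \<bar>p\<bar> + 2 * \<bar>q\<bar>"
  obtain K where K: "0 \<le> K" "\<And>c u v. c0 \<le> c \<Longrightarrow> p < v \<Longrightarrow> v < q \<Longrightarrow> ?M \<le> \<bar>u\<bar> \<Longrightarrow> norm (kern c (u - v)) \<le> K / (1 + u\<^sup>2)"
    using kern_far[OF c0, of p q] by blast
  let ?L = "LINT v|lborel. norm (cutoff_hat v)"
  have L: "0 \<le> ?L" by simp
  let ?K = "\<bar>q - p\<bar> * K + ?L * (1 + ?M\<^sup>2)"
  have main: "norm (avg c p q u) \<le> ?K / (1 + u\<^sup>2)" if c: "c0 \<le> c" for c u
  proof (cases "?M \<le> \<bar>u\<bar>")
    case True
    have "norm (avg c p q u) \<le> (LINT v|lborel. norm (indicator {p<..<q} v * kern c (u - v)))"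
      unfolding avg_def by (rule integral_norm_bound)
    also have "\<dots> \<le> (LINT v|lborel. indicator {p<..<q} v * (K / (1 + u\<^sup>2)))"
      using c c0 K(2)[OF c _ _ True] K(1)
      by (intro integral_mono integrable_norm indicator_kern_integrable integrable_mult_left integrable_indicator_Ioo)
         (auto simp: norm_mult indicator_def)
    also have "\<dots> = measure lborel {p<..<q} * (K / (1 + u\<^sup>2))" by simp
    also have "\<dots> \<le> \<bar>q - p\<bar> * (K / (1 + u\<^sup>2))"
      using K by (intro mult_right_mono) (cases "p \<le> q", auto)
    also have "\<dots> \<le> ?K / (1 + u\<^sup>2)"
      using L by (simp add: divide_right_mono)
    finally show ?thesis .
  next
    case False
    have "norm (avg c p q u) \<le> (LINT v|lborel. norm (indicator {p<..<q} v * kern c (u - v)))"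
      unfolding avg_def by (rule integral_norm_bound)
    also have "\<dots> \<le> (LINT v|lborel. norm (kern c (u - v)))"
      using c c0 by (intro integral_mono integrable_norm indicator_kern_integrable kern_integrable)
         (auto simp: norm_mult indicator_def)
    also have "\<dots> = ?L" using c c0 by (intro integral_norm_kern) auto
    also have "\<dots> \<le> ?L * (1 + ?M\<^sup>2) / (1 + u\<^sup>2)" using False L by (intro near_bound) auto
    also have "\<dots> \<le> ?K / (1 + u\<^sup>2)" using K by (intro divide_right_mono) auto
    finally show ?thesis .
  qed
  have "0 \<le> ?K" using K L by (intro add_nonneg_nonneg mult_nonneg_nonneg) auto
  with main show ?thesis by blast
qed

text \<open>After rescaling, the fixed function \<open>cutoff_hat\<close> is integrated against
  indicators at u - v/(n+1), which are eventually constant for every \<open>v\<close> unless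
  \<open>u\<close> is an endpoint.\<close>

lemma avg_limit:
  assumes "u \<noteq> p" "u \<noteq> q"
  shows "(\<lambda>n. avg (real (Suc n)) p q u) \<longlonglongrightarrow> indicator {p<..<q} u * (LINT v|lborel. cutoff_hat v)"
proof -
  have e: "avg (real (Suc n)) p q u = (LINT v|lborel. indicator {p<..<q} (u - v / real (Suc n)) * cutoff_hat v)" for n
    unfolding avg_def
  proof -
    define m where "m = real (Suc n)"
    have m: "0 < m" by (simp add: m_def)
    have e: "(\<lambda>v. indicator {p<..<q} (u + (- 1 / m) * v) * kern m (u - (u + (- 1 / m) * v)))
       = (\<lambda>v. of_real m * (indicator {p<..<q} (u - v / m) * cutoff_hat v))"
      using m by (auto simp: kern_def fun_eq_iff)
    have "(LINT v|lborel. indicator {p<..<q} v * kern m (u - v))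
       = \<bar>- 1 / m\<bar> *\<^sub>R (LINT v|lborel. indicator {p<..<q} (u + (- 1 / m) * v) * kern m (u - (u + (- 1 / m) * v)))"
      using m by (intro lborel_integral_real_affine) auto
    also have "\<dots> = (LINT v|lborel. indicator {p<..<q} (u - v / m) * cutoff_hat v)"
      unfolding e integral_mult_right_zero using m by (simp add: scaleR_conv_of_real)
    finally show "(LINT v|lborel. indicator {p<..<q} v * kern (real (Suc n)) (u - v)) = (LINT v|lborel. indicator {p<..<q} (u - v / real (Suc n)) * cutoff_hat v)"
      by (simp only: m_def)
  qed
  have "(\<lambda>n. LINT v|lborel. indicator {p<..<q} (u - v / real (Suc n)) * cutoff_hat v) \<longlonglongrightarrow> (LINT v|lborel. indicator {p<..<q} u * cutoff_hat v)"
  proof (rule integral_dominated_convergence[where w="\<lambda>v. norm (cutoff_hat v)"])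
    show "AE v in lborel. (\<lambda>n. indicator {p<..<q} (u - v / real (Suc n)) * cutoff_hat v) \<longlonglongrightarrow> indicator {p<..<q} u * cutoff_hat v"
    proof (rule AE_I2)
      fix v :: real
      have "(\<lambda>n. u - v / real (Suc n)) \<longlonglongrightarrow> u - 0"
        by (intro tendsto_diff tendsto_const lim_const_over_n[THEN LIMSEQ_Suc])
      then have l: "(\<lambda>n. u - v / real (Suc n)) \<longlonglongrightarrow> u" by simp
      consider "p < u" "u < q" | "u < p" | "q < u" using assms by linarith
      then have "\<forall>\<^sub>F n in sequentially. indicator {p<..<q} u * cutoff_hat v = indicator {p<..<q} (u - v / real (Suc n)) * cutoff_hat v"
      proof cases
        case 1
        show ?thesis using order_tendstoD(1)[OF l 1(1)] order_tendstoD(2)[OF l 1(2)]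
          by eventually_elim (use 1 in simp)
      next
        case 2
        show ?thesis using order_tendstoD(2)[OF l 2] by eventually_elim (use 2 in simp)
      next
        case 3
        show ?thesis using order_tendstoD(1)[OF l 3] by eventually_elim (use 3 in simp)
      qed
      then show "(\<lambda>n. indicator {p<..<q} (u - v / real (Suc n)) * cutoff_hat v) \<longlonglongrightarrow> indicator {p<..<q} u * cutoff_hat v"
        by (rule Lim_transform_eventually[OF tendsto_const])
    qed
    show "AE v in lborel. norm (indicator {p<..<q} (u - v / real (Suc n)) * cutoff_hat v) \<le> norm (cutoff_hat v)" for n
      by (auto simp: norm_mult indicator_def)
  qed (auto intro: cutoff_hat_integrable)
  then show ?thesis unfolding e by simp
qed

lemma le_add_of_double_le: "2 * p \<le> a + b \<Longrightarrow> 0 \<le> p \<Longrightarrow> b \<le> q \<Longrightarrow> p \<le> a + (q::real)"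
  by linarith

lemma ennreal_norm_integral_le:
  fixes f :: "'a \<Rightarrow> complex"
  shows "ennreal (norm (integral\<^sup>L M f)) \<le> (\<integral>\<^sup>+x. ennreal (norm (f x)) \<partial>M)"
  by (cases "integrable M f") (auto simp: integral_norm_bound_ennreal not_integrable_integral_eq)

lemma integrable_pairI:
  fixes f :: "'a::euclidean_space \<Rightarrow> 'b::euclidean_space \<Rightarrow> complex"
  assumes m[measurable]: "case_prod f \<in> borel_measurable (lborel \<Otimes>\<^sub>M lborel)"
    and b: "(\<integral>\<^sup>+x. (\<integral>\<^sup>+y. ennreal (norm (f x y)) \<partial>lborel) \<partial>lborel) < \<infinity>"
  shows "integrable (lborel \<Otimes>\<^sub>M lborel) (case_prod f)"
proof (rule integrableI_bounded)
  have "(\<integral>\<^sup>+z. ennreal (norm (case_prod f z)) \<partial>(lborel \<Otimes>\<^sub>M lborel)) = (\<integral>\<^sup>+x. (\<integral>\<^sup>+y. ennreal (norm (f x y)) \<partial>lborel) \<partial>lborel)"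
    by (subst lborel.nn_integral_fst[symmetric]) auto
  then show "(\<integral>\<^sup>+z. ennreal (norm (case_prod f z)) \<partial>(lborel \<Otimes>\<^sub>M lborel)) < \<infinity>" using b by simp
qed (rule m)

lemma mem_box_pair: "z \<in> box (p, p') (q, q') \<longleftrightarrow> fst z \<in> {p<..<q} \<and> snd z \<in> {p'<..<q' :: real}" for p q :: real
  by (cases z) (auto simp: box_def Basis_prod_def)

lemma indicator_box_pair:
  "indicator (box (p, p') (q, q')) z = (indicator {p<..<q} (fst z) * indicator {p'<..<q'} (snd z) :: 'a::{comm_semiring_1})"
  for p q p' q' :: real
  by (auto simp: indicator_def mem_box_pair)

lemma integrable_tensor_decay:
  "integrable lborel (\<lambda>z::real\<times>real. 1 / ((1 + (fst z)\<^sup>2) * (1 + (snd z)\<^sup>2)))"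
proof -
  have "integrable (lborel \<Otimes>\<^sub>M lborel) (\<lambda>(x::real, y::real). complex_of_real (1 / (1 + x\<^sup>2)) * complex_of_real (1 / (1 + y\<^sup>2)))"
    by (rule integrable_pair_bound[OF _ integrable_inverse_1_plus_sq integrable_inverse_1_plus_sq])
       (measurable, simp only: norm_mult norm_of_real, simp)
  then have "integrable lborel (\<lambda>z::real\<times>real. complex_of_real (1 / ((1 + (fst z)\<^sup>2) * (1 + (snd z)\<^sup>2))))"
    by (simp add: lborel_prod case_prod_beta')
  from integrable_Re[OF this] show ?thesis by simp
qed

lemma integrable_indicator_box: "integrable lborel (indicator (box a b) :: 'a::euclidean_space \<Rightarrow> real)"
  by (intro integrable_real_indicator) (use emeasure_bounded_finite[OF bounded_box[of a b]] in auto)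

text \<open>The weight involves frequency only; as the modulation weight is at least 1, membership
  in X^(1/2,s) implies this finiteness. The bound -1 < s makes F integrable against products with
  quadratic decay in each variable.\<close>

locale weighted_supp =
  fixes F :: "real \<times> real \<Rightarrow> complex" and s T :: real
  assumes F[measurable]: "F \<in> borel_measurable borel"
    and s: "-1 < s"
    and fin: "(\<integral>\<^sup>+\<zeta>. ennreal ((jap (snd \<zeta>) powr s * cmod (F \<zeta>))\<^sup>2) \<partial>lborel) < \<infinity>"
    and T: "0 < T"
    and supp: "time_supp_in T F"
begin

definition G :: "real \<times> real \<Rightarrow> real" where
  "G \<zeta> = cmod (F \<zeta>) / ((1 + (fst \<zeta>)\<^sup>2) * (1 + (snd \<zeta>)\<^sup>2))"

lemma G_nonneg: "0 \<le> G \<zeta>" by (simp add: G_def)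

lemma G_measurable [measurable]: "G \<in> borel_measurable borel"
  unfolding G_def[abs_def] by measurable

text \<open>The inequality 2ab \<le> a^2 + b^2 separates the weighted square of F from the square of
  <\<xi>>^(-s) / ((1 + \<tau>^2) <\<xi>>^2). The latter is integrable since <\<xi>>^(-s) \<le>
  <\<xi>>.\<close>

lemma G_integrable: "integrable lborel G"
proof -
  let ?w = "\<lambda>\<zeta>. (jap (snd \<zeta>) powr s * cmod (F \<zeta>))\<^sup>2"
  have w: "integrable lborel ?w"
    using fin by (intro integrableI_bounded) auto
  have "cmod (F \<zeta>) / ((1 + (fst \<zeta>)\<^sup>2) * (1 + (snd \<zeta>)\<^sup>2)) \<le> ?w \<zeta> + 1 / ((1 + (fst \<zeta>)\<^sup>2) * (1 + (snd \<zeta>)\<^sup>2))" for \<zeta>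
  proof -
    define j where "j = jap (snd \<zeta>)"
    define t where "t = 1 + (fst \<zeta>)\<^sup>2"
    have j: "1 \<le> j" "j * j = 1 + (snd \<zeta>)\<^sup>2" and t: "1 \<le> t" by (simp_all add: j_def t_def)
    let ?a = "j powr s * cmod (F \<zeta>)" let ?b = "j powr (-s) / (t * (j * j))"
    have "0 \<le> (?a - ?b)\<^sup>2" by simp
    then have "2 * (?a * ?b) \<le> ?a\<^sup>2 + ?b\<^sup>2" by (simp add: power2_diff)
    moreover have ab: "?a * ?b = cmod (F \<zeta>) / (t * (j * j))" using j by (simp add: powr_minus)
    ultimately have "2 * (cmod (F \<zeta>) / (t * (j * j))) \<le> ?a\<^sup>2 + ?b\<^sup>2" by (simp only:)
    moreover have "0 \<le> cmod (F \<zeta>) / (t * (j * j))" using j t by simp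
    moreover have "?b\<^sup>2 \<le> 1 / (t * (j * j))"
    proof -
      have "j powr (-s) \<le> j powr 1" using j s by (intro powr_mono) auto
      then have "j powr (-s) * j powr (-s) \<le> j * j" using j by (intro mult_mono) auto
      then have "(j powr (-s) * j powr (-s)) / ((t * (j * j)) * (t * (j * j))) \<le> (j * j) / ((t * (j * j)) * (t * (j * j)))"
        using t by (intro divide_right_mono) auto
      then have "?b\<^sup>2 \<le> (j * j) / ((t * (j * j)) * (t * (j * j)))"
        by (simp only: power2_eq_square times_divide_times_eq)
      also have "\<dots> = (1 / t) * (1 / (t * (j * j)))" using j by simp
      also have "\<dots> \<le> 1 * (1 / (t * (j * j)))" using t j by (intro mult_right_mono) auto
      finally show ?thesis by simp
    qed
    ultimately have "cmod (F \<zeta>) / (t * (j * j)) \<le> ?a\<^sup>2 + 1 / (t * (j * j))" by (rule le_add_of_double_le)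
    then show ?thesis by (simp add: j(2) t_def) (simp add: j_def)
  qed
  then show ?thesis
    by (intro Bochner_Integration.integrable_bound[OF Bochner_Integration.integrable_add[OF w integrable_tensor_decay]])
       (auto simp: G_def intro: order_trans[OF _ abs_ge_self])
qed

lemma norm_F_mult_le:
  assumes "norm a \<le> K / (1 + (fst \<zeta>)\<^sup>2)" "norm b \<le> L / (1 + (snd \<zeta>)\<^sup>2)" "0 \<le> K" "0 \<le> L"
  shows "norm (F \<zeta> * (a * b)) \<le> K * L * G \<zeta>"
proof -
  have "norm a * norm b \<le> (K / (1 + (fst \<zeta>)\<^sup>2)) * (L / (1 + (snd \<zeta>)\<^sup>2))"
    using assms by (intro mult_mono) auto
  then have "norm (F \<zeta>) * (norm a * norm b) \<le> norm (F \<zeta>) * ((K / (1 + (fst \<zeta>)\<^sup>2)) * (L / (1 + (snd \<zeta>)\<^sup>2)))"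
    by (intro mult_left_mono) auto
  then show ?thesis by (simp add: norm_mult G_def mult_ac)
qed

lemma integrable_F_mult:
  assumes [measurable]: "a \<in> borel_measurable borel" "b \<in> borel_measurable borel"
    and "\<And>u. norm (a u) \<le> K / (1 + u\<^sup>2)" "\<And>u. norm (b u) \<le> L / (1 + u\<^sup>2)" "0 \<le> K" "0 \<le> L"
  shows "integrable lborel (\<lambda>\<zeta>. F \<zeta> * (a (fst \<zeta>) * b (snd \<zeta>)))"
  by (rule Bochner_Integration.integrable_bound[OF integrable_mult_right[OF G_integrable, of "K * L"]])
     (auto intro!: AE_I2 order_trans[OF norm_F_mult_le abs_ge_self] assms)

lemma indicator_decay: "\<exists>K\<ge>0. \<forall>u. norm (indicator {p<..<q} u :: complex) \<le> K / (1 + u\<^sup>2)" for p q :: real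
proof -
  have "norm (indicator {p<..<q} u :: complex) \<le> (1 * (1 + (1 + \<bar>p\<bar> + \<bar>q\<bar>)\<^sup>2)) / (1 + u\<^sup>2)" for u
  proof (cases "u \<in> {p<..<q}")
    case True
    then have "\<bar>u\<bar> < 1 + \<bar>p\<bar> + \<bar>q\<bar>" by auto
    from near_bound[OF this, of 1] True show ?thesis by simp
  qed (auto intro!: divide_nonneg_nonneg)
  then show ?thesis by (intro exI[of _ "1 * (1 + (1 + \<bar>p\<bar> + \<bar>q\<bar>)\<^sup>2)"]) auto
qed

lemma kern_ind_pointwise: "0 < c \<Longrightarrow> \<exists>K\<ge>0. \<forall>u v. norm (indicator {p<..<q} v * kern c (u - v)) \<le> K / (1 + u\<^sup>2) * indicator {p<..<q} v"
  using kern_pointwise[of c p q] by (auto simp: norm_mult indicator_def)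

text \<open>The kernel identity holds for every centre and may be integrated over a box of centres.
  Fubini applies with a multiple of \<open>G\<close> times the indicator of the box as
  majorant.\<close>

lemma avg_identity:
  assumes n: "T \<le> n"
  shows "(LINT \<zeta>|lborel. F \<zeta> * ((avg n p q (fst \<zeta>) - avg T p q (fst \<zeta>)) * avg n p' q' (snd \<zeta>))) = 0"
proof -
  have n0: "0 < n" using T n by simp
  define a where "a t v = indicator {p<..<q} v * kern n (t - v) - indicator {p<..<q} v * kern T (t - v)" for t v
  define b where "b x v = indicator {p'<..<q'} v * kern n (x - v)" for x v
  have [measurable]: "case_prod a \<in> borel_measurable (borel \<Otimes>\<^sub>M borel)" "case_prod b \<in> borel_measurable (borel \<Otimes>\<^sub>M borel)"
    unfolding a_def b_def by measurable
  obtain K1 where K1: "0 \<le> K1" "\<And>u v. norm (indicator {p<..<q} v * kern n (u - v)) \<le> K1 / (1 + u\<^sup>2) * indicator {p<..<q} v"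
    using kern_ind_pointwise[OF n0] by blast
  obtain K2 where K2: "0 \<le> K2" "\<And>u v. norm (indicator {p<..<q} v * kern T (u - v)) \<le> K2 / (1 + u\<^sup>2) * indicator {p<..<q} v"
    using kern_ind_pointwise[OF T] by blast
  obtain L where L: "0 \<le> L" "\<And>u v. norm (indicator {p'<..<q'} v * kern n (u - v)) \<le> L / (1 + u\<^sup>2) * indicator {p'<..<q'} v"
    using kern_ind_pointwise[OF n0] by blast
  have an: "norm (a t v) \<le> (K1 + K2) / (1 + t\<^sup>2) * indicator {p<..<q} v" for t v
  proof -
    have "norm (a t v) \<le> K1 / (1 + t\<^sup>2) * indicator {p<..<q} v + K2 / (1 + t\<^sup>2) * indicator {p<..<q} v"
      unfolding a_def by (rule norm_triangle_le_diff[OF add_mono[OF K1(2) K2(2)]])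
    then show ?thesis by (simp add: add_divide_distrib distrib_right)
  qed
  have int: "integrable (lborel \<Otimes>\<^sub>M lborel) (\<lambda>(\<zeta>, \<omega>). F \<zeta> * (a (fst \<zeta>) (fst \<omega>) * b (snd \<zeta>) (snd \<omega>)))"
  proof (rule integrable_pair_bound[where g="\<lambda>\<zeta>. (K1 + K2) * L * G \<zeta>" and h="indicator (box (p, p') (q, q'))"])
    fix \<zeta> \<omega> :: "real \<times> real"
    have "norm (a (fst \<zeta>) (fst \<omega>)) \<le> ((K1 + K2) * indicator {p<..<q} (fst \<omega>)) / (1 + (fst \<zeta>)\<^sup>2)" using an by simp
    moreover have "norm (b (snd \<zeta>) (snd \<omega>)) \<le> (L * indicator {p'<..<q'} (snd \<omega>)) / (1 + (snd \<zeta>)\<^sup>2)"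
      using L(2) unfolding b_def by simp
    ultimately have "norm (F \<zeta> * (a (fst \<zeta>) (fst \<omega>) * b (snd \<zeta>) (snd \<omega>)))
       \<le> ((K1 + K2) * indicator {p<..<q} (fst \<omega>)) * (L * indicator {p'<..<q'} (snd \<omega>)) * G \<zeta>"
      using K1(1) K2(1) L(1) by (intro norm_F_mult_le) auto
    then show "norm (F \<zeta> * (a (fst \<zeta>) (fst \<omega>) * b (snd \<zeta>) (snd \<omega>))) \<le> (K1 + K2) * L * G \<zeta> * indicator (box (p, p') (q, q')) \<omega>"
      by (simp add: indicator_box_pair mult_ac)
  qed (auto intro: G_integrable integrable_indicator_box)
  have ia: "integrable lborel (a t)" "(LINT v|lborel. a t v) = avg n p q t - avg T p q t" for t
    unfolding a_def avg_def using n0 T by (auto intro!: Bochner_Integration.integrable_diff Bochner_Integration.integral_diff indicator_kern_integrable)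
  have ib: "integrable lborel (b x)" "(LINT v|lborel. b x v) = avg n p' q' x" for x
    unfolding b_def avg_def using n0 by (auto intro!: indicator_kern_integrable)
  have "(LINT \<zeta>|lborel. F \<zeta> * ((avg n p q (fst \<zeta>) - avg T p q (fst \<zeta>)) * avg n p' q' (snd \<zeta>)))
      = (LINT \<zeta>|lborel. (LINT \<omega>|lborel. F \<zeta> * (a (fst \<zeta>) (fst \<omega>) * b (snd \<zeta>) (snd \<omega>))))"
    by (simp add: integral_tensor ia ib)
  also have "\<dots> = (LINT \<omega>|lborel. (LINT \<zeta>|lborel. F \<zeta> * (a (fst \<zeta>) (fst \<omega>) * b (snd \<zeta>) (snd \<omega>))))"
    by (rule lborel_pair.Fubini_integral[OF int, symmetric])
  also have "\<dots> = (LINT \<omega>|(lborel :: (real \<times> real) measure). (0::complex))"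
  proof (rule Bochner_Integration.integral_cong[OF refl])
    fix \<omega> :: "real \<times> real"
    have "(LINT \<zeta>|lborel. F \<zeta> * (a (fst \<zeta>) (fst \<omega>) * b (snd \<zeta>) (snd \<omega>))) =
      (LINT \<zeta>|lborel. (indicator {p<..<q} (fst \<omega>) * indicator {p'<..<q'} (snd \<omega>)) *
        (F \<zeta> * ((kern n (fst \<zeta> - fst \<omega>) - kern T (fst \<zeta> - fst \<omega>)) * kern n (snd \<zeta> - snd \<omega>))))"
      unfolding a_def b_def by (simp only: right_diff_distrib left_diff_distrib mult_ac)
    also have "\<dots> = 0" unfolding integral_mult_right_zero time_supp_kernel[OF supp T n] by simp
    finally show "(LINT \<zeta>|lborel. F \<zeta> * (a (fst \<zeta>) (fst \<omega>) * b (snd \<zeta>) (snd \<omega>))) = 0" .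
  qed
  finally show ?thesis by simp
qed

definition hat_mass :: complex where "hat_mass = (LINT v|lborel. cutoff_hat v)"

text \<open>Letting the scale tend to infinity removes the auxiliary cutoffs and leaves only the one
  at scale \<open>T\<close> in time. The lines carrying the sides of the box, where the limit of the
  averages is not controlled, form a null set.\<close>

lemma avg_identity_limit:
  "(LINT \<zeta>|lborel. F \<zeta> * ((indicator {p<..<q} (fst \<zeta>) * hat_mass - avg T p q (fst \<zeta>)) * (indicator {p'<..<q'} (snd \<zeta>) * hat_mass))) = 0"
proof -
  let ?f = "\<lambda>n \<zeta>. F \<zeta> * ((avg (real (Suc n)) p q (fst \<zeta>) - avg T p q (fst \<zeta>)) * avg (real (Suc n)) p' q' (snd \<zeta>))"
  let ?g = "\<lambda>\<zeta>. F \<zeta> * ((indicator {p<..<q} (fst \<zeta>) * hat_mass - avg T p q (fst \<zeta>)) * (indicator {p'<..<q'} (snd \<zeta>) * hat_mass))"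
  obtain K where K: "0 \<le> K" "\<And>c u. 1 \<le> c \<Longrightarrow> norm (avg c p q u) \<le> K / (1 + u\<^sup>2)" using avg_bound[of 1 p q] by auto
  obtain KT where KT: "0 \<le> KT" "\<And>c u. T \<le> c \<Longrightarrow> norm (avg c p q u) \<le> KT / (1 + u\<^sup>2)" using avg_bound[OF T, of p q] by auto
  obtain L where L: "0 \<le> L" "\<And>c u. 1 \<le> c \<Longrightarrow> norm (avg c p' q' u) \<le> L / (1 + u\<^sup>2)" using avg_bound[of 1 p' q'] by auto
  have null: "AE \<zeta> in lborel. fst \<zeta> \<noteq> p \<and> fst \<zeta> \<noteq> q \<and> snd \<zeta> \<noteq> p' \<and> snd \<zeta> \<noteq> (q'::real)" for p q :: real
  proof -
    have "AE t in lborel. t \<noteq> p \<and> t \<noteq> q" "AE x in lborel. x \<noteq> p' \<and> x \<noteq> q'"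
      using AE_lborel_singleton[of p] AE_lborel_singleton[of q] AE_lborel_singleton[of p'] AE_lborel_singleton[of q'] by auto
    then have "AE t in lborel. AE x in lborel. t \<noteq> p \<and> t \<noteq> q \<and> x \<noteq> p' \<and> x \<noteq> q'" by auto
    then have "AE \<zeta> in lborel \<Otimes>\<^sub>M lborel. fst \<zeta> \<noteq> p \<and> fst \<zeta> \<noteq> q \<and> snd \<zeta> \<noteq> p' \<and> snd \<zeta> \<noteq> q'"
    proof (intro lborel_pair.AE_pair_measure)
      show "{\<zeta> \<in> space (lborel \<Otimes>\<^sub>M lborel). fst \<zeta> \<noteq> p \<and> fst \<zeta> \<noteq> q \<and> snd \<zeta> \<noteq> p' \<and> snd \<zeta> \<noteq> q'} \<in> sets (lborel \<Otimes>\<^sub>M lborel)"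
        by measurable
    qed simp
    then show ?thesis unfolding lborel_prod .
  qed
  have "(\<lambda>n. LINT \<zeta>|lborel. ?f n \<zeta>) \<longlonglongrightarrow> (LINT \<zeta>|lborel. ?g \<zeta>)"
  proof (rule integral_dominated_convergence[where w="\<lambda>\<zeta>. (K + KT) * L * G \<zeta>"])
    show "AE \<zeta> in lborel. (\<lambda>n. ?f n \<zeta>) \<longlonglongrightarrow> ?g \<zeta>"
      using null[of p q] unfolding hat_mass_def
      by eventually_elim (intro tendsto_intros avg_limit, auto)
    show "AE \<zeta> in lborel. norm (?f n \<zeta>) \<le> (K + KT) * L * G \<zeta>" for n
    proof (rule AE_I2, rule norm_F_mult_le)
      fix \<zeta> :: "real \<times> real"
      have "norm (avg (real (Suc n)) p q (fst \<zeta>) - avg T p q (fst \<zeta>)) \<le> K / (1 + (fst \<zeta>)\<^sup>2) + KT / (1 + (fst \<zeta>)\<^sup>2)"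
        by (intro norm_triangle_le_diff add_mono K KT) auto
      then show "norm (avg (real (Suc n)) p q (fst \<zeta>) - avg T p q (fst \<zeta>)) \<le> (K + KT) / (1 + (fst \<zeta>)\<^sup>2)"
        by (simp add: add_divide_distrib)
      show "norm (avg (real (Suc n)) p' q' (snd \<zeta>)) \<le> L / (1 + (snd \<zeta>)\<^sup>2)" by (rule L) simp
    qed (use K KT L in auto)
  qed (auto intro: G_integrable)
  moreover obtain N :: nat where N: "T \<le> real N" using real_arch_simple by blast
  have "\<forall>\<^sub>F n in sequentially. (LINT \<zeta>|lborel. ?f n \<zeta>) = 0"
    using eventually_ge_at_top[of N] by eventually_elim (use N in \<open>intro avg_identity; simp\<close>)
  then have "(\<lambda>n. LINT \<zeta>|lborel. ?f n \<zeta>) \<longlonglongrightarrow> 0" by (rule tendsto_eventually)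
  ultimately show ?thesis by (rule LIMSEQ_unique)
qed

text \<open>2 pi times the transform of cutoff(t/T) u(t, x), written as a convolution in the time
  frequency alone.\<close>

definition H :: "real \<times> real \<Rightarrow> complex" where
  "H \<omega> = (LINT t|lborel. F (t, snd \<omega>) * kern T (t - fst \<omega>))"

lemma H_measurable [measurable]: "H \<in> borel_measurable borel"
proof -
  have [measurable]: "F \<in> borel_measurable (borel \<Otimes>\<^sub>M borel)" by (simp add: borel_prod)
  show ?thesis unfolding H_def[abs_def] by measurable
qed

text \<open>Exchanging the order of integration turns the pairing of F with an average into the
  integral of \<open>H\<close> over a box, so that F and \<open>H\<close> can be compared box by
  box.\<close>

lemma box_H:
  shows "integrable lborel (\<lambda>\<omega>. indicator (box (p, p') (q, q')) \<omega> * H \<omega>)"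
    and "(LINT \<zeta>|lborel. F \<zeta> * (avg T p q (fst \<zeta>) * indicator {p'<..<q'} (snd \<zeta>)))
      = (LINT \<omega>|lborel. indicator (box (p, p') (q, q')) \<omega> * H \<omega>)"
proof -
  have [measurable]: "F \<in> borel_measurable (borel \<Otimes>\<^sub>M borel)" by (simp add: borel_prod)
  let ?a = "\<lambda>t x v. F (t, x) * (indicator {p<..<q} v * kern T (t - v) * indicator {p'<..<q'} x)"
  obtain K where K: "0 \<le> K" "\<And>u v. norm (indicator {p<..<q} v * kern T (u - v)) \<le> K / (1 + u\<^sup>2) * indicator {p<..<q} v"
    using kern_ind_pointwise[OF T] by blast
  obtain L where L: "0 \<le> L" "\<And>u. norm (indicator {p'<..<q'} u :: complex) \<le> L / (1 + u\<^sup>2)"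
    using indicator_decay by blast
  have bound: "norm (?a t x v) \<le> K * L * G (t, x) * indicator {p<..<q} v" for t x v
  proof -
    have "norm (indicator {p<..<q} v * kern T (t - v)) \<le> (K * indicator {p<..<q} v) / (1 + (fst (t, x))\<^sup>2)" using K(2) by simp
    from norm_F_mult_le[OF this, of "indicator {p'<..<q'} x" L] show ?thesis using L K by (simp add: mult_ac)
  qed
  have Gfin: "(\<integral>\<^sup>+\<zeta>. ennreal (G \<zeta>) \<partial>lborel) < \<infinity>"
    using G_integrable G_nonneg by (simp add: integrable_iff_bounded)
  have iH: "integrable (lborel \<Otimes>\<^sub>M lborel) (\<lambda>(v, x). indicator {p<..<q} v * (indicator {p'<..<q'} x * H (v, x)))"
  proof (rule integrable_pairI)
    have "(\<integral>\<^sup>+v. (\<integral>\<^sup>+x. ennreal (norm (indicator {p<..<q} v * (indicator {p'<..<q'} x * H (v, x)))) \<partial>lborel) \<partial>lborel)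
       \<le> (\<integral>\<^sup>+v. (\<integral>\<^sup>+x. (\<integral>\<^sup>+t. ennreal (K * L * indicator {p<..<q} v) * ennreal (G (t, x)) \<partial>lborel) \<partial>lborel) \<partial>lborel)"
    proof (intro nn_integral_mono)
      fix v x :: real
      have "indicator {p<..<q} v * (indicator {p'<..<q'} x * H (v, x)) = (LINT t|lborel. ?a t x v)"
        unfolding H_def integral_mult_right_zero[symmetric] by (simp add: mult_ac)
      then have "ennreal (norm (indicator {p<..<q} v * (indicator {p'<..<q'} x * H (v, x)))) \<le> (\<integral>\<^sup>+t. ennreal (norm (?a t x v)) \<partial>lborel)"
        by (simp add: ennreal_norm_integral_le)
      also have "\<dots> \<le> (\<integral>\<^sup>+t. ennreal (K * L * indicator {p<..<q} v) * ennreal (G (t, x)) \<partial>lborel)"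
      proof (intro nn_integral_mono)
        fix t
        have "norm (?a t x v) \<le> (K * L * indicator {p<..<q} v) * G (t, x)" using bound[of t x v] by (simp add: mult_ac)
        then show "ennreal (norm (?a t x v)) \<le> ennreal (K * L * indicator {p<..<q} v) * ennreal (G (t, x))"
          using K L G_nonneg by (subst ennreal_mult[symmetric]) (auto intro!: ennreal_leI)
      qed
      finally show "ennreal (norm (indicator {p<..<q} v * (indicator {p'<..<q'} x * H (v, x))))
         \<le> (\<integral>\<^sup>+t. ennreal (K * L * indicator {p<..<q} v) * ennreal (G (t, x)) \<partial>lborel)" .
    qed
    also have "\<dots> = (\<integral>\<^sup>+v. ennreal (K * L * indicator {p<..<q} v) * (\<integral>\<^sup>+\<zeta>. ennreal (G \<zeta>) \<partial>lborel) \<partial>lborel)"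
    proof (intro nn_integral_cong)
      fix v :: real
      have [measurable]: "G \<in> borel_measurable (borel \<Otimes>\<^sub>M borel)" by (simp add: borel_prod)
      show "(\<integral>\<^sup>+x. (\<integral>\<^sup>+t. ennreal (K * L * indicator {p<..<q} v) * ennreal (G (t, x)) \<partial>lborel) \<partial>lborel)
         = ennreal (K * L * indicator {p<..<q} v) * (\<integral>\<^sup>+\<zeta>. ennreal (G \<zeta>) \<partial>lborel)"
        by (subst nn_integral_prod_swap) (simp_all add: nn_integral_cmult)
    qed
    also have "\<dots> = (\<integral>\<^sup>+v. ennreal (K * L * indicator {p<..<q} v) \<partial>lborel) * (\<integral>\<^sup>+\<zeta>. ennreal (G \<zeta>) \<partial>lborel)"
      by (rule nn_integral_multc) measurable
    finally have le: "(\<integral>\<^sup>+v. (\<integral>\<^sup>+x. ennreal (norm (indicator {p<..<q} v * (indicator {p'<..<q'} x * H (v, x)))) \<partial>lborel) \<partial>lborel)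
       \<le> (\<integral>\<^sup>+v. ennreal (K * L * indicator {p<..<q} v) \<partial>lborel) * (\<integral>\<^sup>+\<zeta>. ennreal (G \<zeta>) \<partial>lborel)" .
    have "(\<integral>\<^sup>+v. ennreal (K * L * indicator {p<..<q} v) \<partial>lborel) = ennreal (LINT v|lborel. K * L * indicator {p<..<q} v)"
      using K L by (intro nn_integral_eq_integral integrable_mult_right integrable_indicator_Ioo) auto
    then have "(\<integral>\<^sup>+v. ennreal (K * L * indicator {p<..<q} v) \<partial>lborel) < \<infinity>" by simp
    then have lt: "(\<integral>\<^sup>+v. ennreal (K * L * indicator {p<..<q} v) \<partial>lborel) * (\<integral>\<^sup>+\<zeta>. ennreal (G \<zeta>) \<partial>lborel) < \<infinity>"
      using Gfin by (simp add: ennreal_mult_less_top)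
    from le_less_trans[OF le lt] show "(\<integral>\<^sup>+v. (\<integral>\<^sup>+x. ennreal (norm (indicator {p<..<q} v * (indicator {p'<..<q'} x * H (v, x)))) \<partial>lborel) \<partial>lborel) < \<infinity>" .
  qed measurable
  then show "integrable lborel (\<lambda>\<omega>. indicator (box (p, p') (q, q')) \<omega> * H \<omega>)"
    by (simp add: lborel_prod case_prod_beta' indicator_box_pair mult.assoc)
  have ia: "integrable (lborel \<Otimes>\<^sub>M lborel) (\<lambda>(\<zeta>, v). ?a (fst \<zeta>) (snd \<zeta>) v)"
    by (rule integrable_pair_bound[where g="\<lambda>\<zeta>. K * L * G \<zeta>" and h="indicator {p<..<q}"])
       (use bound in \<open>auto intro: G_integrable integrable_indicator_Ioo\<close>)
  have ia2: "integrable (lborel \<Otimes>\<^sub>M lborel) (\<lambda>(t, x). ?a t x v)" for v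
  proof -
    have "integrable lborel (\<lambda>\<zeta>. ?a (fst \<zeta>) (snd \<zeta>) v)"
      by (rule Bochner_Integration.integrable_bound[OF integrable_mult_right[OF G_integrable, of "K * L * indicator {p<..<q} v"]])
         (use bound in \<open>auto intro!: AE_I2 order_trans[OF _ abs_ge_self] simp: mult_ac\<close>)
    then show ?thesis by (simp add: lborel_prod case_prod_beta')
  qed
  have "(LINT \<zeta>|lborel. F \<zeta> * (avg T p q (fst \<zeta>) * indicator {p'<..<q'} (snd \<zeta>)))
     = (LINT \<zeta>|lborel. (LINT v|lborel. ?a (fst \<zeta>) (snd \<zeta>) v))"
    unfolding avg_def by simp
  also have "\<dots> = (LINT v|lborel. (LINT \<zeta>|lborel. ?a (fst \<zeta>) (snd \<zeta>) v))"
    by (rule lborel_pair.Fubini_integral[OF ia, symmetric])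
  also have "\<dots> = (LINT v|lborel. (LINT x|lborel. (LINT t|lborel. ?a t x v)))"
  proof (rule Bochner_Integration.integral_cong[OF refl])
    fix v
    show "(LINT \<zeta>|lborel. ?a (fst \<zeta>) (snd \<zeta>) v) = (LINT x|lborel. (LINT t|lborel. ?a t x v))"
      using lborel_pair.integral_snd[OF ia2[of v]] by (simp add: lborel_prod case_prod_beta')
  qed
  also have "\<dots> = (LINT v|lborel. (LINT x|lborel. indicator {p<..<q} v * (indicator {p'<..<q'} x * H (v, x))))"
    unfolding H_def integral_mult_right_zero[symmetric] by (simp add: mult_ac)
  also have "\<dots> = (LINT \<omega>|lborel. indicator (box (p, p') (q, q')) \<omega> * H \<omega>)"
    using lborel_pair.integral_fst'[OF iH] by (simp add: lborel_prod case_prod_beta' indicator_box_pair mult.assoc)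
  finally show "(LINT \<zeta>|lborel. F \<zeta> * (avg T p q (fst \<zeta>) * indicator {p'<..<q'} (snd \<zeta>)))
      = (LINT \<omega>|lborel. indicator (box (p, p') (q, q')) \<omega> * H \<omega>)" .
qed

text \<open>Since \<open>u\<close> is supported in \<open>[-T, T]\<close>, it equals itself times the dilated cutoff.\<close>
lemma reproducing_formula: "AE \<zeta> in lborel. hat_mass * F \<zeta> = H \<zeta>"
proof -
  have "AE \<zeta> in lborel. hat_mass * F \<zeta> - H \<zeta> = 0"
  proof (rule AE_zero_of_boxes)
    fix a b :: "real \<times> real"
    obtain p p' q q' where ab: "a = (p, p')" "b = (q, q')" by (cases a, cases b) auto
    obtain K where K: "0 \<le> K" "\<And>u. norm (indicator {p<..<q} u :: complex) \<le> K / (1 + u\<^sup>2)" using indicator_decay by blast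
    obtain L where L: "0 \<le> L" "\<And>u. norm (indicator {p'<..<q'} u :: complex) \<le> L / (1 + u\<^sup>2)" using indicator_decay by blast
    obtain M where M: "0 \<le> M" "\<And>u. norm (avg T p q u) \<le> M / (1 + u\<^sup>2)" using avg_bound[OF T, of p q] by auto
    have i1: "integrable lborel (\<lambda>\<zeta>. F \<zeta> * (indicator {p<..<q} (fst \<zeta>) * indicator {p'<..<q'} (snd \<zeta>)))"
      by (rule integrable_F_mult[OF _ _ K(2) L(2) K(1) L(1)]) auto
    have i2: "integrable lborel (\<lambda>\<zeta>. F \<zeta> * (avg T p q (fst \<zeta>) * indicator {p'<..<q'} (snd \<zeta>)))"
      by (rule integrable_F_mult[OF _ _ M(2) L(2) M(1) L(1)]) auto
    have split: "(\<lambda>\<zeta>. indicator (box a b) \<zeta> * (hat_mass * F \<zeta> - H \<zeta>)) =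
       (\<lambda>\<zeta>. hat_mass * (F \<zeta> * (indicator {p<..<q} (fst \<zeta>) * indicator {p'<..<q'} (snd \<zeta>))) - indicator (box (p, p') (q, q')) \<zeta> * H \<zeta>)"
      unfolding ab by (auto simp: indicator_box_pair fun_eq_iff algebra_simps)
    show "integrable lborel (\<lambda>\<zeta>. indicator (box a b) \<zeta> * (hat_mass * F \<zeta> - H \<zeta>))"
      unfolding split by (intro Bochner_Integration.integrable_diff integrable_mult_right i1 box_H)
    let ?I = "LINT \<zeta>|lborel. F \<zeta> * (indicator {p<..<q} (fst \<zeta>) * indicator {p'<..<q'} (snd \<zeta>))"
    let ?J = "LINT \<zeta>|lborel. F \<zeta> * (avg T p q (fst \<zeta>) * indicator {p'<..<q'} (snd \<zeta>))"
    have "hat_mass * (hat_mass * ?I - ?J) = (LINT \<zeta>|lborel. hat_mass * (hat_mass * (F \<zeta> * (indicator {p<..<q} (fst \<zeta>) * indicator {p'<..<q'} (snd \<zeta>)))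
         - F \<zeta> * (avg T p q (fst \<zeta>) * indicator {p'<..<q'} (snd \<zeta>))))"
      unfolding integral_mult_right_zero using i1 i2
      by (subst Bochner_Integration.integral_diff) auto
    also have "\<dots> = (LINT \<zeta>|lborel. F \<zeta> * ((indicator {p<..<q} (fst \<zeta>) * hat_mass - avg T p q (fst \<zeta>)) * (indicator {p'<..<q'} (snd \<zeta>) * hat_mass)))"
      by (simp only: right_diff_distrib left_diff_distrib mult_ac)
    also have "\<dots> = 0" by (rule avg_identity_limit)
    finally have "hat_mass * ?I - ?J = 0" using integral_cutoff_hat_nonzero by (simp add: hat_mass_def)
    then show "(LINT \<zeta>|lborel. indicator (box a b) \<zeta> * (hat_mass * F \<zeta> - H \<zeta>)) = 0"
      unfolding split using i1 box_H(1)[of p p' q q'] box_H(2)[of p q p' q']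
      by (subst Bochner_Integration.integral_diff) auto
  qed measurable
  then show ?thesis by eventually_elim simp
qed

end

section \<open>The gain of a power of T\<close>

definition hat_energy :: real where "hat_energy = (LINT u|lborel. (cmod (cutoff_hat u))\<^sup>2)"

lemma cutoff_hat_square_integrable: "integrable lborel (\<lambda>u. (cmod (cutoff_hat u))\<^sup>2)"
proof -
  have "cmod (cutoff_hat u) * cmod (cutoff_hat u) \<le> (LINT t|lborel. norm (cutoff 0 t)) * cmod (cutoff_hat u)" for u
    unfolding cutoff_hat_def by (intro mult_right_mono norm_ft_le) auto
  then show ?thesis
    by (intro Bochner_Integration.integrable_bound[OF integrable_mult_right[OF integrable_norm[OF cutoff_hat_integrable], of "LINT t|lborel. norm (cutoff 0 t)"]])
       (auto simp: power2_eq_square intro!: AE_I2 order_trans[OF _ abs_ge_self])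
qed

lemma hat_energy_nonneg: "0 \<le> hat_energy" by (simp add: hat_energy_def)

text \<open>The kernel has height of order \<open>T\<close> and width of order 1/T, so its squared
  L^2 norm is proportional to \<open>T\<close>. This is the source of the gain for short
  times.\<close>

lemma nn_integral_kern_square:
  assumes T: "0 < T"
  shows "(\<integral>\<^sup>+t. ennreal (cmod (kern T (t - v)))^2 \<partial>lborel) = ennreal (T * hat_energy)"
proof -
  have "(\<integral>\<^sup>+u. ennreal (cmod (cutoff_hat u))^2 \<partial>lborel) = ennreal hat_energy"
    unfolding hat_energy_def by (subst nn_integral_eq_integral[OF cutoff_hat_square_integrable, symmetric]) (auto simp: ennreal_power)
  moreover have "(\<integral>\<^sup>+u. ennreal (cmod (cutoff_hat u))^2 \<partial>lborel) = \<bar>T\<bar> * (\<integral>\<^sup>+t. ennreal (cmod (cutoff_hat (- (T * v) + T * t)))^2 \<partial>lborel)"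
    using T by (intro nn_integral_real_affine) auto
  ultimately have e: "ennreal T * (\<integral>\<^sup>+t. ennreal (cmod (cutoff_hat (- (T * v) + T * t)))^2 \<partial>lborel) = ennreal hat_energy" using T by simp
  have "(\<integral>\<^sup>+t. ennreal (cmod (kern T (t - v)))^2 \<partial>lborel) = (\<integral>\<^sup>+t. ennreal T * (ennreal T * ennreal (cmod (cutoff_hat (- (T * v) + T * t)))^2) \<partial>lborel)"
  proof (intro nn_integral_cong)
    fix t
    have "kern T (t - v) = of_real T * cutoff_hat (- (T * v) + T * t)" by (simp add: kern_def algebra_simps)
    then show "ennreal (cmod (kern T (t - v)))^2 = ennreal T * (ennreal T * ennreal (cmod (cutoff_hat (- (T * v) + T * t)))^2)"
      using T by (simp add: norm_mult ennreal_mult power2_eq_square mult_ac)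
  qed
  also have "\<dots> = ennreal T * (ennreal T * (\<integral>\<^sup>+t. ennreal (cmod (cutoff_hat (- (T * v) + T * t)))^2 \<partial>lborel))"
    by (simp add: nn_integral_cmult)
  also have "\<dots> = ennreal (T * hat_energy)" unfolding e using T hat_energy_nonneg by (simp add: ennreal_mult)
  finally show ?thesis .
qed

definition gain_const :: real where "gain_const = hat_energy / (cmod (LINT v|lborel. cutoff_hat v))\<^sup>2"

lemma gain_const_nonneg: "0 \<le> gain_const" by (simp add: gain_const_def hat_energy_nonneg)

text \<open>Finiteness of \<open>Q\<close> is what permits moving half of it to the left
  side.\<close>

lemma ennreal_absorb:
  fixes Q Y :: ennreal
  assumes "Q < \<infinity>" "Q \<le> ennreal (1/2) * Q + Y" shows "Q \<le> 2 * Y"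
proof (cases "Y = \<infinity>")
  case False
  obtain q where q: "Q = ennreal q" "0 \<le> q" using assms(1) by (cases Q) auto
  obtain y where y: "Y = ennreal y" "0 \<le> y" using False by (cases Y) auto
  have "0 \<le> 1/2 * q" "(0::real) \<le> 1/2" using q by auto
  then have "ennreal (1/2 * q + y) = ennreal (1/2) * ennreal q + ennreal y"
    using q(2) y(2) by (simp only: ennreal_plus ennreal_mult)
  then have "ennreal q \<le> ennreal (1/2 * q + y)"
    using assms(2) by (simp only: q(1) y(1))
  then have "q \<le> 1/2 * q + y" using q y by (subst (asm) ennreal_le_iff) auto
  then have "ennreal q \<le> ennreal (2 * y)" by (intro ennreal_leI) simp
  then show ?thesis using q y by (simp add: ennreal_mult')
qed (simp add: ennreal_mult_top)

context weighted_supp begin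

definition A :: "real \<times> real \<Rightarrow> ennreal" where
  "A \<zeta> = ennreal ((jap (snd \<zeta>) powr s * cmod (F \<zeta>))\<^sup>2)"

lemma A_measurable [measurable]: "A \<in> borel_measurable borel" "A \<in> borel_measurable (borel \<Otimes>\<^sub>M borel)"
proof -
  show "A \<in> borel_measurable borel" unfolding A_def[abs_def] by measurable
  then show "A \<in> borel_measurable (borel \<Otimes>\<^sub>M borel)" by (simp add: borel_prod)
qed

text \<open>Cauchy-Schwarz in the reproducing formula. The formula convolves in \<tau> only and the
  weight depends on \<xi> only, so the weight passes through the convolution unchanged.\<close>

lemma A_pointwise: "AE \<zeta> in lborel. A \<zeta> \<le> ennreal (T * gain_const) * (\<integral>\<^sup>+t. A (t, snd \<zeta>) \<partial>lborel)"
  using reproducing_formula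
proof eventually_elim
  case (elim \<zeta>)
  have [measurable]: "F \<in> borel_measurable (borel \<Otimes>\<^sub>M borel)" by (simp add: borel_prod)
  let ?x = "snd \<zeta>" let ?w = "ennreal ((jap (snd \<zeta>) powr s)\<^sup>2)"
  let ?I = "\<integral>\<^sup>+t. ennreal (cmod (F (t, ?x)))^2 \<partial>lborel"
  let ?c = "(cmod hat_mass)\<^sup>2"
  have c: "0 < ?c" using integral_cutoff_hat_nonzero by (simp add: hat_mass_def)
  have "ennreal (cmod (hat_mass * F \<zeta>)) \<le> (\<integral>\<^sup>+t. ennreal (cmod (F (t, ?x))) * ennreal (cmod (kern T (t - fst \<zeta>))) \<partial>lborel)"
    unfolding elim H_def by (rule order_trans[OF ennreal_norm_integral_le]) (simp add: norm_mult ennreal_mult)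
  then have "ennreal (cmod (hat_mass * F \<zeta>))^2 \<le> (\<integral>\<^sup>+t. ennreal (cmod (F (t, ?x))) * ennreal (cmod (kern T (t - fst \<zeta>))) \<partial>lborel)^2"
    by (rule power_mono) simp
  also have "\<dots> \<le> ?I * (\<integral>\<^sup>+t. ennreal (cmod (kern T (t - fst \<zeta>)))^2 \<partial>lborel)"
    by (rule Cauchy_Schwarz_nn_integral) measurable
  also have "\<dots> = ?I * ennreal (T * hat_energy)" by (simp add: nn_integral_kern_square[OF T])
  finally have 1: "ennreal ?c * ennreal (cmod (F \<zeta>))^2 \<le> ?I * ennreal (T * hat_energy)"
    by (simp add: norm_mult power_mult_distrib ennreal_power ennreal_mult')
  have "ennreal (1 / ?c) * (ennreal ?c * ennreal (cmod (F \<zeta>))^2) = ennreal (cmod (F \<zeta>))^2"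
    using c by (simp add: mult.assoc[symmetric] ennreal_mult'[symmetric])
  then have "ennreal (cmod (F \<zeta>))^2 \<le> ennreal (1 / ?c) * (?I * ennreal (T * hat_energy))"
    using mult_left_mono[OF 1, of "ennreal (1 / ?c)"] by simp
  also have "\<dots> = ennreal (T * gain_const) * ?I"
    using T hat_energy_nonneg by (simp add: gain_const_def hat_mass_def mult_ac ennreal_mult''[symmetric] flip: mult.assoc)
  finally have "?w * ennreal (cmod (F \<zeta>))^2 \<le> ?w * (ennreal (T * gain_const) * ?I)" by (intro mult_left_mono) auto
  also have "\<dots> = ennreal (T * gain_const) * (?w * ?I)" by (simp only: mult_ac)
  also have "?w * ?I = (\<integral>\<^sup>+t. A (t, snd \<zeta>) \<partial>lborel)"
    by (subst nn_integral_cmult[symmetric]) (auto simp: A_def power_mult_distrib ennreal_mult' ennreal_power)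
  finally show ?case by (simp add: A_def power_mult_distrib ennreal_mult' ennreal_power)
qed

text \<open>At each frequency the region is an interval of length 2R in \<tau>, on which the
  pointwise bound applies with the mass of the whole slice.\<close>

lemma near_curve:
  assumes R: "0 < R"
  shows "(\<integral>\<^sup>+\<zeta>. A \<zeta> * indicator {\<zeta>. \<bar>fst \<zeta> - snd \<zeta> ^ 3\<bar> < R} \<zeta> \<partial>lborel) \<le> ennreal (2 * R * (T * gain_const)) * (\<integral>\<^sup>+\<zeta>. A \<zeta> \<partial>lborel)"
proof -
  let ?c = "ennreal (T * gain_const)"
  let ?J = "\<lambda>x. \<integral>\<^sup>+t. A (t, x) \<partial>lborel"
  have [measurable]: "{\<zeta>::real\<times>real. \<bar>fst \<zeta> - snd \<zeta> ^ 3\<bar> < R} \<in> sets borel"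
    by measurable
  have J[measurable]: "(\<lambda>\<zeta>. ?J (snd \<zeta>)) \<in> borel_measurable (borel :: (real\<times>real) measure)" by measurable
  have "(\<integral>\<^sup>+\<zeta>. A \<zeta> * indicator {\<zeta>. \<bar>fst \<zeta> - snd \<zeta> ^ 3\<bar> < R} \<zeta> \<partial>lborel)
      \<le> (\<integral>\<^sup>+\<zeta>. (?c * ?J (snd \<zeta>)) * indicator {\<zeta>. \<bar>fst \<zeta> - snd \<zeta> ^ 3\<bar> < R} \<zeta> \<partial>lborel)"
  proof (rule nn_integral_mono_AE)
    show "AE \<zeta> in lborel. A \<zeta> * indicator {\<zeta>. \<bar>fst \<zeta> - snd \<zeta> ^ 3\<bar> < R} \<zeta>
        \<le> (?c * ?J (snd \<zeta>)) * indicator {\<zeta>. \<bar>fst \<zeta> - snd \<zeta> ^ 3\<bar> < R} \<zeta>"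
      using A_pointwise by eventually_elim (rule mult_right_mono, auto)
  qed
  also have "\<dots> = (\<integral>\<^sup>+x. (\<integral>\<^sup>+t. (?c * ?J x) * indicator {x^3 - R<..<x^3 + R} t \<partial>lborel) \<partial>lborel)"
  proof (subst nn_integral_prod_swap)
    show "(\<integral>\<^sup>+x. (\<integral>\<^sup>+t. (?c * ?J (snd (t, x))) * indicator {\<zeta>. \<bar>fst \<zeta> - snd \<zeta> ^ 3\<bar> < R} (t, x) \<partial>lborel) \<partial>lborel)
       = (\<integral>\<^sup>+x. (\<integral>\<^sup>+t. (?c * ?J x) * indicator {x^3 - R<..<x^3 + R} t \<partial>lborel) \<partial>lborel)"
      by (intro nn_integral_cong) (auto simp: indicator_def abs_less_iff)
  qed measurable
  also have "\<dots> = (\<integral>\<^sup>+x. ennreal (2 * R * (T * gain_const)) * ?J x \<partial>lborel)"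
  proof (intro nn_integral_cong)
    fix x :: real
    have "(\<integral>\<^sup>+t. (?c * ?J x) * indicator {x^3 - R<..<x^3 + R} t \<partial>lborel) = (?c * ?J x) * emeasure lborel {x^3 - R<..<x^3 + R}"
      by (rule nn_integral_cmult_indicator) simp
    also have "emeasure lborel {x^3 - R<..<x^3 + R} = ennreal (2 * R)" using R by simp
    finally have eq: "(\<integral>\<^sup>+t. (?c * ?J x) * indicator {x^3 - R<..<x^3 + R} t \<partial>lborel) = (?c * ?J x) * ennreal (2 * R)" .
    show "(\<integral>\<^sup>+t. (?c * ?J x) * indicator {x^3 - R<..<x^3 + R} t \<partial>lborel) = ennreal (2 * R * (T * gain_const)) * ?J x"
    proof -
      have "ennreal (2 * R * (T * gain_const)) = ennreal (2 * R) * ennreal (T * gain_const)"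
        using R by (intro ennreal_mult') simp
      then show ?thesis using eq by (simp only: mult_ac)
    qed
  qed
  also have "\<dots> = ennreal (2 * R * (T * gain_const)) * (\<integral>\<^sup>+x. ?J x \<partial>lborel)" by (rule nn_integral_cmult) measurable
  also have "(\<integral>\<^sup>+x. ?J x \<partial>lborel) = (\<integral>\<^sup>+\<zeta>. A \<zeta> \<partial>lborel)" by (subst nn_integral_prod_swap) auto
  finally show ?thesis .
qed

text \<open>Absorption bounds the mass of \<open>A\<close> by 2/R times its mass weighted by
  \<open>lam\<close>. Splitting lam^(1-2e) at lam = R then gives R^(-2e) once from the high part and
  twice from the low part, hence the constant 3.\<close>

lemma gain:
  assumes e: "0 < e" "e < 1/2"
  defines "R \<equiv> 1 / (4 * (gain_const + 1) * T)"
  shows "(\<integral>\<^sup>+\<zeta>. ennreal (lam \<alpha> \<zeta> powr (1 - 2 * e)) * A \<zeta> \<partial>lborel)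
    \<le> ennreal (3 * R powr (- (2 * e))) * (\<integral>\<^sup>+\<zeta>. ennreal (lam \<alpha> \<zeta>) * A \<zeta> \<partial>lborel)"
proof -
  have g: "0 < gain_const + 1" using gain_const_nonneg by linarith
  have R: "0 < R" using T g by (simp add: R_def)
  let ?Q = "\<integral>\<^sup>+\<zeta>. A \<zeta> \<partial>lborel" let ?X = "\<integral>\<^sup>+\<zeta>. ennreal (lam \<alpha> \<zeta>) * A \<zeta> \<partial>lborel"
  let ?S = "{\<zeta>::real\<times>real. \<bar>fst \<zeta> - snd \<zeta> ^ 3\<bar> < R}"
  have [measurable]: "?S \<in> sets borel" by measurable
  \<comment> \<open>With this \<open>R\<close> the product is 1/2 times a ratio below 1; adding 1 to
    \<open>gain_const\<close> keeps the denominator of \<open>R\<close> positive in every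
    case.\<close>
  have "2 * R * (T * gain_const) = 1/2 * (gain_const / (gain_const + 1))" using T g by (simp add: R_def divide_simps)
  also have "\<dots> \<le> 1/2 * 1" using g gain_const_nonneg by (intro mult_left_mono) (auto simp: divide_simps)
  finally have half: "2 * R * (T * gain_const) \<le> 1/2" by simp
  have "?Q \<le> (\<integral>\<^sup>+\<zeta>. A \<zeta> * indicator ?S \<zeta> + ennreal (1 / R) * (ennreal (lam \<alpha> \<zeta>) * A \<zeta>) \<partial>lborel)"
  proof (intro nn_integral_mono)
    fix \<zeta> :: "real \<times> real"
    show "A \<zeta> \<le> A \<zeta> * indicator ?S \<zeta> + ennreal (1 / R) * (ennreal (lam \<alpha> \<zeta>) * A \<zeta>)"
    proof (cases "\<zeta> \<in> ?S")
      case False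
      then have "R \<le> lam \<alpha> \<zeta>" using abs_le_lam[of \<zeta> \<alpha>] by simp
      then have "1 \<le> ennreal (1 / R) * ennreal (lam \<alpha> \<zeta>)"
        using R by (simp add: ennreal_mult'[symmetric] flip: ennreal_1)
      then have "1 * A \<zeta> \<le> ennreal (1 / R) * ennreal (lam \<alpha> \<zeta>) * A \<zeta>" by (intro mult_right_mono) auto
      then show ?thesis using False by (simp add: mult.assoc)
    qed simp
  qed
  also have "\<dots> = (\<integral>\<^sup>+\<zeta>. A \<zeta> * indicator ?S \<zeta> \<partial>lborel) + ennreal (1 / R) * ?X"
    by (subst nn_integral_add) (auto simp: nn_integral_cmult)
  also have "\<dots> \<le> ennreal (1/2) * ?Q + ennreal (1 / R) * ?X"
    using half by (intro add_right_mono order_trans[OF near_curve[OF R]] mult_right_mono ennreal_leI) auto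
  finally have "?Q \<le> 2 * (ennreal (1 / R) * ?X)"
    using fin by (intro ennreal_absorb) (auto simp: A_def)
  then have Q: "?Q \<le> ennreal (2 / R) * ?X" using R
    by (simp add: mult.assoc[symmetric] ennreal_mult'[symmetric] ennreal_numeral[symmetric] del: ennreal_numeral)
  have "(\<integral>\<^sup>+\<zeta>. ennreal (lam \<alpha> \<zeta> powr (1 - 2 * e)) * A \<zeta> \<partial>lborel)
     \<le> (\<integral>\<^sup>+\<zeta>. ennreal (R powr (-(2 * e))) * (ennreal (lam \<alpha> \<zeta>) * A \<zeta>) + ennreal (R powr (1 - 2 * e)) * A \<zeta> \<partial>lborel)"
  proof (intro nn_integral_mono)
    fix \<zeta>
    let ?l = "lam \<alpha> \<zeta>"
    have l: "0 < ?l" by (rule lam_pos)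
    have "?l powr (1 - 2 * e) \<le> R powr (-(2 * e)) * ?l + R powr (1 - 2 * e)"
    proof (cases "?l \<le> R")
      case True
      then have "?l powr (1 - 2 * e) \<le> R powr (1 - 2 * e)" using e l by (intro powr_mono2) auto
      then show ?thesis using l by (simp add: add_increasing)
    next
      case False
      then have "?l powr (-(2 * e)) \<le> R powr (-(2 * e))" using e R by (intro powr_mono2') auto
      then have "?l powr (-(2 * e)) * ?l \<le> R powr (-(2 * e)) * ?l" using l by (intro mult_right_mono) auto
      moreover have "?l powr (1 - 2 * e) = ?l powr (-(2 * e)) * ?l" using l by (simp add: powr_diff powr_minus divide_simps)
      ultimately show ?thesis by (simp add: add_increasing2)
    qed
    then have "ennreal (?l powr (1 - 2 * e)) \<le> ennreal (R powr (-(2 * e))) * ennreal ?l + ennreal (R powr (1 - 2 * e))"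
      using l by (simp add: ennreal_mult'[symmetric] ennreal_plus[symmetric] del: ennreal_plus)
    then have "ennreal (?l powr (1 - 2 * e)) * A \<zeta> \<le> (ennreal (R powr (-(2 * e))) * ennreal ?l + ennreal (R powr (1 - 2 * e))) * A \<zeta>"
      by (intro mult_right_mono) auto
    then show "ennreal (?l powr (1 - 2 * e)) * A \<zeta> \<le> ennreal (R powr (-(2 * e))) * (ennreal ?l * A \<zeta>) + ennreal (R powr (1 - 2 * e)) * A \<zeta>"
      by (simp add: distrib_right mult.assoc)
  qed
  also have "\<dots> = ennreal (R powr (-(2 * e))) * ?X + ennreal (R powr (1 - 2 * e)) * ?Q"
    by (subst nn_integral_add) (auto simp: nn_integral_cmult)
  also have "\<dots> \<le> ennreal (R powr (-(2 * e))) * ?X + ennreal (R powr (1 - 2 * e)) * (ennreal (2 / R) * ?X)"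
    by (intro add_left_mono mult_left_mono Q) auto
  also have "\<dots> = ennreal (R powr (-(2 * e)) + R powr (1 - 2 * e) * (2 / R)) * ?X"
  proof -
    have nn: "0 \<le> R powr (1 - 2 * e) * (2 / R)" "0 \<le> 2 / R" using R by auto
    then have "ennreal (R powr (-(2 * e)) + R powr (1 - 2 * e) * (2 / R)) = ennreal (R powr (-(2 * e))) + ennreal (R powr (1 - 2 * e)) * ennreal (2 / R)"
      by (simp only: ennreal_plus ennreal_mult powr_ge_zero)
    then show ?thesis by (simp only: distrib_right mult.assoc)
  qed
  also have "R powr (1 - 2 * e) * (2 / R) = 2 * R powr (-(2 * e))" using R by (simp add: powr_diff powr_minus divide_simps)
  finally show ?thesis by simp
qed

end

lemma Xsq_eq: "Xsq \<alpha> b s F = (\<integral>\<^sup>+\<zeta>. ennreal ((lam \<alpha> \<zeta> powr b * jap (snd \<zeta>) powr s * cmod (F \<zeta>))\<^sup>2) \<partial>lborel)"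
  unfolding Xsq_def lam_def jbr_def by simp

lemma time_localization_gain:
  assumes s: "-1 < s" and e: "0 < e" "e < 1/2"
  shows "\<exists>C\<ge>0. \<forall>T>0. \<forall>F. in_X \<alpha> (1/2) s F \<and> time_supp_in T F \<longrightarrow>
      Xsq \<alpha> (1/2 - e) s F \<le> ennreal (C * T powr (2 * e)) * Xsq \<alpha> (1/2) s F"
proof -
  have g: "0 < gain_const + 1" using gain_const_nonneg by linarith
  let ?C = "3 * (4 * (gain_const + 1)) powr (2 * e)"
  have "Xsq \<alpha> (1/2 - e) s F \<le> ennreal (?C * T powr (2 * e)) * Xsq \<alpha> (1/2) s F"
    if T: "0 < T" and X: "in_X \<alpha> (1/2) s F" and supp: "time_supp_in T F" for T F
  proof -
    have F[measurable]: "F \<in> borel_measurable borel" using X by (simp add: in_X_def)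
    have sq: "ennreal ((lam \<alpha> \<zeta> powr b * jap (snd \<zeta>) powr s * cmod (F \<zeta>))\<^sup>2)
        = ennreal (lam \<alpha> \<zeta> powr (2 * b)) * ennreal ((jap (snd \<zeta>) powr s * cmod (F \<zeta>))\<^sup>2)" for b \<zeta>
    proof -
      have "(lam \<alpha> \<zeta> powr b)\<^sup>2 = lam \<alpha> \<zeta> powr (2 * b)" by (simp add: power2_eq_square powr_add[symmetric])
      then show ?thesis by (simp add: power_mult_distrib ennreal_mult'[symmetric] mult.assoc)
    qed
    have half: "Xsq \<alpha> (1/2) s F = (\<integral>\<^sup>+\<zeta>. ennreal (lam \<alpha> \<zeta>) * ennreal ((jap (snd \<zeta>) powr s * cmod (F \<zeta>))\<^sup>2) \<partial>lborel)"
      unfolding Xsq_eq sq using lam_pos[of \<alpha>] by (simp add: less_imp_le)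
    interpret weighted_supp F s T
    proof
      have "(\<integral>\<^sup>+\<zeta>. ennreal ((jap (snd \<zeta>) powr s * cmod (F \<zeta>))\<^sup>2) \<partial>lborel) \<le> Xsq \<alpha> (1/2) s F"
        unfolding half
      proof (intro nn_integral_mono)
        fix \<zeta> :: "real \<times> real"
        have "1 \<le> ennreal (lam \<alpha> \<zeta>)" using lam_ge1[of \<alpha> \<zeta>] by (simp flip: ennreal_1)
        then have "1 * ennreal ((jap (snd \<zeta>) powr s * cmod (F \<zeta>))\<^sup>2) \<le> ennreal (lam \<alpha> \<zeta>) * ennreal ((jap (snd \<zeta>) powr s * cmod (F \<zeta>))\<^sup>2)"
          by (intro mult_right_mono) auto
        then show "ennreal ((jap (snd \<zeta>) powr s * cmod (F \<zeta>))\<^sup>2) \<le> ennreal (lam \<alpha> \<zeta>) * ennreal ((jap (snd \<zeta>) powr s * cmod (F \<zeta>))\<^sup>2)"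
          by simp
      qed
      then show "(\<integral>\<^sup>+\<zeta>. ennreal ((jap (snd \<zeta>) powr s * cmod (F \<zeta>))\<^sup>2) \<partial>lborel) < \<infinity>"
        using X by (auto simp: in_X_def intro: le_less_trans)
    qed (use s T supp in auto)
    have lhs: "Xsq \<alpha> (1/2 - e) s F = (\<integral>\<^sup>+\<zeta>. ennreal (lam \<alpha> \<zeta> powr (1 - 2 * e)) * ennreal ((jap (snd \<zeta>) powr s * cmod (F \<zeta>))\<^sup>2) \<partial>lborel)"
      unfolding Xsq_eq sq by (simp add: right_diff_distrib)
    have c: "3 * (1 / (4 * (gain_const + 1) * T)) powr (- (2 * e)) = ?C * T powr (2 * e)"
      using T g by (simp add: powr_divide powr_minus powr_mult divide_simps)
    show ?thesis using gain[OF e, of \<alpha>] unfolding half lhs A_def c .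
  qed
  then show ?thesis by (intro exI[of _ ?C]) auto
qed

section \<open>The bilinear estimate\<close>

lemma ennreal_add_square_le: "(a + b)\<^sup>2 \<le> 2 * (a\<^sup>2 + b\<^sup>2 :: ennreal)"
proof (cases "a = \<infinity> \<or> b = \<infinity>")
  case True
  then show ?thesis by (auto simp: ennreal_mult_top power2_eq_square)
next
  case False
  obtain x where x: "a = ennreal x" "0 \<le> x" using False by (cases a) auto
  obtain y where y: "b = ennreal y" "0 \<le> y" using False by (cases b) auto
  have "0 \<le> (x - y)\<^sup>2" by simp
  then have "(x + y)\<^sup>2 \<le> 2 * (x\<^sup>2 + y\<^sup>2)" by (simp add: power2_eq_square algebra_simps)
  then have "ennreal ((x + y)\<^sup>2) \<le> ennreal (2 * (x\<^sup>2 + y\<^sup>2))" by (rule ennreal_leI)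
  then show ?thesis using x y by (simp add: ennreal_power[symmetric] ennreal_mult' ennreal_plus)
qed

lemma nn_integral_diff_lborel:
  fixes f :: "'a::euclidean_space \<Rightarrow> ennreal"
  assumes [measurable]: "f \<in> borel_measurable borel"
  shows "(\<integral>\<^sup>+\<eta>. f (\<zeta> - \<eta>) \<partial>lborel) = (\<integral>\<^sup>+\<eta>. f \<eta> \<partial>lborel)"
proof -
  have "lborel = distr lborel borel (\<lambda>\<eta>. \<zeta> - \<eta> :: 'a)"
  proof (rule lborel_eqI)
    fix l u :: 'a assume "\<And>b. b \<in> Basis \<Longrightarrow> l \<bullet> b \<le> u \<bullet> b"
    have "(\<lambda>\<eta>. \<zeta> - \<eta>) -` box l u = box (\<zeta> - u) (\<zeta> - l)"
      by (auto simp: box_def inner_diff_left algebra_simps)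
    moreover have "emeasure lborel (box (\<zeta> - u) (\<zeta> - l)) = (\<Prod>b\<in>Basis. (u - l) \<bullet> b)"
      using \<open>\<And>b. b \<in> Basis \<Longrightarrow> l \<bullet> b \<le> u \<bullet> b\<close> by (subst emeasure_lborel_box) (auto simp: inner_diff_left)
    ultimately show "emeasure (distr lborel borel (\<lambda>\<eta>. \<zeta> - \<eta>)) (box l u) = (\<Prod>b\<in>Basis. (u - l) \<bullet> b)"
      by (subst emeasure_distr) auto
  qed simp
  then have "(\<integral>\<^sup>+\<eta>. f \<eta> \<partial>lborel) = (\<integral>\<^sup>+\<eta>. f \<eta> \<partial>(distr lborel borel (\<lambda>\<eta>. \<zeta> - \<eta>)))" by simp
  also have "\<dots> = (\<integral>\<^sup>+\<eta>. f (\<zeta> - \<eta>) \<partial>lborel)" by (subst nn_integral_distr) auto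
  finally show ?thesis by simp
qed

section \<open>Cauchy-Schwarz criteria for bilinear convolution operators\<close>

context
  fixes f g :: "'a::euclidean_space \<Rightarrow> ennreal" and C :: ennreal
  assumes f[measurable]: "f \<in> borel_measurable borel" and g[measurable]: "g \<in> borel_measurable borel"
begin

lemma nn_integral_conv_squares:
  "(\<integral>\<^sup>+\<zeta>. (\<integral>\<^sup>+\<eta>. (f \<eta>)\<^sup>2 * (g (\<zeta> - \<eta>))\<^sup>2 \<partial>lborel) \<partial>lborel) = (\<integral>\<^sup>+\<eta>. (f \<eta>)\<^sup>2 \<partial>lborel) * (\<integral>\<^sup>+\<eta>. (g \<eta>)\<^sup>2 \<partial>lborel)"
proof -
  have "(\<integral>\<^sup>+\<zeta>. (\<integral>\<^sup>+\<eta>. (f \<eta>)\<^sup>2 * (g (\<zeta> - \<eta>))\<^sup>2 \<partial>lborel) \<partial>lborel) = (\<integral>\<^sup>+\<eta>. (\<integral>\<^sup>+\<zeta>. (f \<eta>)\<^sup>2 * (g (\<zeta> - \<eta>))\<^sup>2 \<partial>lborel) \<partial>lborel)"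
    by (rule lborel_pair.Fubini') measurable
  also have "\<dots> = (\<integral>\<^sup>+\<eta>. (f \<eta>)\<^sup>2 * (\<integral>\<^sup>+\<zeta>. (g \<zeta>)\<^sup>2 \<partial>lborel) \<partial>lborel)"
  proof (intro nn_integral_cong)
    fix \<eta>
    have "(\<integral>\<^sup>+\<zeta>. (f \<eta>)\<^sup>2 * (g (\<zeta> - \<eta>))\<^sup>2 \<partial>lborel) = (f \<eta>)\<^sup>2 * (\<integral>\<^sup>+\<zeta>. (g (\<zeta> - \<eta>))\<^sup>2 \<partial>lborel)"
      by (rule nn_integral_cmult) measurable
    also have "(\<integral>\<^sup>+\<zeta>. (g (\<zeta> - \<eta>))\<^sup>2 \<partial>lborel) = (\<integral>\<^sup>+\<zeta>. (g (0 - (\<eta> - \<zeta>)))\<^sup>2 \<partial>lborel)" by simp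
    also have "\<dots> = (\<integral>\<^sup>+\<zeta>. (g (0 - \<zeta>))\<^sup>2 \<partial>lborel)"
      by (rule nn_integral_diff_lborel[of "\<lambda>\<zeta>. (g (0 - \<zeta>))\<^sup>2" \<eta>]) measurable
    also have "\<dots> = (\<integral>\<^sup>+\<zeta>. (g \<zeta>)\<^sup>2 \<partial>lborel)"
      by (rule nn_integral_diff_lborel[of "\<lambda>\<zeta>. (g \<zeta>)\<^sup>2" 0]) measurable
    finally show "(\<integral>\<^sup>+\<zeta>. (f \<eta>)\<^sup>2 * (g (\<zeta> - \<eta>))\<^sup>2 \<partial>lborel) = (f \<eta>)\<^sup>2 * (\<integral>\<^sup>+\<zeta>. (g \<zeta>)\<^sup>2 \<partial>lborel)" .
  qed
  also have "\<dots> = (\<integral>\<^sup>+\<eta>. (f \<eta>)\<^sup>2 \<partial>lborel) * (\<integral>\<^sup>+\<eta>. (g \<eta>)\<^sup>2 \<partial>lborel)"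
    by (rule nn_integral_multc) measurable
  finally show ?thesis .
qed

text \<open>Cauchy-Schwarz at each output point separates the kernel from the inputs. The squares of
  the inputs then form a convolution, whose total integral factors.\<close>

lemma bilinear_output:
  assumes k[measurable]: "case_prod k \<in> borel_measurable (borel \<Otimes>\<^sub>M borel)"
    and K: "\<And>\<zeta>. (\<integral>\<^sup>+\<eta>. (k \<zeta> \<eta>)\<^sup>2 \<partial>lborel) \<le> C"
  shows "(\<integral>\<^sup>+\<zeta>. (\<integral>\<^sup>+\<eta>. k \<zeta> \<eta> * (f \<eta> * g (\<zeta> - \<eta>)) \<partial>lborel)\<^sup>2 \<partial>lborel) \<le> C * ((\<integral>\<^sup>+\<eta>. (f \<eta>)\<^sup>2 \<partial>lborel) * (\<integral>\<^sup>+\<eta>. (g \<eta>)\<^sup>2 \<partial>lborel))"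
proof -
  have "(\<integral>\<^sup>+\<zeta>. (\<integral>\<^sup>+\<eta>. k \<zeta> \<eta> * (f \<eta> * g (\<zeta> - \<eta>)) \<partial>lborel)\<^sup>2 \<partial>lborel) \<le> (\<integral>\<^sup>+\<zeta>. C * (\<integral>\<^sup>+\<eta>. (f \<eta>)\<^sup>2 * (g (\<zeta> - \<eta>))\<^sup>2 \<partial>lborel) \<partial>lborel)"
  proof (intro nn_integral_mono)
    fix \<zeta>
    have "(\<integral>\<^sup>+\<eta>. k \<zeta> \<eta> * (f \<eta> * g (\<zeta> - \<eta>)) \<partial>lborel)\<^sup>2 \<le> (\<integral>\<^sup>+\<eta>. (k \<zeta> \<eta>)\<^sup>2 \<partial>lborel) * (\<integral>\<^sup>+\<eta>. (f \<eta> * g (\<zeta> - \<eta>))\<^sup>2 \<partial>lborel)"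
      by (rule Cauchy_Schwarz_nn_integral) measurable
    also have "\<dots> \<le> C * (\<integral>\<^sup>+\<eta>. (f \<eta>)\<^sup>2 * (g (\<zeta> - \<eta>))\<^sup>2 \<partial>lborel)"
      unfolding power_mult_distrib by (intro mult_right_mono K) auto
    finally show "(\<integral>\<^sup>+\<eta>. k \<zeta> \<eta> * (f \<eta> * g (\<zeta> - \<eta>)) \<partial>lborel)\<^sup>2 \<le> C * (\<integral>\<^sup>+\<eta>. (f \<eta>)\<^sup>2 * (g (\<zeta> - \<eta>))\<^sup>2 \<partial>lborel)" .
  qed
  also have "\<dots> = C * (\<integral>\<^sup>+\<zeta>. (\<integral>\<^sup>+\<eta>. (f \<eta>)\<^sup>2 * (g (\<zeta> - \<eta>))\<^sup>2 \<partial>lborel) \<partial>lborel)"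
    by (rule nn_integral_cmult) measurable
  finally show ?thesis unfolding nn_integral_conv_squares .
qed

text \<open>Here the kernel is kept with \<open>f\<close> in the Cauchy--Schwarz inequality, so that only its integral in
  the output variable enters.\<close>
lemma bilinear_input:
  assumes k[measurable]: "case_prod k \<in> borel_measurable (borel \<Otimes>\<^sub>M borel)"
    and K: "\<And>\<eta>. (\<integral>\<^sup>+\<zeta>. (k \<zeta> \<eta>)\<^sup>2 \<partial>lborel) \<le> C"
  shows "(\<integral>\<^sup>+\<zeta>. (\<integral>\<^sup>+\<eta>. k \<zeta> \<eta> * (f \<eta> * g (\<zeta> - \<eta>)) \<partial>lborel)\<^sup>2 \<partial>lborel) \<le> C * ((\<integral>\<^sup>+\<eta>. (f \<eta>)\<^sup>2 \<partial>lborel) * (\<integral>\<^sup>+\<eta>. (g \<eta>)\<^sup>2 \<partial>lborel))"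
proof -
  let ?G = "\<integral>\<^sup>+\<eta>. (g \<eta>)\<^sup>2 \<partial>lborel"
  have "(\<integral>\<^sup>+\<zeta>. (\<integral>\<^sup>+\<eta>. k \<zeta> \<eta> * (f \<eta> * g (\<zeta> - \<eta>)) \<partial>lborel)\<^sup>2 \<partial>lborel) \<le> (\<integral>\<^sup>+\<zeta>. (\<integral>\<^sup>+\<eta>. (k \<zeta> \<eta>)\<^sup>2 * (f \<eta>)\<^sup>2 \<partial>lborel) * ?G \<partial>lborel)"
  proof (intro nn_integral_mono)
    fix \<zeta>
    have "(\<integral>\<^sup>+\<eta>. (k \<zeta> \<eta> * f \<eta>) * g (\<zeta> - \<eta>) \<partial>lborel)\<^sup>2 \<le> (\<integral>\<^sup>+\<eta>. (k \<zeta> \<eta> * f \<eta>)\<^sup>2 \<partial>lborel) * (\<integral>\<^sup>+\<eta>. (g (\<zeta> - \<eta>))\<^sup>2 \<partial>lborel)"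
      by (rule Cauchy_Schwarz_nn_integral) measurable
    also have "(\<integral>\<^sup>+\<eta>. (g (\<zeta> - \<eta>))\<^sup>2 \<partial>lborel) = ?G"
      by (rule nn_integral_diff_lborel[of "\<lambda>\<eta>. (g \<eta>)\<^sup>2"]) measurable
    finally show "(\<integral>\<^sup>+\<eta>. k \<zeta> \<eta> * (f \<eta> * g (\<zeta> - \<eta>)) \<partial>lborel)\<^sup>2 \<le> (\<integral>\<^sup>+\<eta>. (k \<zeta> \<eta>)\<^sup>2 * (f \<eta>)\<^sup>2 \<partial>lborel) * ?G"
      by (simp only: power_mult_distrib mult.assoc)
  qed
  also have "\<dots> = (\<integral>\<^sup>+\<zeta>. (\<integral>\<^sup>+\<eta>. (k \<zeta> \<eta>)\<^sup>2 * (f \<eta>)\<^sup>2 \<partial>lborel) \<partial>lborel) * ?G"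
    by (rule nn_integral_multc) measurable
  also have "(\<integral>\<^sup>+\<zeta>. (\<integral>\<^sup>+\<eta>. (k \<zeta> \<eta>)\<^sup>2 * (f \<eta>)\<^sup>2 \<partial>lborel) \<partial>lborel) = (\<integral>\<^sup>+\<eta>. (\<integral>\<^sup>+\<zeta>. (k \<zeta> \<eta>)\<^sup>2 * (f \<eta>)\<^sup>2 \<partial>lborel) \<partial>lborel)"
    by (rule lborel_pair.Fubini') measurable
  also have "\<dots> = (\<integral>\<^sup>+\<eta>. (\<integral>\<^sup>+\<zeta>. (k \<zeta> \<eta>)\<^sup>2 \<partial>lborel) * (f \<eta>)\<^sup>2 \<partial>lborel)"
    by (intro nn_integral_cong nn_integral_multc) measurable
  also have "\<dots> \<le> (\<integral>\<^sup>+\<eta>. C * (f \<eta>)\<^sup>2 \<partial>lborel)" by (intro nn_integral_mono mult_right_mono K) auto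
  also have "\<dots> = C * (\<integral>\<^sup>+\<eta>. (f \<eta>)\<^sup>2 \<partial>lborel)" by (rule nn_integral_cmult) measurable
  finally show ?thesis by (simp add: mult.assoc mult_right_mono)
qed

end

lemma nn_integral_conv_swap:
  fixes f g :: "'a::euclidean_space \<Rightarrow> ennreal"
  assumes [measurable]: "f \<in> borel_measurable borel" "g \<in> borel_measurable borel" "k \<in> borel_measurable borel"
  shows "(\<integral>\<^sup>+\<eta>. k (\<zeta> - \<eta>) * (f \<eta> * g (\<zeta> - \<eta>)) \<partial>lborel) = (\<integral>\<^sup>+\<eta>. k \<eta> * (g \<eta> * f (\<zeta> - \<eta>)) \<partial>lborel)"
  using nn_integral_diff_lborel[of "\<lambda>\<eta>. k \<eta> * (g \<eta> * f (\<zeta> - \<eta>))" \<zeta>] by (simp add: mult_ac)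

text \<open>One uniform bound on \<open>k\<close> serves all four terms: \<open>k\<close> falls
  under the output criterion, its transpose under the input criterion, and the terms with \<zeta> -
  \<eta> under the same two after exchanging \<open>f\<close> and \<open>g\<close>. The 16 is the
  factor 4 from squaring a sum of four terms, times four equal bounds.\<close>

lemma bilinear_symmetric:
  fixes f g :: "'a::euclidean_space \<Rightarrow> ennreal"
  assumes f[measurable]: "f \<in> borel_measurable borel" and g[measurable]: "g \<in> borel_measurable borel"
    and k[measurable]: "case_prod k \<in> borel_measurable (borel \<Otimes>\<^sub>M borel)"
    and K: "\<And>\<zeta>. (\<integral>\<^sup>+\<eta>. (k \<zeta> \<eta>)\<^sup>2 \<partial>lborel) \<le> C"
  shows "(\<integral>\<^sup>+\<zeta>. (\<integral>\<^sup>+\<eta>. (k \<zeta> \<eta> + k \<eta> \<zeta> + (k \<zeta> (\<zeta> - \<eta>) + k (\<zeta> - \<eta>) \<zeta>)) * (f \<eta> * g (\<zeta> - \<eta>)) \<partial>lborel)\<^sup>2 \<partial>lborel)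
    \<le> 16 * C * ((\<integral>\<^sup>+\<eta>. (f \<eta>)\<^sup>2 \<partial>lborel) * (\<integral>\<^sup>+\<eta>. (g \<eta>)\<^sup>2 \<partial>lborel))"
proof -
  let ?N = "(\<integral>\<^sup>+\<eta>. (f \<eta>)\<^sup>2 \<partial>lborel) * (\<integral>\<^sup>+\<eta>. (g \<eta>)\<^sup>2 \<partial>lborel)"
  have [measurable]: "(\<lambda>(\<zeta>, \<eta>). k \<eta> \<zeta>) \<in> borel_measurable (borel \<Otimes>\<^sub>M borel)" by measurable
  have [measurable]: "k \<zeta> \<in> borel_measurable borel" "(\<lambda>\<eta>. k \<eta> \<zeta>) \<in> borel_measurable borel" for \<zeta> by measurable
  let ?a = "\<lambda>f g \<zeta>. \<integral>\<^sup>+\<eta>. k \<zeta> \<eta> * (f \<eta> * g (\<zeta> - \<eta>)) \<partial>lborel"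
  let ?b = "\<lambda>f g \<zeta>. \<integral>\<^sup>+\<eta>. k \<eta> \<zeta> * (f \<eta> * g (\<zeta> - \<eta>)) \<partial>lborel"
  have a: "(\<integral>\<^sup>+\<zeta>. (?a f g \<zeta>)\<^sup>2 \<partial>lborel) \<le> C * ?N" "(\<integral>\<^sup>+\<zeta>. (?a g f \<zeta>)\<^sup>2 \<partial>lborel) \<le> C * ?N"
    using bilinear_output[OF f g k K] bilinear_output[OF g f k K] by (simp_all only: mult.commute[of "\<integral>\<^sup>+\<eta>. (g \<eta>)\<^sup>2 \<partial>lborel"])
  have b: "(\<integral>\<^sup>+\<zeta>. (?b f g \<zeta>)\<^sup>2 \<partial>lborel) \<le> C * ?N" "(\<integral>\<^sup>+\<zeta>. (?b g f \<zeta>)\<^sup>2 \<partial>lborel) \<le> C * ?N"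
    using bilinear_input[OF f g, of "\<lambda>\<zeta> \<eta>. k \<eta> \<zeta>" C] bilinear_input[OF g f, of "\<lambda>\<zeta> \<eta>. k \<eta> \<zeta>" C] K
    by (simp_all add: mult.commute[of "\<integral>\<^sup>+\<eta>. (g \<eta>)\<^sup>2 \<partial>lborel"])
  have "(\<integral>\<^sup>+\<eta>. (k \<zeta> \<eta> + k \<eta> \<zeta> + (k \<zeta> (\<zeta> - \<eta>) + k (\<zeta> - \<eta>) \<zeta>)) * (f \<eta> * g (\<zeta> - \<eta>)) \<partial>lborel)
      = (?a f g \<zeta> + ?b f g \<zeta>) + (?a g f \<zeta> + ?b g f \<zeta>)" for \<zeta>
  proof -
    have e: "(k \<zeta> \<eta> + k \<eta> \<zeta> + (k \<zeta> (\<zeta> - \<eta>) + k (\<zeta> - \<eta>) \<zeta>)) * (f \<eta> * g (\<zeta> - \<eta>))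
      = (k \<zeta> \<eta> * (f \<eta> * g (\<zeta> - \<eta>)) + k \<eta> \<zeta> * (f \<eta> * g (\<zeta> - \<eta>)))
        + (k \<zeta> (\<zeta> - \<eta>) * (f \<eta> * g (\<zeta> - \<eta>)) + k (\<zeta> - \<eta>) \<zeta> * (f \<eta> * g (\<zeta> - \<eta>)))" for \<eta>
      by (simp only: distrib_right)
    have [measurable]: "(\<lambda>\<eta>. k \<zeta> (\<zeta> - \<eta>)) \<in> borel_measurable borel" "(\<lambda>\<eta>. k (\<zeta> - \<eta>) \<zeta>) \<in> borel_measurable borel"
      by measurable
    have s: "?a g f \<zeta> = (\<integral>\<^sup>+\<eta>. k \<zeta> (\<zeta> - \<eta>) * (f \<eta> * g (\<zeta> - \<eta>)) \<partial>lborel)"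
      "?b g f \<zeta> = (\<integral>\<^sup>+\<eta>. k (\<zeta> - \<eta>) \<zeta> * (f \<eta> * g (\<zeta> - \<eta>)) \<partial>lborel)"
      using nn_integral_conv_swap[of f g "k \<zeta>" \<zeta>] nn_integral_conv_swap[of f g "\<lambda>\<eta>. k \<eta> \<zeta>" \<zeta>] by simp_all
    show ?thesis unfolding e s
      by (subst nn_integral_add, measurable, subst (1 2) nn_integral_add) auto
  qed
  then have "(\<integral>\<^sup>+\<zeta>. (\<integral>\<^sup>+\<eta>. (k \<zeta> \<eta> + k \<eta> \<zeta> + (k \<zeta> (\<zeta> - \<eta>) + k (\<zeta> - \<eta>) \<zeta>)) * (f \<eta> * g (\<zeta> - \<eta>)) \<partial>lborel)\<^sup>2 \<partial>lborel)
     = (\<integral>\<^sup>+\<zeta>. ((?a f g \<zeta> + ?b f g \<zeta>) + (?a g f \<zeta> + ?b g f \<zeta>))\<^sup>2 \<partial>lborel)" by simp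
  also have "\<dots> \<le> (\<integral>\<^sup>+\<zeta>. 4 * (((?a f g \<zeta>)\<^sup>2 + (?b f g \<zeta>)\<^sup>2) + ((?a g f \<zeta>)\<^sup>2 + (?b g f \<zeta>)\<^sup>2)) \<partial>lborel)"
  proof (intro nn_integral_mono)
    fix \<zeta>
    have "((?a f g \<zeta> + ?b f g \<zeta>) + (?a g f \<zeta> + ?b g f \<zeta>))\<^sup>2 \<le> 2 * ((?a f g \<zeta> + ?b f g \<zeta>)\<^sup>2 + (?a g f \<zeta> + ?b g f \<zeta>)\<^sup>2)"
      by (rule ennreal_add_square_le)
    also have "\<dots> \<le> 2 * (2 * ((?a f g \<zeta>)\<^sup>2 + (?b f g \<zeta>)\<^sup>2) + 2 * ((?a g f \<zeta>)\<^sup>2 + (?b g f \<zeta>)\<^sup>2))"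
      by (intro mult_left_mono add_mono ennreal_add_square_le) auto
    also have "\<dots> = 4 * (((?a f g \<zeta>)\<^sup>2 + (?b f g \<zeta>)\<^sup>2) + ((?a g f \<zeta>)\<^sup>2 + (?b g f \<zeta>)\<^sup>2))"
      by (simp only: distrib_left mult.assoc[symmetric]) simp
    finally show "((?a f g \<zeta> + ?b f g \<zeta>) + (?a g f \<zeta> + ?b g f \<zeta>))\<^sup>2 \<le> 4 * (((?a f g \<zeta>)\<^sup>2 + (?b f g \<zeta>)\<^sup>2) + ((?a g f \<zeta>)\<^sup>2 + (?b g f \<zeta>)\<^sup>2))" .
  qed
  also have "\<dots> = 4 * (((\<integral>\<^sup>+\<zeta>. (?a f g \<zeta>)\<^sup>2 \<partial>lborel) + (\<integral>\<^sup>+\<zeta>. (?b f g \<zeta>)\<^sup>2 \<partial>lborel)) + ((\<integral>\<^sup>+\<zeta>. (?a g f \<zeta>)\<^sup>2 \<partial>lborel) + (\<integral>\<^sup>+\<zeta>. (?b g f \<zeta>)\<^sup>2 \<partial>lborel)))"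
    by (subst nn_integral_cmult, measurable, subst nn_integral_add, measurable, subst (1 2) nn_integral_add) auto
  also have "\<dots> \<le> 4 * ((C * ?N + C * ?N) + (C * ?N + C * ?N))" by (intro mult_left_mono add_mono a b) auto
  also have "\<dots> = 16 * C * ?N" by (simp only: mult_2[symmetric] mult.assoc[symmetric]) simp
  finally show ?thesis .
qed

text \<open>Both branches of \<open>s_alpha\<close> are the single equation \<sigma> (4 - 2\<beta>)
  = 3 for \<sigma> = -\<open>s_alpha \<alpha>\<close>. Any \<rho> strictly between 1/2 and \<sigma>
  leaves room in every condition at \<kappa> = 0, and \<kappa> is then chosen small.\<close>

lemma exists_exponents:
  assumes "0 < \<alpha>" "\<alpha> \<le> 1" "s_alpha \<alpha> < s"
  shows "\<exists>\<rho> \<kappa>. exponents \<alpha> \<rho> \<kappa> (max (\<alpha> - 1/2) 0) (1 + \<kappa>/8) \<and> - \<rho> \<le> s"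
proof -
  define \<beta> where "\<beta> = max (\<alpha> - 1/2) 0"
  define \<sigma> where "\<sigma> = - s_alpha \<alpha>"
  have \<beta>: "0 \<le> \<beta>" "\<beta> \<le> 1/2" using assms by (auto simp: \<beta>_def max_def)
  have \<sigma>: "3/4 \<le> \<sigma>" "\<sigma> \<le> 1" "\<sigma> * (4 - 2 * \<beta>) = 3" "2 * \<sigma> \<le> 3/2 + \<alpha>"
  proof -
    have "3/4 \<le> \<sigma> \<and> \<sigma> \<le> 1 \<and> \<sigma> * (4 - 2 * \<beta>) = 3 \<and> 2 * \<sigma> \<le> 3/2 + \<alpha>"
    proof (cases "\<alpha> \<le> 1/2")
      case True
      then show ?thesis using assms by (simp add: \<sigma>_def \<beta>_def s_alpha_def max_def)
    next
      case False
      then have d: "3 \<le> 5 - 2 * \<alpha>" "5 - 2 * \<alpha> \<le> 4" "\<beta> = \<alpha> - 1/2" and sg: "\<sigma> = 3 / (5 - 2 * \<alpha>)"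
        using assms by (auto simp: \<sigma>_def \<beta>_def s_alpha_def)
      have "0 \<le> \<alpha> * (1 - \<alpha>)" using assms by (intro mult_nonneg_nonneg) auto
      then have "6 \<le> (3/2 + \<alpha>) * (5 - 2 * \<alpha>)" by (simp add: algebra_simps)
      then show ?thesis unfolding sg using d by (simp add: field_simps)
    qed
    then show "3/4 \<le> \<sigma>" "\<sigma> \<le> 1" "\<sigma> * (4 - 2 * \<beta>) = 3" "2 * \<sigma> \<le> 3/2 + \<alpha>" by auto
  qed
  \<comment> \<open>At least -s, as required for -\<rho> \<le> s, and at least the midpoint of 1/2
    and \<sigma>, so that \<rho> > 1/2 even when s is large.\<close>
  define \<rho> where "\<rho> = max (- s) ((\<sigma> + 1/2) / 2)"
  have \<rho>: "1/2 < \<rho>" "\<rho> < \<sigma>" "- \<rho> \<le> s" using \<sigma> assms by (auto simp: \<rho>_def \<sigma>_def max_def field_simps)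
  have gap: "\<rho> * (4 - 2 * \<beta>) < 3"
  proof -
    have "\<rho> * (4 - 2 * \<beta>) < \<sigma> * (4 - 2 * \<beta>)" using \<rho> \<beta> by (intro mult_strict_right_mono) auto
    then show ?thesis using \<sigma> by simp
  qed
  \<comment> \<open>Besides 1/2, which keeps \<kappa> below 1, these are the gaps in the conditions
    at \<kappa> = 0, with \<alpha> standing for 2\<alpha>. The division by 3 below covers the
    largest coefficient of \<kappa>, since \<beta>\<kappa> \<le> \<kappa>/2.\<close>
  define S where "S = {1/2, 2*\<rho> - 1, 2 - 2*\<rho>, 3/2 + \<alpha> - 2*\<rho>, 3 - \<rho> * (4 - 2 * \<beta>), \<alpha>}"
  define \<kappa> where "\<kappa> = Min S / 3"
  have S: "finite S" "S \<noteq> {}" "\<And>t. t \<in> S \<Longrightarrow> 0 < t"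
    using \<rho> \<sigma> gap assms by (auto simp: S_def)
  then have k0: "0 < \<kappa>" by (simp add: \<kappa>_def)
  have le: "3 * \<kappa> \<le> t" if "t \<in> S" for t using Min_le[OF S(1) that] by (simp add: \<kappa>_def)
  have k: "3 * \<kappa> \<le> 1/2" "3 * \<kappa> \<le> 2*\<rho> - 1" "3 * \<kappa> \<le> 2 - 2*\<rho>" "3 * \<kappa> \<le> 3/2 + \<alpha> - 2*\<rho>"
     "3 * \<kappa> \<le> 3 - \<rho> * (4 - 2 * \<beta>)" "3 * \<kappa> \<le> \<alpha>"
    by (rule le, simp add: S_def)+
  have bk: "\<beta> * \<kappa> \<le> 1/2 * \<kappa>" using \<beta> k0 by (intro mult_right_mono) auto
  have k5: "3 * \<kappa> \<le> 3 - 4 * \<rho> + 2 * (\<beta> * \<rho>)" using k(5) by (simp add: algebra_simps)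
  have ex1: "\<beta> * (\<kappa> - 2*\<rho>) = \<beta> * \<kappa> - 2 * (\<beta> * \<rho>)" and ex2: "\<beta> * (2 - 2*\<rho>) = 2 * \<beta> - 2 * (\<beta> * \<rho>)"
    by (simp_all add: algebra_simps)
  have "exponents \<alpha> \<rho> \<kappa> (max (\<alpha> - 1/2) 0) (1 + \<kappa>/8)"
    unfolding \<beta>_def[symmetric]
  proof
    show "4*\<rho> - 3 + 2*\<kappa> + \<beta>*(\<kappa> - 2*\<rho>) \<le> 0" using k5 bk k0 unfolding ex1 by linarith
    \<comment> \<open>Substituting \<alpha> = \<beta> + 1/2 gives the inequality just proved:
      \<beta> is the exponent of the threshold at which the two bounds balance.\<close>
    show "\<beta> = 0 \<or> \<beta>*(2 - 2*\<rho>) + 4*\<rho> - 2 + 2*\<kappa> + \<beta>*\<kappa> \<le> 2*\<alpha>"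
    proof (cases "\<beta> = 0")
      case False
      then have "\<alpha> = \<beta> + 1/2" by (auto simp: \<beta>_def max_def split: if_splits)
      then show ?thesis using k5 bk k0 unfolding ex2 by linarith
    qed simp
    show "2*\<kappa> + \<beta>*\<kappa> \<le> 2*\<alpha>" using k(6) bk k0 assms by linarith
  qed (use assms \<rho> \<sigma> k k0 in \<open>auto simp: \<beta>_def\<close>)
  then show ?thesis using \<rho> by blast
qed

text \<open>In the application p < 1 < r. Each smaller modulation borrows a factor l^(r-p) from the
  largest one, which makes the pair integrable at the price of weakening l^(-p) to
  l^(\<kappa>-1).\<close>

lemma modulation_redistribute:
  fixes l l1 l2 :: real
  assumes "1 \<le> l1" "1 \<le> l2" "l1 \<le> l" "l2 \<le> l" and p: "p \<le> r" and k: "\<kappa> - 1 = - p + 2 * (r - p)"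
  shows "(l * l1 * l2) powr (-p) \<le> l powr (\<kappa> - 1) * (l1 * l2) powr (-r)"
proof -
  have l: "1 \<le> l" using assms by linarith
  have *: "x powr (-p) \<le> l powr (r - p) * x powr (-r)" if "1 \<le> x" "x \<le> l" for x
  proof -
    have "x powr (-p) = x powr (r - p) * x powr (-r)" by (simp flip: powr_add)
    also have "\<dots> \<le> l powr (r - p) * x powr (-r)" using that p by (intro mult_right_mono powr_mono2) auto
    finally show ?thesis .
  qed
  have "(l * l1 * l2) powr (-p) = l powr (-p) * l1 powr (-p) * l2 powr (-p)" using assms l by (intro powr_mult3) auto
  also have "\<dots> \<le> l powr (-p) * (l powr (r - p) * l1 powr (-r)) * (l powr (r - p) * l2 powr (-r))"
    using assms by (intro mult_mono * mult_nonneg_nonneg) auto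
  also have "\<dots> = (l powr (-p) * l powr (r - p) * l powr (r - p)) * (l1 powr (-r) * l2 powr (-r))" by (simp only: mult_ac)
  also have "l powr (-p) * l powr (r - p) * l powr (r - p) = l powr (\<kappa> - 1)"
    unfolding k by (simp flip: powr_add)
  also have "l1 powr (-r) * l2 powr (-r) = (l1 * l2) powr (-r)" using assms by (simp add: powr_mult)
  finally show ?thesis .
qed

section \<open>The squared kernel and its majorant\<close>

context exponents begin

text \<open>The sum of the Jacobian weight, the degenerate weight and the low-frequency weight, each
  with uniformly bounded integral in \<eta>. The last carries a single modulation, the other having
  been cancelled by dissipation.\<close>

definition mker :: "real \<times> real \<Rightarrow> real \<times> real \<Rightarrow> real" where
  "mker \<zeta> \<eta> = \<bar>snd \<zeta>\<bar> * \<bar>2 * snd \<eta> - snd \<zeta>\<bar> * (lam \<alpha> \<eta> * lam \<alpha> (\<zeta> - \<eta>)) powr (-r)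
     + sqrt \<bar>snd \<zeta>\<bar> * ((lam \<alpha> \<eta> * lam \<alpha> (\<zeta> - \<eta>)) powr (-r) * sqrt (max (lam \<alpha> \<eta>) (lam \<alpha> (\<zeta> - \<eta>))))
     + lowf (snd \<zeta>) (snd \<eta>) * lam \<alpha> (\<zeta> - \<eta>) powr (-r)"

lemma mker_parts_nonneg:
  "0 \<le> \<bar>snd \<zeta>\<bar> * \<bar>2 * snd \<eta> - snd \<zeta>\<bar> * (lam \<alpha> \<eta> * lam \<alpha> (\<zeta> - \<eta>)) powr (-r)"
  "0 \<le> sqrt \<bar>snd \<zeta>\<bar> * ((lam \<alpha> \<eta> * lam \<alpha> (\<zeta> - \<eta>)) powr (-r) * sqrt (max (lam \<alpha> \<eta>) (lam \<alpha> (\<zeta> - \<eta>))))"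
  "0 \<le> lowf (snd \<zeta>) (snd \<eta>) * lam \<alpha> (\<zeta> - \<eta>) powr (-r)"
  using lowf_nonneg[of "snd \<zeta>" "snd \<eta>"] lam_pos[of \<alpha> \<eta>] by (auto intro!: mult_nonneg_nonneg simp: max_def)

lemma mker_nonneg: "0 \<le> mker \<zeta> \<eta>"
  unfolding mker_def by (intro add_nonneg_nonneg mker_parts_nonneg)

lemma mker_measurable [measurable]: "case_prod mker \<in> borel_measurable (borel \<Otimes>\<^sub>M borel)"
proof -
  have [measurable]: "(\<lambda>z. lowf (f z) (g z)) \<in> borel_measurable M"
    if [measurable]: "f \<in> borel_measurable M" "g \<in> borel_measurable M" for f g :: "'z \<Rightarrow> real" and M
    unfolding lowf_def by measurable
  show ?thesis unfolding mker_def by measurable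
qed

lemma mker_bound: "\<exists>C\<ge>0. \<forall>\<zeta>. (\<integral>\<^sup>+\<eta>. ennreal (mker \<zeta> \<eta>) \<partial>lborel) \<le> ennreal C"
proof -
  define C1 where "C1 = 4 powr r * (2 * (2 powr r * (2 / (r - 1)))) * (2 / (r - 1))"
  define C2 where "C2 = 4 powr r * (2 * (2 powr r * (2 / (r - 1)))) * (2 powr (r - 1/2) * (4 / (2 * (r - 1/2) - 1)))"
  define C3 where "C3 = 2 powr r * (2 / (r - 1)) * (2 / \<kappa>)"
  have C: "0 \<le> C1" "0 \<le> C2" "0 \<le> C3" using r1 kap by (auto simp: C1_def C2_def C3_def)
  note b = nn_integral_kernel_weighted[OF r1, of _ \<alpha>, folded C1_def] nn_integral_kernel_sqrt[OF r1, of _ \<alpha>, folded C2_def]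
    nn_integral_kernel_low[folded C3_def]
  have "(\<integral>\<^sup>+\<eta>. ennreal (mker \<zeta> \<eta>) \<partial>lborel) \<le> ennreal (C1 + C2 + C3)" for \<zeta>
  proof -
    have [measurable]: "(\<lambda>\<eta>. lowf (snd \<zeta>) (snd \<eta>)) \<in> borel_measurable (borel :: (real \<times> real) measure)"
      by (rule measurable_compose[OF borel_fst_snd(2) lowf_measurable])
    have "(\<integral>\<^sup>+\<eta>. ennreal (mker \<zeta> \<eta>) \<partial>lborel) =
      (\<integral>\<^sup>+\<eta>. ennreal (\<bar>snd \<zeta>\<bar> * \<bar>2 * snd \<eta> - snd \<zeta>\<bar> * (lam \<alpha> \<eta> * lam \<alpha> (\<zeta> - \<eta>)) powr (-r)) \<partial>lborel)
      + (\<integral>\<^sup>+\<eta>. ennreal (sqrt \<bar>snd \<zeta>\<bar> * ((lam \<alpha> \<eta> * lam \<alpha> (\<zeta> - \<eta>)) powr (-r) * sqrt (max (lam \<alpha> \<eta>) (lam \<alpha> (\<zeta> - \<eta>))))) \<partial>lborel)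
      + (\<integral>\<^sup>+\<eta>. ennreal (lowf (snd \<zeta>) (snd \<eta>) * lam \<alpha> (\<zeta> - \<eta>) powr (-r)) \<partial>lborel)"
      unfolding mker_def
      by (simp only: ennreal_plus mker_parts_nonneg add_nonneg_nonneg)
         (subst nn_integral_add, measurable, subst nn_integral_add, measurable)
    also have "\<dots> \<le> ennreal C1 + ennreal C2 + ennreal C3" by (intro add_mono b)
    also have "\<dots> = ennreal (C1 + C2 + C3)" using C by simp
    finally show ?thesis .
  qed
  then show ?thesis using C by (intro exI[of _ "C1 + C2 + C3"]) auto
qed

text \<open>The square of the bilinear multiplier when all three modulation exponents equal p/2 and
  s = -\<rho>.\<close>

definition fker :: "real \<Rightarrow> real \<times> real \<Rightarrow> real \<times> real \<Rightarrow> real" where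
  "fker p \<zeta> \<eta> = wgt (snd \<zeta>) (snd \<eta>) (snd (\<zeta> - \<eta>)) * (lam \<alpha> \<zeta> * lam \<alpha> \<eta> * lam \<alpha> (\<zeta> - \<eta>)) powr (-p)"

text \<open>The ordering decides which point is outer: \<zeta> if the output modulation is largest,
  with \<eta> the input of larger frequency, or \<eta> if its own modulation is largest. Up to
  exchanging \<eta> and \<zeta> - \<eta> one of the two always occurs.\<close>

lemma fker_bound_ordered:
  assumes y: "snd \<eta> \<noteq> 0" and p: "p \<le> r" and k: "\<kappa> - 1 = - p + 2 * (r - p)"
    and ord: "(lam \<alpha> \<eta> \<le> lam \<alpha> \<zeta> \<and> lam \<alpha> (\<zeta> - \<eta>) \<le> lam \<alpha> \<zeta> \<and> \<bar>snd (\<zeta> - \<eta>)\<bar> \<le> \<bar>snd \<eta>\<bar>) \<or>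
      (lam \<alpha> \<zeta> \<le> lam \<alpha> \<eta> \<and> lam \<alpha> (\<zeta> - \<eta>) \<le> lam \<alpha> \<eta>)"
  shows "fker p \<zeta> \<eta> \<le> 1000000 * (mker \<zeta> \<eta> + mker \<eta> \<zeta>)"
proof -
  define x y z where xyz: "x = snd \<zeta>" "y = snd \<eta>" "z = snd (\<zeta> - \<eta>)"
  define l l1 l2 where ls: "l = lam \<alpha> \<zeta>" "l1 = lam \<alpha> \<eta>" "l2 = lam \<alpha> (\<zeta> - \<eta>)"
  have x: "x = y + z" and y0: "y \<noteq> 0" using y by (auto simp: xyz)
  have ge: "1 \<le> l" "1 \<le> l1" "1 \<le> l2" by (auto simp: ls lam_ge1)
  have res: "\<bar>x * y * z\<bar> \<le> max l (max l1 l2)" unfolding xyz ls by (rule resonance_le_max)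
  have pw: "\<bar>y\<bar> powr (2*\<alpha>) \<le> l1" "\<bar>x\<bar> powr (2*\<alpha>) \<le> l" unfolding xyz ls by (rule powr_le_lam)+
  have sym: "lam \<alpha> (\<eta> - \<zeta>) = l2" by (simp add: ls lam_diff_commute)
  have m1: "mker \<zeta> \<eta> = \<bar>x\<bar> * \<bar>y - z\<bar> * (l1 * l2) powr (-r) + sqrt \<bar>x\<bar> * ((l1 * l2) powr (-r) * sqrt (max l1 l2)) + lowf x y * l2 powr (-r)"
  proof -
    have "2 * y - x = y - z" using x by simp
    then show ?thesis by (simp add: mker_def xyz ls)
  qed
  have m2: "mker \<eta> \<zeta> = \<bar>y\<bar> * \<bar>x + z\<bar> * (l * l2) powr (-r) + sqrt \<bar>y\<bar> * ((l * l2) powr (-r) * sqrt (max l l2)) + lowf y x * l2 powr (-r)"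
  proof -
    have "2 * x - y = x + z" using x by simp
    then show ?thesis unfolding mker_def sym by (simp add: xyz ls)
  qed
  \<comment> \<open>The r-th power supplied by dissipation removes one modulation completely and
    leaves the single power in the last term of \<open>mker\<close>.\<close>
  have cancel: "a powr r * (a * l2) powr (-r) = l2 powr (-r)" if "1 \<le> a" for a
  proof -
    have "a powr r * (a powr (-r) * l2 powr (-r)) = (a powr r * a powr (-r)) * l2 powr (-r)" by simp
    also have "a powr r * a powr (-r) = 1" using that by (simp flip: powr_add)
    finally show ?thesis using that ge by (simp add: powr_mult)
  qed
  note parts = mker_parts_nonneg[of \<zeta> \<eta>] mker_parts_nonneg[of \<eta> \<zeta>]
  show ?thesis
  proof (cases "l1 \<le> l \<and> l2 \<le> l \<and> \<bar>z\<bar> \<le> \<bar>y\<bar>")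
    case True
    have "fker p \<zeta> \<eta> \<le> wgt x y z * (l powr (\<kappa> - 1) * (l1 * l2) powr (-r))"
      unfolding fker_def xyz[symmetric] ls[symmetric] using True ge p k
      by (intro mult_left_mono modulation_redistribute wgt_nonneg) auto
    also have "\<dots> = (wgt x y z * l powr (\<kappa> - 1)) * (l1 * l2) powr (-r)" by simp
    also have "\<dots> \<le> (1000000 * (\<bar>x\<bar> * \<bar>y - z\<bar> + sqrt \<bar>x\<bar> * sqrt (max l1 l2) + (lowf x y + lowf y x) * l1 powr r)) * (l1 * l2) powr (-r)"
      using True res ge pw x y0 by (intro mult_right_mono weight_bound_output) auto
    also have "\<dots> = 1000000 * (\<bar>x\<bar> * \<bar>y - z\<bar> * (l1 * l2) powr (-r) + sqrt \<bar>x\<bar> * ((l1 * l2) powr (-r) * sqrt (max l1 l2))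
        + (lowf x y + lowf y x) * (l1 powr r * (l1 * l2) powr (-r)))" by (simp only: distrib_left distrib_right mult_ac)
    also have "\<dots> = 1000000 * (mker \<zeta> \<eta> + lowf y x * l2 powr (-r))"
      unfolding m1 cancel[OF ge(2)] by (simp only: distrib_right add_ac)
    \<comment> \<open>The remaining \<open>lowf y x\<close> term is the low-frequency part of the
      transposed kernel, whose modulation at \<eta> - \<zeta> is again \<open>l2\<close>.\<close>
    also have "\<dots> \<le> 1000000 * (mker \<zeta> \<eta> + mker \<eta> \<zeta>)"
      using parts(4,5) unfolding m2 sym by (intro mult_left_mono add_left_mono) (auto simp: xyz ls)
    finally show ?thesis .
  next
    case False
    then have o: "l \<le> l1" "l2 \<le> l1" using ord by (auto simp: xyz ls)
    have "fker p \<zeta> \<eta> \<le> wgt x y z * (l1 powr (\<kappa> - 1) * (l * l2) powr (-r))"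
      unfolding fker_def xyz[symmetric] ls[symmetric] mult.commute[of l l1] using o ge p k
      by (intro mult_left_mono modulation_redistribute wgt_nonneg) auto
    also have "\<dots> = (wgt x y z * l1 powr (\<kappa> - 1)) * (l * l2) powr (-r)" by simp
    also have "\<dots> \<le> (1000000 * (\<bar>y\<bar> * \<bar>x + z\<bar> + sqrt \<bar>y\<bar> * sqrt (max l l2) + lowf x y * l powr r)) * (l * l2) powr (-r)"
      using o res ge pw x y0 by (intro mult_right_mono weight_bound_input) auto
    also have "\<dots> = 1000000 * (\<bar>y\<bar> * \<bar>x + z\<bar> * (l * l2) powr (-r) + sqrt \<bar>y\<bar> * ((l * l2) powr (-r) * sqrt (max l l2))
        + lowf x y * (l powr r * (l * l2) powr (-r)))" by (simp only: distrib_left distrib_right mult_ac)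
    also have "\<dots> \<le> 1000000 * (mker \<zeta> \<eta> + mker \<eta> \<zeta>)"
      unfolding cancel[OF ge(1)] using parts(1,2) lowf_nonneg[of y x] unfolding m1 m2
      by (intro mult_left_mono) (auto simp: xyz ls)
    finally show ?thesis .
  qed
qed

lemma fker_commute: "fker p \<zeta> (\<zeta> - \<eta>) = fker p \<zeta> \<eta>"
  unfolding fker_def by (simp add: wgt_commute mult_ac)

text \<open>\<open>fker\<close> is invariant under \<eta> -> \<zeta> - \<eta>, which supplies the
  missing orderings. Vanishing input frequencies are excluded because
  \<open>0 powr (\<kappa> - 1)\<close> is 0, so the singular weight is not large there; they form a
  null set.\<close>

lemma fker_bound:
  assumes "snd \<eta> \<noteq> 0" "snd \<eta> \<noteq> snd \<zeta>" and p: "p \<le> r" and k: "\<kappa> - 1 = - p + 2 * (r - p)"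
  shows "fker p \<zeta> \<eta> \<le> 1000000 * (mker \<zeta> \<eta> + mker \<eta> \<zeta> + (mker \<zeta> (\<zeta> - \<eta>) + mker (\<zeta> - \<eta>) \<zeta>))"
proof -
  let ?\<theta> = "\<zeta> - \<eta>"
  have nn: "0 \<le> mker \<zeta> \<eta> + mker \<eta> \<zeta>" "0 \<le> mker \<zeta> ?\<theta> + mker ?\<theta> \<zeta>" using mker_nonneg by (auto intro: add_nonneg_nonneg)
  have e: "\<zeta> - ?\<theta> = \<eta>" by simp
  consider "(lam \<alpha> \<eta> \<le> lam \<alpha> \<zeta> \<and> lam \<alpha> ?\<theta> \<le> lam \<alpha> \<zeta> \<and> \<bar>snd ?\<theta>\<bar> \<le> \<bar>snd \<eta>\<bar>) \<or> (lam \<alpha> \<zeta> \<le> lam \<alpha> \<eta> \<and> lam \<alpha> ?\<theta> \<le> lam \<alpha> \<eta>)"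
    | "(lam \<alpha> ?\<theta> \<le> lam \<alpha> \<zeta> \<and> lam \<alpha> \<eta> \<le> lam \<alpha> \<zeta> \<and> \<bar>snd \<eta>\<bar> \<le> \<bar>snd ?\<theta>\<bar>) \<or> (lam \<alpha> \<zeta> \<le> lam \<alpha> ?\<theta> \<and> lam \<alpha> \<eta> \<le> lam \<alpha> ?\<theta>)"
    by linarith
  then show ?thesis
  proof cases
    case 1
    from fker_bound_ordered[OF assms(1) p k 1] nn show ?thesis by simp
  next
    case 2
    have "snd ?\<theta> \<noteq> 0" using assms(2) by simp
    from fker_bound_ordered[OF this p k, of \<zeta>, unfolded e, OF 2] nn show ?thesis by (simp add: fker_commute)
  qed
qed

end

section \<open>Reduction to the frequency exponent -\<rho> and the bilinear estimate\<close>

lemma jap_add_le: "jap (y + z) \<le> 2 * (jap y * jap z)"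
proof (rule real_le_lsqrt)
  have "0 \<le> (y - z)\<^sup>2" by simp
  then have "1 + (y + z)\<^sup>2 \<le> 1 + 2 * y\<^sup>2 + 2 * z\<^sup>2" by (simp add: power2_eq_square algebra_simps)
  also have "\<dots> \<le> 4 * ((1 + y\<^sup>2) * (1 + z\<^sup>2))" by (simp add: algebra_simps add_nonneg_nonneg)
  also have "\<dots> = (2 * (jap y * jap z))\<^sup>2" by (simp add: power_mult_distrib)
  finally show "1 + (y + z)\<^sup>2 \<le> (2 * (jap y * jap z))\<^sup>2" .
qed (auto simp: mult_nonneg_nonneg)

text \<open>Raising the exponent from -\<rho> to s costs <y+z>^(s+\<rho>), which is at most a
  constant times <y>^(s+\<rho>) <z>^(s+\<rho>). The extreme case is therefore s = -\<rho>.\<close>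

lemma frequency_weight_le:
  assumes "- \<rho> \<le> s"
  shows "jap (y + z) powr s * jap y powr (-s) * jap z powr (-s)
    \<le> 2 powr (s + \<rho>) * (jap (y + z) powr (-\<rho>) * jap y powr \<rho> * jap z powr \<rho>)"
proof -
  have "jap (y + z) powr (s + \<rho>) \<le> (2 * (jap y * jap z)) powr (s + \<rho>)"
    using assms jap_add_le[of y z] by (intro powr_mono2) auto
  also have "\<dots> = 2 powr (s + \<rho>) * (jap y powr (s + \<rho>) * jap z powr (s + \<rho>))"
    by (simp add: powr_mult)
  finally have main: "jap (y + z) powr (s + \<rho>) * (jap (y + z) powr (-\<rho>) * jap y powr (-s) * jap z powr (-s))
     \<le> 2 powr (s + \<rho>) * (jap y powr (s + \<rho>) * jap z powr (s + \<rho>)) * (jap (y + z) powr (-\<rho>) * jap y powr (-s) * jap z powr (-s))"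
    by (intro mult_right_mono mult_nonneg_nonneg) auto
  have e1: "jap (y + z) powr s = jap (y + z) powr (s + \<rho>) * jap (y + z) powr (-\<rho>)" by (simp flip: powr_add)
  have e2: "jap w powr \<rho> = jap w powr (s + \<rho>) * jap w powr (-s)" for w by (simp flip: powr_add)
  show ?thesis using main unfolding e1 e2[of y] e2[of z] by (simp only: mult_ac)
qed

context exponents begin

lemma sqrt_fker:
  "sqrt (fker p \<zeta> \<eta>) = \<bar>snd \<zeta>\<bar> * (jap (snd \<zeta>) powr (-\<rho>) * jap (snd \<eta>) powr \<rho> * jap (snd (\<zeta> - \<eta>)) powr \<rho>)
    * (lam \<alpha> \<zeta> powr (-p/2) * lam \<alpha> \<eta> powr (-p/2) * lam \<alpha> (\<zeta> - \<eta>) powr (-p/2))"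
proof -
  have sq: "sqrt (a powr t) = a powr (t / 2)" if "0 < a" for a t :: real
    using that by (simp add: powr_half_sqrt[symmetric] powr_powr)
  have l: "0 < lam \<alpha> \<zeta>" "0 < lam \<alpha> \<eta>" "0 < lam \<alpha> (\<zeta> - \<eta>)" by (rule lam_pos)+
  have "sqrt (fker p \<zeta> \<eta>) = \<bar>snd \<zeta>\<bar> * jap (snd \<zeta>) powr (-2*\<rho>/2) * jap (snd \<eta>) powr (2*\<rho>/2) * jap (snd (\<zeta> - \<eta>)) powr (2*\<rho>/2)
     * (lam \<alpha> \<zeta> * lam \<alpha> \<eta> * lam \<alpha> (\<zeta> - \<eta>)) powr (-p/2)"
    unfolding fker_def wgt_def real_sqrt_mult using l jap_pos by (simp only: sq real_sqrt_abs mult_pos_pos)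
  also have "(lam \<alpha> \<zeta> * lam \<alpha> \<eta> * lam \<alpha> (\<zeta> - \<eta>)) powr (-p/2) = lam \<alpha> \<zeta> powr (-p/2) * lam \<alpha> \<eta> powr (-p/2) * lam \<alpha> (\<zeta> - \<eta>) powr (-p/2)"
    using l by (intro powr_mult3) auto
  finally show ?thesis by simp
qed

text \<open>Subadditivity of the square root separates the four kernels, so that each can be treated
  by its own Cauchy-Schwarz inequality.\<close>

lemma sqrt_fker_le:
  assumes "snd \<eta> \<noteq> 0" "snd \<eta> \<noteq> snd \<zeta>" "p \<le> r" "\<kappa> - 1 = - p + 2 * (r - p)"
  shows "sqrt (fker p \<zeta> \<eta>) \<le> 1000 * (sqrt (mker \<zeta> \<eta>) + sqrt (mker \<eta> \<zeta>) + (sqrt (mker \<zeta> (\<zeta> - \<eta>)) + sqrt (mker (\<zeta> - \<eta>) \<zeta>)))"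
proof -
  have "sqrt (fker p \<zeta> \<eta>) \<le> sqrt (1000000 * (mker \<zeta> \<eta> + mker \<eta> \<zeta> + (mker \<zeta> (\<zeta> - \<eta>) + mker (\<zeta> - \<eta>) \<zeta>)))"
    by (intro real_sqrt_le_mono fker_bound assms)
  also have "\<dots> = sqrt (1000\<^sup>2) * sqrt (mker \<zeta> \<eta> + mker \<eta> \<zeta> + (mker \<zeta> (\<zeta> - \<eta>) + mker (\<zeta> - \<eta>) \<zeta>))"
  proof -
    have "(1000000::real) = 1000\<^sup>2" by simp
    then show ?thesis by (simp only: real_sqrt_mult)
  qed
  also have "\<dots> \<le> 1000 * (sqrt (mker \<zeta> \<eta> + mker \<eta> \<zeta>) + sqrt (mker \<zeta> (\<zeta> - \<eta>) + mker (\<zeta> - \<eta>) \<zeta>))"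
    unfolding real_sqrt_abs abs_numeral
    by (intro mult_left_mono sqrt_add_le_add_sqrt add_nonneg_nonneg mker_nonneg) simp
  also have "\<dots> \<le> 1000 * (sqrt (mker \<zeta> \<eta>) + sqrt (mker \<eta> \<zeta>) + (sqrt (mker \<zeta> (\<zeta> - \<eta>)) + sqrt (mker (\<zeta> - \<eta>) \<zeta>)))"
    by (intro mult_left_mono add_mono sqrt_add_le_add_sqrt mker_nonneg) auto
  finally show ?thesis .
qed

text \<open>Moving the weights of both inputs into the kernel turns the multiplier into a multiple
  of the square root of \<open>fker\<close>, acting on the weighted profiles of F and G, whose L^2
  norms are the X norms.\<close>

lemma bilinear_estimate:
  assumes s: "- \<rho> \<le> s" and p: "p \<le> r" "\<kappa> - 1 = - p + 2 * (r - p)"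
  shows "\<exists>C\<ge>0. \<forall>F G. F \<in> borel_measurable borel \<and> G \<in> borel_measurable borel \<longrightarrow>
    Xsq \<alpha> (-p/2) s (dx_prod F G) \<le> ennreal C * (Xsq \<alpha> (p/2) s F * Xsq \<alpha> (p/2) s G)"
proof -
  obtain Cm where Cm: "0 \<le> Cm" "\<And>\<zeta>. (\<integral>\<^sup>+\<eta>. ennreal (mker \<zeta> \<eta>) \<partial>lborel) \<le> ennreal Cm" using mker_bound by blast
  define c where "c = 2 powr (s + \<rho>) * 1000"
  have c: "0 \<le> c" by (simp add: c_def)
  define k where "k \<zeta> \<eta> = ennreal (sqrt (mker \<zeta> \<eta>))" for \<zeta> \<eta>
  have k_meas[measurable]: "case_prod k \<in> borel_measurable (borel \<Otimes>\<^sub>M borel)" unfolding k_def by measurable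
  have k_sq: "(\<integral>\<^sup>+\<eta>. (k \<zeta> \<eta>)\<^sup>2 \<partial>lborel) \<le> ennreal Cm" for \<zeta>
    unfolding k_def using Cm(2) mker_nonneg by (simp add: ennreal_power)
  have "Xsq \<alpha> (-p/2) s (dx_prod F G) \<le> ennreal (c\<^sup>2 * (16 * Cm)) * (Xsq \<alpha> (p/2) s F * Xsq \<alpha> (p/2) s G)"
    if [measurable]: "F \<in> borel_measurable borel" "G \<in> borel_measurable borel" for F G
  proof -
    define f where "f H \<zeta> = lam \<alpha> \<zeta> powr (p/2) * jap (snd \<zeta>) powr s * cmod (H \<zeta>)" for H and \<zeta>
    have f0: "0 \<le> f H \<zeta>" for H \<zeta> by (simp add: f_def)
    have fm: "f H \<in> borel_measurable borel" if [measurable]: "H \<in> borel_measurable borel" for H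
      unfolding f_def by measurable
    have [measurable]: "f F \<in> borel_measurable borel" "f G \<in> borel_measurable borel" by (auto intro: fm)
    have norm_f: "Xsq \<alpha> (p/2) s H = (\<integral>\<^sup>+\<eta>. (ennreal (f H \<eta>))\<^sup>2 \<partial>lborel)" for H
      unfolding Xsq_eq f_def by (simp add: ennreal_power)
    let ?S = "\<lambda>\<zeta> \<eta>. k \<zeta> \<eta> + k \<eta> \<zeta> + (k \<zeta> (\<zeta> - \<eta>) + k (\<zeta> - \<eta>) \<zeta>)"
    have ptw: "(lam \<alpha> \<zeta> powr (-p/2) * jap (snd \<zeta>) powr s * \<bar>snd \<zeta>\<bar>) * (cmod (F \<eta>) * cmod (G (\<zeta> - \<eta>)))
      \<le> c * (sqrt (mker \<zeta> \<eta>) + sqrt (mker \<eta> \<zeta>) + (sqrt (mker \<zeta> (\<zeta> - \<eta>)) + sqrt (mker (\<zeta> - \<eta>) \<zeta>))) * (f F \<eta> * f G (\<zeta> - \<eta>))"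
      if ne: "snd \<eta> \<noteq> 0" "snd \<eta> \<noteq> snd \<zeta>" for \<zeta> \<eta>
    proof -
      define y z where yz: "y = snd \<eta>" "z = snd (\<zeta> - \<eta>)"
      define l l1 l2 where ls: "l = lam \<alpha> \<zeta>" "l1 = lam \<alpha> \<eta>" "l2 = lam \<alpha> (\<zeta> - \<eta>)"
      define a b where ab: "a = cmod (F \<eta>)" "b = cmod (G (\<zeta> - \<eta>))"
      have x: "snd \<zeta> = y + z" by (simp add: yz)
      have unit: "w powr (-t) * w powr t = 1" if "0 < w" for w t :: real using that by (simp flip: powr_add)
      have l: "0 < l1" "0 < l2" by (simp_all add: ls lam_pos)
      have u: "l1 powr (-p/2) * l1 powr (p/2) = 1" "l2 powr (-p/2) * l2 powr (p/2) = 1"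
        "jap y powr (-s) * jap y powr s = 1" "jap z powr (-s) * jap z powr s = 1"
        using unit[OF l(1), of "p/2"] unit[OF l(2), of "p/2"] unit[OF jap_pos, of y s] unit[OF jap_pos, of z s] by simp_all
      \<comment> \<open>The extra factor is a product of four ones; half of each goes to the kernel
        and half to the weighted profiles.\<close>
      have "(l powr (-p/2) * jap (y + z) powr s * \<bar>y + z\<bar>) * (a * b)
        = (l powr (-p/2) * jap (y + z) powr s * \<bar>y + z\<bar>) * (a * b) *
           ((l1 powr (-p/2) * l1 powr (p/2)) * (l2 powr (-p/2) * l2 powr (p/2)) * (jap y powr (-s) * jap y powr s) * (jap z powr (-s) * jap z powr s))"
        unfolding u by simp
      also have "\<dots> = (\<bar>y + z\<bar> * (jap (y + z) powr s * jap y powr (-s) * jap z powr (-s)) * (l powr (-p/2) * l1 powr (-p/2) * l2 powr (-p/2)))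
          * ((l1 powr (p/2) * jap y powr s * a) * (l2 powr (p/2) * jap z powr s * b))" by (simp only: mult_ac)
      also have "\<dots> \<le> (\<bar>y + z\<bar> * (2 powr (s + \<rho>) * (jap (y + z) powr (-\<rho>) * jap y powr \<rho> * jap z powr \<rho>)) * (l powr (-p/2) * l1 powr (-p/2) * l2 powr (-p/2)))
          * ((l1 powr (p/2) * jap y powr s * a) * (l2 powr (p/2) * jap z powr s * b))"
        by (intro mult_right_mono mult_left_mono frequency_weight_le s mult_nonneg_nonneg) (auto simp: ab)
      also have "\<dots> = 2 powr (s + \<rho>) * sqrt (fker p \<zeta> \<eta>) * (f F \<eta> * f G (\<zeta> - \<eta>))"
        unfolding sqrt_fker f_def x by (simp only: yz ls ab mult_ac)
      also have "\<dots> \<le> 2 powr (s + \<rho>) * (1000 * (sqrt (mker \<zeta> \<eta>) + sqrt (mker \<eta> \<zeta>) + (sqrt (mker \<zeta> (\<zeta> - \<eta>)) + sqrt (mker (\<zeta> - \<eta>) \<zeta>)))) * (f F \<eta> * f G (\<zeta> - \<eta>))"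
        by (intro mult_right_mono mult_left_mono sqrt_fker_le ne p mult_nonneg_nonneg f0) auto
      finally show ?thesis unfolding x by (simp only: c_def ls ab mult.assoc)
    qed
    have inner: "ennreal (lam \<alpha> \<zeta> powr (-p/2) * jap (snd \<zeta>) powr s * cmod (dx_prod F G \<zeta>))
       \<le> ennreal c * (\<integral>\<^sup>+\<eta>. ?S \<zeta> \<eta> * (ennreal (f F \<eta>) * ennreal (f G (\<zeta> - \<eta>))) \<partial>lborel)" for \<zeta>
    proof -
      let ?w = "lam \<alpha> \<zeta> powr (-p/2) * jap (snd \<zeta>) powr s * \<bar>snd \<zeta>\<bar>"
      have w: "0 \<le> ?w" by simp
      have pi1: "1 \<le> (2 * pi)\<^sup>2" using pi_ge_two by (intro one_le_power) auto
      have "cmod (dx_prod F G \<zeta>) = \<bar>snd \<zeta>\<bar> / (2*pi)\<^sup>2 * cmod (LINT \<eta>|lborel. F \<eta> * G (\<zeta> - \<eta>))"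
        unfolding dx_prod_def by (simp add: norm_mult norm_divide norm_power)
      also have "\<dots> \<le> \<bar>snd \<zeta>\<bar> / 1 * cmod (LINT \<eta>|lborel. F \<eta> * G (\<zeta> - \<eta>))"
        using pi1 by (intro mult_right_mono divide_left_mono) auto
      finally have "lam \<alpha> \<zeta> powr (-p/2) * jap (snd \<zeta>) powr s * cmod (dx_prod F G \<zeta>) \<le> lam \<alpha> \<zeta> powr (-p/2) * jap (snd \<zeta>) powr s * (\<bar>snd \<zeta>\<bar> * cmod (LINT \<eta>|lborel. F \<eta> * G (\<zeta> - \<eta>)))"
        by (intro mult_left_mono) auto
      then have "ennreal (lam \<alpha> \<zeta> powr (-p/2) * jap (snd \<zeta>) powr s * cmod (dx_prod F G \<zeta>)) \<le> ennreal (?w * cmod (LINT \<eta>|lborel. F \<eta> * G (\<zeta> - \<eta>)))"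
        by (intro ennreal_leI) (simp only: mult.assoc)
      also have "\<dots> = ennreal ?w * ennreal (cmod (LINT \<eta>|lborel. F \<eta> * G (\<zeta> - \<eta>)))"
        by (rule ennreal_mult[OF w]) simp
      also have "\<dots> \<le> ennreal ?w * (\<integral>\<^sup>+\<eta>. ennreal (cmod (F \<eta> * G (\<zeta> - \<eta>))) \<partial>lborel)"
        by (intro mult_left_mono ennreal_norm_integral_le) auto
      also have "\<dots> = (\<integral>\<^sup>+\<eta>. ennreal ?w * ennreal (cmod (F \<eta> * G (\<zeta> - \<eta>))) \<partial>lborel)"
        by (rule nn_integral_cmult[symmetric]) measurable
      also have "\<dots> \<le> (\<integral>\<^sup>+\<eta>. ennreal c * (?S \<zeta> \<eta> * (ennreal (f F \<eta>) * ennreal (f G (\<zeta> - \<eta>)))) \<partial>lborel)"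
      proof (rule nn_integral_mono_AE)
        \<comment> \<open>The lines of vanishing input frequency are null sets, so the pointwise
          kernel bound holds for almost every \<eta>.\<close>
        have line: "AE \<eta> in lborel. snd \<eta> \<noteq> (a::real)" for a :: real
        proof -
          have "AE \<eta> in lborel \<Otimes>\<^sub>M lborel. snd \<eta> \<noteq> a"
          proof (intro lborel_pair.AE_pair_measure)
            show "{\<eta> \<in> space (lborel \<Otimes>\<^sub>M lborel). snd \<eta> \<noteq> a} \<in> sets (lborel \<Otimes>\<^sub>M lborel)" by measurable
          qed (simp add: AE_lborel_singleton)
          then show ?thesis unfolding lborel_prod .
        qed
        show "AE \<eta> in lborel. ennreal ?w * ennreal (cmod (F \<eta> * G (\<zeta> - \<eta>))) \<le> ennreal c * (?S \<zeta> \<eta> * (ennreal (f F \<eta>) * ennreal (f G (\<zeta> - \<eta>))))"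
          using line[of 0] line[of "snd \<zeta>"]
        proof eventually_elim
          case (elim \<eta>)
          let ?s = "sqrt (mker \<zeta> \<eta>) + sqrt (mker \<eta> \<zeta>) + (sqrt (mker \<zeta> (\<zeta> - \<eta>)) + sqrt (mker (\<zeta> - \<eta>) \<zeta>))"
          have s0: "0 \<le> ?s" using mker_nonneg by (intro add_nonneg_nonneg) auto
          have "ennreal ?w * ennreal (cmod (F \<eta> * G (\<zeta> - \<eta>))) = ennreal (?w * (cmod (F \<eta>) * cmod (G (\<zeta> - \<eta>))))"
            unfolding norm_mult by (rule ennreal_mult[symmetric, OF w]) simp
          also have "\<dots> \<le> ennreal (c * ?s * (f F \<eta> * f G (\<zeta> - \<eta>)))" by (rule ennreal_leI[OF ptw[OF elim]])
          also have "\<dots> = ennreal c * (ennreal ?s * (ennreal (f F \<eta>) * ennreal (f G (\<zeta> - \<eta>))))"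
            using c s0 f0 by (simp only: ennreal_mult mult_nonneg_nonneg mult.assoc)
          also have "ennreal ?s = ?S \<zeta> \<eta>"
            unfolding k_def using mker_nonneg by (simp only: ennreal_plus real_sqrt_ge_zero add_nonneg_nonneg)
          finally show ?case .
        qed
      qed
      also have "\<dots> = ennreal c * (\<integral>\<^sup>+\<eta>. ?S \<zeta> \<eta> * (ennreal (f F \<eta>) * ennreal (f G (\<zeta> - \<eta>))) \<partial>lborel)"
      proof (rule nn_integral_cmult)
        have [measurable]: "(\<lambda>\<eta>. k \<zeta> \<eta>) \<in> borel_measurable borel" "(\<lambda>\<eta>. k \<eta> \<zeta>) \<in> borel_measurable borel"
          "(\<lambda>\<eta>. k \<zeta> (\<zeta> - \<eta>)) \<in> borel_measurable borel" "(\<lambda>\<eta>. k (\<zeta> - \<eta>) \<zeta>) \<in> borel_measurable borel" by measurable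
        show "(\<lambda>\<eta>. ?S \<zeta> \<eta> * (ennreal (f F \<eta>) * ennreal (f G (\<zeta> - \<eta>)))) \<in> borel_measurable lborel" by measurable
      qed
      finally show ?thesis .
    qed
    have "Xsq \<alpha> (-p/2) s (dx_prod F G) = (\<integral>\<^sup>+\<zeta>. (ennreal (lam \<alpha> \<zeta> powr (-p/2) * jap (snd \<zeta>) powr s * cmod (dx_prod F G \<zeta>)))\<^sup>2 \<partial>lborel)"
      unfolding Xsq_eq by (simp add: ennreal_power)
    also have "\<dots> \<le> (\<integral>\<^sup>+\<zeta>. (ennreal c * (\<integral>\<^sup>+\<eta>. ?S \<zeta> \<eta> * (ennreal (f F \<eta>) * ennreal (f G (\<zeta> - \<eta>))) \<partial>lborel))\<^sup>2 \<partial>lborel)"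
      by (intro nn_integral_mono power_mono inner) auto
    also have "\<dots> = (ennreal c)\<^sup>2 * (\<integral>\<^sup>+\<zeta>. (\<integral>\<^sup>+\<eta>. ?S \<zeta> \<eta> * (ennreal (f F \<eta>) * ennreal (f G (\<zeta> - \<eta>))) \<partial>lborel)\<^sup>2 \<partial>lborel)"
      unfolding power_mult_distrib by (rule nn_integral_cmult) measurable
    also have "\<dots> \<le> (ennreal c)\<^sup>2 * (16 * ennreal Cm * (Xsq \<alpha> (p/2) s F * Xsq \<alpha> (p/2) s G))"
      unfolding norm_f by (intro mult_left_mono bilinear_symmetric k_sq) measurable
    also have "\<dots> = ennreal (c\<^sup>2 * (16 * Cm)) * (Xsq \<alpha> (p/2) s F * Xsq \<alpha> (p/2) s G)"
      using c Cm by (simp add: ennreal_mult ennreal_power mult.assoc)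
    finally show ?thesis .
  qed
  then show ?thesis using Cm by (intro exI[of _ "c\<^sup>2 * (16 * Cm)"]) auto
qed

end

section \<open>Combination of the time gain with the bilinear estimate\<close>

lemma Xsq_mono:
  assumes "b \<le> b'" shows "Xsq \<alpha> b s F \<le> Xsq \<alpha> b' s F"
  unfolding Xsq_eq using assms lam_ge1
  by (intro nn_integral_mono ennreal_leI power_mono mult_right_mono powr_mono) auto

theorem theorem1p1:
  fixes \<alpha> s :: real
  assumes "0 < \<alpha>" and "\<alpha> \<le> 1" and "s > s_alpha \<alpha>"
  shows "\<exists>\<nu>>0. \<exists>\<delta>>0. \<exists>C::real. \<forall>T>0. \<forall>F G.
           in_X \<alpha> (1/2) s F \<and> in_X \<alpha> (1/2) s G \<and> time_supp_in T F \<and> time_supp_in T G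
           \<longrightarrow> Xsq \<alpha> (-1/2 + \<delta>) s (dx_prod F G)
               \<le> ennreal ((C * T powr \<nu>)\<^sup>2) * Xsq \<alpha> (1/2) s F * Xsq \<alpha> (1/2) s G"
proof -
  obtain \<rho> \<kappa> where ex: "exponents \<alpha> \<rho> \<kappa> (max (\<alpha> - 1/2) 0) (1 + \<kappa>/8)" and s: "- \<rho> \<le> s"
    using exists_exponents[OF assms] by blast
  interpret exponents \<alpha> \<rho> \<kappa> "max (\<alpha> - 1/2) 0" "1 + \<kappa>/8" by (rule ex)
  \<comment> \<open>With p = 1 - 2e and r = 1 + \<kappa>/8, the relation \<kappa> - 1 = -p + 2(r -
    p) forces this value.\<close>
  define e where "e = \<kappa> / 8"
  have e: "0 < e" "e < 1/2" using kap by (auto simp: e_def)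
  have s1: "-1 < s" using s rho by linarith
  have p: "1 - 2 * e \<le> 1 + \<kappa>/8" "\<kappa> - 1 = - (1 - 2 * e) + 2 * ((1 + \<kappa>/8) - (1 - 2 * e))"
    using kap by (auto simp: e_def)
  obtain C1 where C1: "0 \<le> C1" and b: "\<And>F G. F \<in> borel_measurable borel \<Longrightarrow> G \<in> borel_measurable borel \<Longrightarrow>
      Xsq \<alpha> (-(1 - 2 * e)/2) s (dx_prod F G) \<le> ennreal C1 * (Xsq \<alpha> ((1 - 2 * e)/2) s F * Xsq \<alpha> ((1 - 2 * e)/2) s G)"
    using bilinear_estimate[OF s p] by blast
  obtain C2 where C2: "0 \<le> C2" and g: "\<And>T F. 0 < T \<Longrightarrow> in_X \<alpha> (1/2) s F \<Longrightarrow> time_supp_in T F \<Longrightarrow>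
      Xsq \<alpha> (1/2 - e) s F \<le> ennreal (C2 * T powr (2 * e)) * Xsq \<alpha> (1/2) s F"
    using time_localization_gain[OF s1 e, of \<alpha>] by blast
  have h: "-(1 - 2 * e)/2 = -1/2 + e" "(1 - 2 * e)/2 = 1/2 - e" by (auto simp: field_simps)
  have "Xsq \<alpha> (-1/2 + e) s (dx_prod F G) \<le> ennreal ((sqrt (C1 * C2) * T powr e)\<^sup>2) * Xsq \<alpha> (1/2) s F * Xsq \<alpha> (1/2) s G"
    if T: "0 < T" and F: "in_X \<alpha> (1/2) s F" "time_supp_in T F" and G: "in_X \<alpha> (1/2) s G" for T F G
  proof -
    have "Xsq \<alpha> (-1/2 + e) s (dx_prod F G) \<le> ennreal C1 * (Xsq \<alpha> (1/2 - e) s F * Xsq \<alpha> (1/2 - e) s G)"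
    proof -
      have "F \<in> borel_measurable borel" "G \<in> borel_measurable borel" using F G by (simp_all add: in_X_def)
      from b[OF this] show ?thesis by (simp only: h)
    qed
    \<comment> \<open>Lowering the modulation exponent of F from 1/2 to 1/2 - e is where T^(2e)
      enters. Squared norms are compared here, so the norm itself gains T^e.\<close>
    also have "\<dots> \<le> ennreal C1 * ((ennreal (C2 * T powr (2 * e)) * Xsq \<alpha> (1/2) s F) * Xsq \<alpha> (1/2) s G)"
      using T F e by (intro mult_left_mono mult_mono g Xsq_mono) auto
    also have "\<dots> = ennreal (C1 * (C2 * T powr (2 * e))) * Xsq \<alpha> (1/2) s F * Xsq \<alpha> (1/2) s G"
      using C1 C2 by (simp add: ennreal_mult mult.assoc)
    also have "C1 * (C2 * T powr (2 * e)) = (sqrt (C1 * C2) * T powr e)\<^sup>2"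
    proof -
      have "(T powr e)\<^sup>2 = T powr (2 * e)" by (simp add: power2_eq_square powr_add[symmetric])
      then show ?thesis using C1 C2 by (simp add: power_mult_distrib)
    qed
    finally show ?thesis .
  qed
  \<comment> \<open>The same \<open>e\<close> serves as the power of T and as the improvement of the
    output exponent.\<close>
  then show ?thesis using e(1) by (intro exI[of _ e] conjI exI[of _ "sqrt (C1 * C2)"]) auto
qed

end
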